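(* Let $\beta>0$ and $\tau_1,\tau_2>0$ be fixed, let $X_n^{i,\beta}:=\log(\det W_n^{i,\beta})-\mu^i_{\beta,n}$ for $i\in\{L,G,J\}$, and set $K_2^\beta=\frac8{\beta^2}+\frac9\beta+4$. There is a constant $K_1^\beta>0$, not depending on $n$, such that for each $i\in\{L,G,J\}$ and every $n\ge2$ (with, for $i=J$, $\lfloor n\tau_1\rfloor,\lfloor n\tau_2\rfloor\ge1$) $$d_{Kol}\left(X_n^{i,\beta}\sqrt{\frac\beta{2\log n}},\,\mathcal N(0,1)\right)\le C\left(\frac1{4K_2^\beta},1,K_1^\beta\right)\left(\frac\beta{2\log n}\right)^{1/2},$$ where $C(D,v,K_1)=\frac3{2\pi}\left(2^{v-1}\Gamma\left(\frac v2\right)K_1+\frac7D\sqrt{\frac\pi2}\right)$.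
   Context: Random determinants. (L) $\det W_n^{L,\beta}=\prod_{k=1}^n\lambda_k$, where $(\lambda_1,\dots,\lambda_n)$ has density on $(0,\infty)^n$ proportional to $\prod_{j<k}|\lambda_k-\lambda_j|^\beta\prod_{k=1}^n\lambda_k^{\beta/2-1}e^{-\lambda_k/2}$ ($\beta$-Laguerre ensemble). (G) $\det W_n^{G,\beta}$ is a random variable distributed as $\prod_{k=2}^n\rho_k$ with $\rho_k$ independent, $\rho_k\sim\mathrm{Beta}\left(\frac\beta2(n-k+1),\frac\beta2(k-1)\right)$ ($\beta$-Uniform Gram ensemble). (J) With $n_1=\lfloor n\tau_1\rfloor$, $n_2=\lfloor n\tau_2\rfloor$, $m=\min(n_1,n_2)$, $M=\max(n_1,n_2)$: $\det W_n^{J,\beta}=\prod_{k=1}^m\lambda_k$, where $(\lambda_1,\dots,\lambda_m)$ has density on $(0,1)^m$ proportional to $\prod_{j<k}|\lambda_k-\lambda_j|^\beta\prod_{k=1}^m\lambda_k^{\beta/2-1}(1-\lambda_k)^{\frac\beta2(M-m+1)-1}$ ($\beta$-Jacobi ensemble). Centerings: $\mu^L_{\beta,n}=(\frac12-\frac1\beta)\log n-n+n\log(\beta n)$; $\mu^G_{\beta,n}=(\frac12-\frac1\beta)\log n-n+\frac1\beta$; $\mu^J_{\beta,n}=(\frac12-\frac1\beta)\log n+(\frac12-\frac1\beta)\log\left(\frac{\tau_1\tau_2}{\tau_1+\tau_2}\right)-\varepsilon(\lfloor n\tau_1\rfloor,\lfloor n\tau_2\rfloor)-\varepsilon(\lfloor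 n\tau_2\rfloor,\lfloor n\tau_1\rfloor)$ with $\varepsilon(x,y)=x\log(1+\frac yx)$. $d_{Kol}(X,Y)=\sup_{x\in\mathbb{R}}|\mathbb{P}[X\le x]-\mathbb{P}[Y\le x]|$ is the Kolmogorov distance. The constant $K_1^\beta$ may depend on $\beta$ and, in the Jacobi case, on $\tau_1,\tau_2$. *)

theory Defs
  imports "HOL-Probability.Probability"
begin

text \<open>
  All random variables are represented by their laws on canonical spaces; the Kolmogorov
  distance only depends on the laws, through their distribution functions.
\<close>

definition kolmogorov_dist :: "real measure \<Rightarrow> real measure \<Rightarrow> real" where
  "kolmogorov_dist M N = (SUP x. \<bar>cdf M x - cdf N x\<bar>)"

text \<open>The probability measure whose density with respect to \<open>N\<close> is proportional to \<open>w\<close>;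
  meaningful when \<open>w\<close> is nonnegative with integral in \<open>(0, \<infinity>)\<close>.\<close>

definition proportional_density :: "'a measure \<Rightarrow> ('a \<Rightarrow> real) \<Rightarrow> 'a measure" where
  "proportional_density N w =
     density N (\<lambda>x. ennreal (w x) / (\<integral>\<^sup>+ y. ennreal (w y) \<partial>N))"

definition vandermonde_abs :: "nat \<Rightarrow> (nat \<Rightarrow> real) \<Rightarrow> real" where
  "vandermonde_abs n x = (\<Prod>k\<in>{1..n}. \<Prod>j\<in>{1..<k}. \<bar>x k - x j\<bar>)"

text \<open>Vectors \<open>(x\<^sub>1, \<dots>, x\<^sub>n)\<close> are points of the product space over the index set \<open>{1..n}\<close>.\<close>

definition laguerre_ensemble :: "real \<Rightarrow> nat \<Rightarrow> (nat \<Rightarrow> real) measure" where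
  "laguerre_ensemble \<beta> n =
     proportional_density (\<Pi>\<^sub>M k\<in>{1..n}. lborel)
       (\<lambda>x. vandermonde_abs n x powr \<beta> *
            (\<Prod>k\<in>{1..n}. indicator {0<..} (x k) * x k powr (\<beta> / 2 - 1) * exp (- x k / 2)))"

definition jacobi_ensemble :: "real \<Rightarrow> nat \<Rightarrow> nat \<Rightarrow> (nat \<Rightarrow> real) measure" where
  "jacobi_ensemble \<beta> n1 n2 =
     (let m = min n1 n2; M = max n1 n2 in
      proportional_density (\<Pi>\<^sub>M k\<in>{1..m}. lborel)
       (\<lambda>x. vandermonde_abs m x powr \<beta> *
            (\<Prod>k\<in>{1..m}. indicator {0<..<1} (x k) * x k powr (\<beta> / 2 - 1) *
               (1 - x k) powr (\<beta> / 2 * (real M - real m + 1) - 1))))"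

definition beta_distribution :: "real \<Rightarrow> real \<Rightarrow> real measure" where
  "beta_distribution a b =
     density lborel (\<lambda>x. ennreal (indicator {0<..<1} x *
       (x powr (a - 1) * (1 - x) powr (b - 1) / Beta a b)))"

definition laguerre_det :: "real \<Rightarrow> nat \<Rightarrow> real measure" where
  "laguerre_det \<beta> n = distr (laguerre_ensemble \<beta> n) borel (\<lambda>x. \<Prod>k\<in>{1..n}. x k)"

definition gram_det :: "real \<Rightarrow> nat \<Rightarrow> real measure" where
  "gram_det \<beta> n =
     distr (\<Pi>\<^sub>M k\<in>{2..n}. beta_distribution (\<beta> / 2 * (real n - real k + 1)) (\<beta> / 2 * (real k - 1)))
       borel (\<lambda>\<rho>. \<Prod>k\<in>{2..n}. \<rho> k)"

definition nfloor :: "nat \<Rightarrow> real \<Rightarrow> nat" where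
  "nfloor n \<tau> = nat \<lfloor>real n * \<tau>\<rfloor>"

definition jacobi_det :: "real \<Rightarrow> real \<Rightarrow> real \<Rightarrow> nat \<Rightarrow> real measure" where
  "jacobi_det \<beta> \<tau>1 \<tau>2 n =
     distr (jacobi_ensemble \<beta> (nfloor n \<tau>1) (nfloor n \<tau>2)) borel
       (\<lambda>x. \<Prod>k\<in>{1..min (nfloor n \<tau>1) (nfloor n \<tau>2)}. x k)"

definition mu_L :: "real \<Rightarrow> nat \<Rightarrow> real" where
  "mu_L \<beta> n = (1 / 2 - 1 / \<beta>) * ln (real n) - real n + real n * ln (\<beta> * real n)"

definition mu_G :: "real \<Rightarrow> nat \<Rightarrow> real" where
  "mu_G \<beta> n = (1 / 2 - 1 / \<beta>) * ln (real n) - real n + 1 / \<beta>"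

definition eps :: "real \<Rightarrow> real \<Rightarrow> real" where
  "eps x y = x * ln (1 + y / x)"

definition mu_J :: "real \<Rightarrow> real \<Rightarrow> real \<Rightarrow> nat \<Rightarrow> real" where
  "mu_J \<beta> \<tau>1 \<tau>2 n =
     (1 / 2 - 1 / \<beta>) * ln (real n) + (1 / 2 - 1 / \<beta>) * ln (\<tau>1 * \<tau>2 / (\<tau>1 + \<tau>2))
     - eps (real (nfloor n \<tau>1)) (real (nfloor n \<tau>2))
     - eps (real (nfloor n \<tau>2)) (real (nfloor n \<tau>1))"

text \<open>Law of \<open>(log W - \<mu>) * sqrt (\<beta> / (2 log n))\<close> when \<open>W\<close> has law \<open>D\<close>. The laws above
  are concentrated on the positive reals, so the value of \<open>ln\<close> elsewhere is irrelevant.\<close>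

definition rescaled_log_law :: "real \<Rightarrow> nat \<Rightarrow> real \<Rightarrow> real measure \<Rightarrow> real measure" where
  "rescaled_log_law \<beta> n \<mu> D =
     distr D borel (\<lambda>w. (ln w - \<mu>) * sqrt (\<beta> / (2 * ln (real n))))"

definition kol_const :: "real \<Rightarrow> real \<Rightarrow> real \<Rightarrow> real" where
  "kol_const D v K1 =
     3 / (2 * pi) * (2 powr (v - 1) * Gamma (v / 2) * K1 + 7 / D * sqrt (pi / 2))"

definition K2 :: "real \<Rightarrow> real" where
  "K2 \<beta> = 8 / \<beta>\<^sup>2 + 9 / \<beta> + 4"

end

theory Submission
  imports Defs
begin

text \<open>
  Write \<open>g = \<beta> / 2\<close>. All three determinants have, up to a deterministic factor and a limit, the same
  shape: they are products of independent beta variables with parameters \<open>(g k, b\<^sub>k)\<close>,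
  \<open>k = 1, 2, \<dots>\<close>. Hence the logarithm of the determinant is a sum of independent variables. The
  \<open>k\<close>-th of them has variance close to \<open>1 / (g k) - 1 / (g k + b\<^sub>k)\<close>, and its third absolute moment after
  centering is at most of the order of \<open>k\<close> to the power \<open>- 3 / 2\<close>. In the three ensembles the total variance
  is \<open>ln n / g\<close> up to a bounded error, whereas the third moments have a bounded sum. As \<open>K1\<close> may be chosen
  large, the theorem says that the Kolmogorov distance is at most a constant multiple of
  \<open>sqrt (g / ln n)\<close>. This is also the size of the effect of a bounded error in the centering, so
  centerings and variances matter only up to bounded errors.

  \<^emph>\<open>Law of the determinant.\<close> For the Gram ensemble the product structure is the definition. For the
  Jacobi density the moments of the determinant follow from Aomoto's proof of Selberg's integral formula: an
  integration by parts in one variable, symmetrised over the pairs of variables, gives a recursion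
  for the averages of \<open>x\<^sub>1 \<cdots> x\<^sub>k\<close> (\<open>aomoto_recursion\<close>). To have no singular integrands when
  \<open>\<beta>\<close> is small, each factor \<open>\<bar>x\<^sub>i - x\<^sub>j\<bar>\<close> is first replaced by the square root of
  \<open>(x\<^sub>i - x\<^sub>j)\<^sup>2 + e\<close>, and \<open>e\<close> tends to \<open>0\<close> at the end. The resulting moments are those of a product of
  beta variables, and moments determine a law on the unit interval (\<open>selberg_law\<close>). The Laguerre
  determinant is unbounded, and its moments grow too fast for such an argument; its law is obtained as a
  limit of rescaled Jacobi ensembles, where \<open>(1 - x / N)\<close> to the power \<open>N / 2\<close> tends to \<open>exp (- x / 2)\<close>
  (\<open>laguerre_limit\<close>). The normal approximation is uniform along these
  ensembles, so it survives the limit.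

  \<^emph>\<open>Normal approximation.\<close> The summands are exchanged for Gaussians one at a time
  (\<open>lindeberg_sum\<close>), with the test function \<open>y \<mapsto> Phi (x - y)\<close>, where \<open>Phi\<close> is the normal distribution
  function. At the exchange of the \<open>k\<close>-th summand the later ones have already become
  Gaussian, so that the test function has width \<open>t\<^sub>k\<close>, where \<open>t\<^sub>k\<^sup>2 = 1 +\<close> (the variance of the summands after
  \<open>k\<close>), and its derivatives are at most \<open>1 / t\<^sub>k\<close>. As \<open>1 / t\<^sub>k\<close> exceeds \<open>1 / t\<^sub>0\<close> at most by a factor of order
  \<open>k\<close> to the power \<open>1 / 4\<close>, the errors sum to \<open>O(1 / t\<^sub>0)\<close>: this order of the exchanges yields the rate
  without any estimate of characteristic functions. What is approximated in this way is the sum plus an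
  independent standard normal variable, which is removed by a smoothing inequality
  (\<open>gaussian_smoothing\<close>). Since the limiting distribution function is \<open>1 / t\<^sub>0\<close>-Lipschitz, this again
  costs \<open>O(1 / t\<^sub>0)\<close>.

  \<^emph>\<open>Constants.\<close> Stirling's formula and the harmonic sum, both with bounded error, show that the
  centerings and variances of the three products agree with those of the theorem.
\<close>

section \<open>Beta distributions\<close>

lemma beta_distribution_sets [simp, measurable_cong]: "sets (beta_distribution a b) = sets borel"
  by (simp add: beta_distribution_def)

lemma beta_distribution_space [simp]: "space (beta_distribution a b) = UNIV"
  by (simp add: beta_distribution_def)

lemma Beta_real_pos:
  fixes a b :: real
  assumes "a > 0" "b > 0"
  shows "Beta a b > 0"
  using assms by (simp add: Beta_def Gamma_real_pos)

lemma beta_density_integrable: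
  fixes a b :: real
  assumes "a > 0" "b > 0"
  shows "integrable lborel (\<lambda>x. indicator {0<..<1} x * (x powr (a - 1) * (1 - x) powr (b - 1)))"
proof -
  have "set_integrable lborel {0<..<1} (\<lambda>x. x powr (a - 1) * (1 - x) powr (b - 1))"
    by (rule set_integrable_subset[OF integrable_Beta[OF assms]]) auto
  then show ?thesis by (simp add: set_integrable_def)
qed

lemma beta_density_integral:
  fixes a b :: real
  assumes "a > 0" "b > 0"
  shows "(\<integral>x. indicator {0<..<1} x * (x powr (a - 1) * (1 - x) powr (b - 1)) \<partial>lborel) = Beta a b"
proof -
  have "(\<integral>x. indicator {0<..<1} x * (x powr (a - 1) * (1 - x) powr (b - 1)) \<partial>lborel)
      = (LINT x:{0..1}|lborel. x powr (a - 1) * (1 - x) powr (b - 1))"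
    unfolding set_lebesgue_integral_def
    by (rule integral_cong_AE)
      (auto intro!: AE_I[where N="{0,1}"] simp: indicator_def emeasure_lborel_countable)
  also have "\<dots> = integral {0..1} (\<lambda>x. x powr (a - 1) * (1 - x) powr (b - 1))"
    by (rule set_borel_integral_eq_integral(2)[OF integrable_Beta[OF assms]])
  also have "\<dots> = Beta a b"
    using has_integral_Beta_real[OF assms] by (rule integral_unique)
  finally show ?thesis .
qed

lemma beta_distribution_integral:
  fixes a b :: real
  assumes "a > 0" "b > 0" and [measurable]: "f \<in> borel_measurable borel"
  shows "(\<integral>x. f x \<partial>beta_distribution a b)
       = (\<integral>x. indicator {0<..<1} x * (x powr (a - 1) * (1 - x) powr (b - 1)) * f x \<partial>lborel) / Beta a b"
proof -
  have "(\<integral>x. f x \<partial>beta_distribution a b)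
      = (\<integral>x. (indicator {0<..<1} x * (x powr (a - 1) * (1 - x) powr (b - 1) / Beta a b)) *\<^sub>R f x \<partial>lborel)"
    unfolding beta_distribution_def
    using Beta_real_pos[OF assms(1,2)] by (subst integral_density) (auto intro!: mult_nonneg_nonneg)
  also have "\<dots> = (\<integral>x. indicator {0<..<1} x * (x powr (a - 1) * (1 - x) powr (b - 1)) * f x / Beta a b \<partial>lborel)"
    by (intro Bochner_Integration.integral_cong) auto
  finally show ?thesis by simp
qed

lemma prob_space_beta_distribution:
  fixes a b :: real
  assumes "a > 0" "b > 0"
  shows "prob_space (beta_distribution a b)"
proof
  have "emeasure (beta_distribution a b) (space (beta_distribution a b))
      = (\<integral>\<^sup>+x. ennreal (indicator {0<..<1} x * (x powr (a - 1) * (1 - x) powr (b - 1) / Beta a b)) \<partial>lborel)"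
    unfolding beta_distribution_def by (subst emeasure_density) auto
  also have "\<dots> = ennreal (\<integral>x. indicator {0<..<1} x * (x powr (a - 1) * (1 - x) powr (b - 1) / Beta a b) \<partial>lborel)"
    using beta_density_integrable[OF assms] Beta_real_pos[OF assms]
    by (intro nn_integral_eq_integral) auto
  also have "(\<lambda>x. indicator {0<..<1} x * (x powr (a - 1) * (1 - x) powr (b - 1) / Beta a b))
     = (\<lambda>x. (indicator {0<..<1} x * (x powr (a - 1) * (1 - x) powr (b - 1))) / Beta a b)" by auto
  also have "(\<integral>x. (indicator {0<..<1} x * (x powr (a - 1) * (1 - x) powr (b - 1))) / Beta a b \<partial>lborel) = 1"
    using Beta_real_pos[OF assms] by (subst integral_divide_zero) (simp add: beta_density_integral[OF assms])
  finally show "emeasure (beta_distribution a b) (space (beta_distribution a b)) = 1" by simp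
qed

lemma AE_beta_distribution: "AE x in beta_distribution a b. 0 < x \<and> x < 1"
  unfolding beta_distribution_def
  by (subst AE_density) (auto simp: indicator_def)

text \<open>Multiplied by the beta density, the integrand is a constant multiple of the derivative of
  \<open>x powr a * (1 - x) powr b * F x\<close>, which vanishes at both end points. This integration by parts yields
  both the recursion of Aomoto and the moments of a single beta variable.\<close>

lemma beta_distribution_stein:
  fixes a b :: real
  assumes ab: "a > 0" "b > 0"
    and F: "\<And>x. (F has_real_derivative F' x) (at x)"
    and F': "continuous_on UNIV F'"
  shows "(\<integral>x. x * (1 - x) * F' x + (a - (a + b) * x) * F x \<partial>beta_distribution a b) = 0"
proof -
  have cF: "continuous_on UNIV F"
    using F by (meson DERIV_isCont continuous_at_imp_continuous_on)
  have [measurable]: "F \<in> borel_measurable borel" "F' \<in> borel_measurable borel"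
    using cF F' by (auto intro: borel_measurable_continuous_onI)
  define h where "h x = x * (1 - x) * F' x + (a - (a + b) * x) * F x" for x
  have [measurable]: "h \<in> borel_measurable borel" unfolding h_def by measurable
  have ch: "continuous_on UNIV h"
    unfolding h_def using cF F' by (intro continuous_intros) auto
  define G where "G x = x powr a * (1 - x) powr b * F x" for x
  define g where "g x = x powr (a - 1) * (1 - x) powr (b - 1) * h x" for x
  have "bounded (h ` {0..1})"
    using ch by (intro compact_imp_bounded compact_continuous_image) (auto intro: continuous_on_subset)
  then obtain K where K: "\<And>x. x \<in> {0..1} \<Longrightarrow> \<bar>h x\<bar> \<le> K"
    unfolding bounded_iff real_norm_def by blast
  have K0: "K \<ge> 0" using K[of 0] by auto
  have int: "set_integrable lborel (einterval 0 1) g"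
    unfolding set_integrable_def
  proof (rule Bochner_Integration.integrable_bound)
    show "integrable lborel (\<lambda>x. K * (indicator {0<..<1} x * (x powr (a - 1) * (1 - x) powr (b - 1))))"
      by (intro integrable_mult_right beta_density_integrable ab)
    show "(\<lambda>x. indicat_real (einterval 0 1) x *\<^sub>R g x) \<in> borel_measurable lborel"
      unfolding g_def by measurable
    show "AE x in lborel. norm (indicat_real (einterval 0 1) x *\<^sub>R g x)
       \<le> norm (K * (indicator {0<..<1} x * (x powr (a - 1) * (1 - x) powr (b - 1))))"
    proof (rule AE_I2)
      fix x :: real
      show "norm (indicat_real (einterval 0 1) x *\<^sub>R g x)
       \<le> norm (K * (indicator {0<..<1} x * (x powr (a - 1) * (1 - x) powr (b - 1))))"
      proof (cases "x \<in> {0<..<1}")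
        case True
        then show ?thesis
          using K[of x] K0
          by (auto simp: g_def abs_mult einterval_def indicator_def mult.commute[of K]
              intro!: mult_left_mono)
      next
        case False
        then show ?thesis by (auto simp: einterval_def indicator_def zero_ereal_def one_ereal_def)
      qed
    qed
  qed
  have d: "(G has_real_derivative g x) (at x)" if "0 < x" "x < 1" for x
  proof -
    have "(G has_real_derivative (x powr a * (- (b * (1 - x) powr (b - 1))) + a * x powr (a - 1) * (1 - x) powr b) * F x
        + x powr a * (1 - x) powr b * F' x) (at x)"
      unfolding G_def using that F[of x]
      by (auto intro!: derivative_eq_intros simp: field_simps)
    moreover have "x powr a = x * x powr (a - 1)" "(1 - x) powr b = (1 - x) * (1 - x) powr (b - 1)"
      using that by (simp_all add: powr_diff)
    ultimately show ?thesis
      by (simp add: g_def h_def algebra_simps)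
  qed
  have cF': "(F \<longlongrightarrow> F x) (at x within A)" for x A
    using cF by (meson UNIV_I continuous_on_def subset_UNIV tendsto_within_subset)
  have lim0: "(G \<longlongrightarrow> 0) (at_right 0)"
  proof -
    have "((\<lambda>x. x powr a) \<longlongrightarrow> 0 powr a) (at_right (0::real))"
      using ab by (intro tendsto_powr2 tendsto_intros)
        (auto intro: eventually_mono[OF eventually_at_right_less])
    moreover have "((\<lambda>x. (1 - x) powr b) \<longlongrightarrow> (1 - 0) powr b) (at_right (0::real))"
      by (intro tendsto_intros) auto
    ultimately have "((\<lambda>x. x powr a * (1 - x) powr b * F x) \<longlongrightarrow> 0 powr a * (1 - 0) powr b * F 0) (at_right 0)"
      by (intro tendsto_mult cF')
    then show ?thesis using ab by (simp add: G_def[abs_def])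
  qed
  have lim1: "(G \<longlongrightarrow> 0) (at_left 1)"
  proof -
    have "((\<lambda>x. (1 - x) powr b) \<longlongrightarrow> (1 - 1) powr b) (at_left (1::real))"
      using ab by (intro tendsto_powr2 tendsto_intros)
        (auto simp: eventually_at_filter)
    moreover have "((\<lambda>x. x powr a) \<longlongrightarrow> 1 powr a) (at_left (1::real))"
      by (intro tendsto_intros) auto
    ultimately have "((\<lambda>x. x powr a * (1 - x) powr b * F x) \<longlongrightarrow> 1 powr a * (1 - 1) powr b * F 1) (at_left 1)"
      by (intro tendsto_mult cF')
    then show ?thesis using ab by (simp add: G_def[abs_def])
  qed
  have "(LBINT x=0..1. g x) = 0 - 0"
  proof (rule interval_integral_FTC_integrable[OF _ _ _ int, where F=G])
    show "(0::ereal) < 1" by simp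
    fix x assume x: "(0::ereal) < ereal x" "ereal x < 1"
    then have x': "0 < x" "x < 1" by auto
    show "(G has_vector_derivative g x) (at x)"
      using d[OF x'] by (simp add: has_real_derivative_iff_has_vector_derivative)
    have "isCont h x" using ch by (simp add: continuous_on_eq_continuous_at)
    then show "isCont g x" unfolding g_def using x'
      by (intro continuous_intros) auto
  next
    show "((G \<circ> real_of_ereal) \<longlongrightarrow> 0) (at_right 0)"
      using lim0 by (simp add: ereal_tendsto_simps zero_ereal_def)
    show "((G \<circ> real_of_ereal) \<longlongrightarrow> 0) (at_left 1)"
      using lim1 by (simp add: ereal_tendsto_simps one_ereal_def)
  qed
  moreover have "(LBINT x=0..1. g x) = (\<integral>x. indicator {0<..<1} x * (x powr (a - 1) * (1 - x) powr (b - 1)) * h x \<partial>lborel)"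
  proof -
    have "(LBINT x=0..1. g x) = (LBINT x=ereal 0..ereal 1. g x)" by (simp add: zero_ereal_def one_ereal_def)
    also have "\<dots> = (\<integral>x. indicator {0<..<1} x *\<^sub>R g x \<partial>lborel)"
      unfolding interval_integral_Ioo[of "0::real" 1 g, simplified] set_lebesgue_integral_def
      by (simp add: set_lebesgue_integral_def interval_integral_Ioo)
    finally show ?thesis by (simp add: g_def mult_ac)
  qed
  ultimately show ?thesis
    using ab by (subst beta_distribution_integral) (auto simp: h_def[symmetric])
qed

section \<open>Aomoto's recursion for Selberg averages\<close>

abbreviation off_diagonal :: "'i set \<Rightarrow> ('i \<times> 'i) set" where
  "off_diagonal I \<equiv> {(i, j). i \<in> I \<and> j \<in> I \<and> i \<noteq> j}"

text \<open>For \<open>e = 0\<close> this is the absolute Vandermonde determinant to the power \<open>2 g\<close>: every unordered pair occurs twice,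
  and \<open>(d\<^sup>2) powr (g / 2)\<close> is \<open>\<bar>d\<bar> powr g\<close>. For \<open>e > 0\<close> it is smooth for every \<open>g > 0\<close>. The product over
  ordered pairs makes the symmetry in the variables evident.\<close>

definition reg_vandermonde :: "'i set \<Rightarrow> real \<Rightarrow> real \<Rightarrow> ('i \<Rightarrow> real) \<Rightarrow> real" where
  "reg_vandermonde I g e x =
     (\<Prod>(i, j)\<in>off_diagonal I. ((x i - x j)\<^sup>2 + e) powr (g / 2))"

text \<open>The derivative of \<open>ln (d\<^sup>2 + e) / 2\<close>; it replaces \<open>1 / d\<close>, is odd and, for fixed \<open>e > 0\<close>, bounded, and satisfies
  \<open>d * reg_inverse d e = reg_one d e\<close>.\<close>

abbreviation reg_inverse :: "real \<Rightarrow> real \<Rightarrow> real" where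
  "reg_inverse d e \<equiv> d / (d\<^sup>2 + e)"

abbreviation reg_one :: "real \<Rightarrow> real \<Rightarrow> real" where
  "reg_one d e \<equiv> d\<^sup>2 / (d\<^sup>2 + e)"

lemma finite_off_diagonal [simp]: "finite I \<Longrightarrow> finite (off_diagonal I)"
  by (rule finite_subset[of _ "I \<times> I"]) auto

lemma reg_vandermonde_nonneg: "reg_vandermonde I g e x \<ge> 0"
  unfolding reg_vandermonde_def by (intro prod_nonneg) auto

lemma reg_vandermonde_split:
  assumes "finite I" "k \<in> I"
  shows "reg_vandermonde I g e x
    = (\<Prod>j\<in>I - {k}. ((x k - x j)\<^sup>2 + e) powr g) * reg_vandermonde (I - {k}) g e x"
proof -
  let ?h = "\<lambda>(i, j). ((x i - x j)\<^sup>2 + e) powr (g / 2)"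
  let ?Q = off_diagonal
  have Q: "?Q I = (Pair k ` (I - {k}) \<union> (\<lambda>j. (j, k)) ` (I - {k})) \<union> ?Q (I - {k})"
    using assms by auto
  have "prod ?h (?Q I) = prod ?h (Pair k ` (I - {k}) \<union> (\<lambda>j. (j, k)) ` (I - {k})) * prod ?h (?Q (I - {k}))"
    unfolding Q using assms finite_off_diagonal[of "I - {k}"] by (intro prod.union_disjoint) auto
  also have "prod ?h (Pair k ` (I - {k}) \<union> (\<lambda>j. (j, k)) ` (I - {k}))
      = prod ?h (Pair k ` (I - {k})) * prod ?h ((\<lambda>j. (j, k)) ` (I - {k}))"
    using assms by (intro prod.union_disjoint) auto
  also have "prod ?h (Pair k ` (I - {k})) = (\<Prod>j\<in>I - {k}. ((x k - x j)\<^sup>2 + e) powr (g / 2))"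
    by (subst prod.reindex) (auto simp: inj_on_def)
  also have "prod ?h ((\<lambda>j. (j, k)) ` (I - {k})) = (\<Prod>j\<in>I - {k}. ((x k - x j)\<^sup>2 + e) powr (g / 2))"
    by (subst prod.reindex) (auto simp: inj_on_def power2_commute)
  also have "(\<Prod>j\<in>I - {k}. ((x k - x j)\<^sup>2 + e) powr (g / 2)) * (\<Prod>j\<in>I - {k}. ((x k - x j)\<^sup>2 + e) powr (g / 2))
      = (\<Prod>j\<in>I - {k}. ((x k - x j)\<^sup>2 + e) powr g)"
    by (simp add: prod.distrib[symmetric] powr_add[symmetric])
  finally show ?thesis unfolding reg_vandermonde_def .
qed

abbreviation swap :: "'i \<Rightarrow> 'i \<Rightarrow> 'i \<Rightarrow> 'i" where
  "swap \<equiv> Transposition.transpose"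

lemma reg_vandermonde_swap:
  assumes "finite I" "j \<in> I" "k \<in> I"
  shows "reg_vandermonde I g e (\<lambda>i\<in>I. x (swap j k i)) = reg_vandermonde I g e x"
proof -
  let ?t = "swap j k"
  have tI: "?t i \<in> I \<longleftrightarrow> i \<in> I" for i
    using assms by (auto simp: Transposition.transpose_def)
  have "bij_betw (map_prod ?t ?t) (off_diagonal I) (off_diagonal I)"
    by (rule bij_betwI[where g = "map_prod ?t ?t"])
      (auto simp: tI dest: injD[OF Transposition.inj_transpose])
  from prod.reindex_bij_betw[OF this, of "\<lambda>(i, j). ((x i - x j)\<^sup>2 + e) powr (g / 2)"]
  have "reg_vandermonde I g e x = (\<Prod>q\<in>off_diagonal I.
     (case map_prod ?t ?t q of (i, j) \<Rightarrow> ((x i - x j)\<^sup>2 + e) powr (g / 2)))"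
    unfolding reg_vandermonde_def by simp
  also have "\<dots> = reg_vandermonde I g e (\<lambda>i\<in>I. x (?t i))"
    unfolding reg_vandermonde_def by (rule prod.cong) auto
  finally show ?thesis by simp
qed

lemma prod_swap:
  assumes "S \<subseteq> I" "j \<in> I" "k \<in> I"
  shows "(\<Prod>i\<in>S. (\<lambda>i\<in>I. x (swap j k i)) i) = (\<Prod>i\<in>swap j k ` S. x i :: real)"
proof -
  have "(\<Prod>i\<in>swap j k ` S. x i) = (\<Prod>i\<in>S. x (swap j k i))"
    by (subst prod.reindex) (auto simp: inj_on_def dest: injD[OF Transposition.inj_transpose])
  also have "\<dots> = (\<Prod>i\<in>S. (\<lambda>i\<in>I. x (swap j k i)) i)"
    using assms by (intro prod.cong) auto
  finally show ?thesis by simp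
qed

text \<open>Measurable functions that are bounded on the open cube are integrable for a product of beta
  distributions. Closure of this class under the algebraic operations discharges the integrability
  conditions below.\<close>

definition cube_bounded :: "'i set \<Rightarrow> (('i \<Rightarrow> real) \<Rightarrow> real) \<Rightarrow> bool" where
  "cube_bounded I h \<longleftrightarrow> h \<in> borel_measurable (\<Pi>\<^sub>M i\<in>I. borel) \<and>
     (\<exists>C. \<forall>x. (\<forall>i\<in>I. 0 < x i \<and> x i < 1) \<longrightarrow> \<bar>h x\<bar> \<le> C)"

named_theorems cube_bounded_intros

lemma cube_boundedI:
  assumes "h \<in> borel_measurable (\<Pi>\<^sub>M i\<in>I. borel)"
    and "\<And>x. (\<And>i. i \<in> I \<Longrightarrow> 0 < x i \<and> x i < 1) \<Longrightarrow> \<bar>h x\<bar> \<le> C"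
  shows "cube_bounded I h"
  using assms unfolding cube_bounded_def by blast

lemma cube_bounded_measurable: "cube_bounded I h \<Longrightarrow> h \<in> borel_measurable (\<Pi>\<^sub>M i\<in>I. borel)"
  by (simp add: cube_bounded_def)

lemma cube_bounded_const [cube_bounded_intros]: "cube_bounded I (\<lambda>x. c)"
  by (rule cube_boundedI[where C = "\<bar>c\<bar>"]) auto

lemma cube_bounded_coord [cube_bounded_intros]: "i \<in> I \<Longrightarrow> cube_bounded I (\<lambda>x. x i)"
  by (rule cube_boundedI[where C = 1]) force+

lemma cube_bounded_add [cube_bounded_intros]:
  assumes "cube_bounded I f" "cube_bounded I h"
  shows "cube_bounded I (\<lambda>x. f x + h x)"
proof -
  obtain C D where "\<And>x. (\<forall>i\<in>I. 0 < x i \<and> x i < 1) \<Longrightarrow> \<bar>f x\<bar> \<le> C"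
     "\<And>x. (\<forall>i\<in>I. 0 < x i \<and> x i < 1) \<Longrightarrow> \<bar>h x\<bar> \<le> D"
    using assms unfolding cube_bounded_def by blast
  then show ?thesis using assms[THEN cube_bounded_measurable]
    by (intro cube_boundedI[where C = "C + D"])
      (auto intro!: order_trans[OF abs_triangle_ineq] add_mono)
qed

lemma cube_bounded_mult [cube_bounded_intros]:
  assumes "cube_bounded I f" "cube_bounded I h"
  shows "cube_bounded I (\<lambda>x. f x * h x)"
proof -
  obtain C D where "\<And>x. (\<forall>i\<in>I. 0 < x i \<and> x i < 1) \<Longrightarrow> \<bar>f x\<bar> \<le> C"
     "\<And>x. (\<forall>i\<in>I. 0 < x i \<and> x i < 1) \<Longrightarrow> \<bar>h x\<bar> \<le> D"
    using assms unfolding cube_bounded_def by blast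
  then show ?thesis using assms[THEN cube_bounded_measurable]
    by (intro cube_boundedI[where C = "C * D"])
      (auto simp: abs_mult intro!: mult_mono order_trans[OF abs_ge_zero])
qed

lemma cube_bounded_diff [cube_bounded_intros]:
  assumes "cube_bounded I f" "cube_bounded I h"
  shows "cube_bounded I (\<lambda>x. f x - h x)"
  using cube_bounded_add[OF assms(1) cube_bounded_mult[OF cube_bounded_const[of I "-1"] assms(2)]]
  by simp

lemma cube_bounded_sum [cube_bounded_intros]:
  "(\<And>i. i \<in> A \<Longrightarrow> cube_bounded I (f i)) \<Longrightarrow> cube_bounded I (\<lambda>x. \<Sum>i\<in>A. f i x)"
  by (induction A rule: infinite_finite_induct) (auto intro: cube_bounded_intros)

lemma cube_bounded_prod [cube_bounded_intros]:
  "(\<And>i. i \<in> A \<Longrightarrow> cube_bounded I (f i)) \<Longrightarrow> cube_bounded I (\<lambda>x. \<Prod>i\<in>A. f i x)"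
  by (induction A rule: infinite_finite_induct) (auto intro: cube_bounded_intros)

lemma cube_bounded_power [cube_bounded_intros]:
  "cube_bounded I f \<Longrightarrow> cube_bounded I (\<lambda>x. f x ^ (p::nat))"
  by (induction p) (auto intro: cube_bounded_intros)

lemma cube_diff_le_1:
  fixes x y :: real
  assumes "0 < x \<and> x < 1" "0 < y \<and> y < 1"
  shows "\<bar>x - y\<bar> \<le> 1" "(x - y)\<^sup>2 \<le> 1"
proof -
  show 1: "\<bar>x - y\<bar> \<le> 1" using assms by auto
  then show "(x - y)\<^sup>2 \<le> 1" using abs_square_le_1 by blast
qed

lemma reg_vandermonde_le:
  assumes "finite I" "0 \<le> e" "e \<le> 1" "0 \<le> g" and x: "\<And>i. i \<in> I \<Longrightarrow> 0 < x i \<and> x i < 1"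
  shows "reg_vandermonde I g e x \<le> (\<Prod>q\<in>off_diagonal I. 2 powr (g / 2))"
  unfolding reg_vandermonde_def
proof (rule prod_mono, clarify, rule conjI)
  fix i j assume ij: "i \<in> I" "j \<in> I"
  show "((x i - x j)\<^sup>2 + e) powr (g / 2) \<le> 2 powr (g / 2)"
    using cube_diff_le_1(2)[of "x i" "x j"] x ij assms by (intro powr_mono2) auto
qed auto

lemma reg_vandermonde_measurable [measurable]:
  "reg_vandermonde I g e \<in> borel_measurable (\<Pi>\<^sub>M i\<in>I. borel)"
proof -
  have "(\<lambda>x. \<Prod>q\<in>off_diagonal I. ((x (fst q) - x (snd q))\<^sup>2 + e) powr (g / 2))
      \<in> borel_measurable (\<Pi>\<^sub>M i\<in>I. borel)"
  proof (rule borel_measurable_prod)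
    fix q :: "'a \<times> 'a"
    assume "q \<in> off_diagonal I"
    then have [simp]: "fst q \<in> I" "snd q \<in> I" by auto
    show "(\<lambda>x. ((x (fst q) - x (snd q))\<^sup>2 + e) powr (g / 2)) \<in> borel_measurable (\<Pi>\<^sub>M i\<in>I. borel)"
      by measurable
  qed
  then show ?thesis by (simp add: reg_vandermonde_def[abs_def] case_prod_beta)
qed

lemma cube_bounded_reg_vandermonde [cube_bounded_intros]:
  assumes "finite I" "0 \<le> e" "e \<le> 1" "0 \<le> g"
  shows "cube_bounded I (reg_vandermonde I g e)"
  using reg_vandermonde_le[OF assms] reg_vandermonde_nonneg[of I g e]
  by (intro cube_boundedI[OF reg_vandermonde_measurable]) auto

lemma cube_bounded_reg_inverse [cube_bounded_intros]:
  assumes "i \<in> I" "j \<in> I" "0 < e"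
  shows "cube_bounded I (\<lambda>x. reg_inverse (x i - x j) e)"
proof (rule cube_boundedI[where C = "1 / e"])
  show "(\<lambda>x. reg_inverse (x i - x j) e) \<in> borel_measurable (\<Pi>\<^sub>M i\<in>I. borel)"
    using assms by measurable
next
  fix x :: "'a \<Rightarrow> real"
  assume "\<And>i. i \<in> I \<Longrightarrow> 0 < x i \<and> x i < 1"
  then have "\<bar>x i - x j\<bar> \<le> 1" using assms cube_diff_le_1 by blast
  moreover have "0 < (x i - x j)\<^sup>2 + e" using assms by (simp add: add_nonneg_pos)
  ultimately show "\<bar>reg_inverse (x i - x j) e\<bar> \<le> 1 / e"
    using assms by (auto simp: abs_divide intro!: frac_le)
qed

lemma cube_bounded_reg_one [cube_bounded_intros]:
  assumes "i \<in> I" "j \<in> I" "0 \<le> e"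
  shows "cube_bounded I (\<lambda>x. reg_one (x i - x j) e)"
proof (rule cube_boundedI[where C = 1])
  show "(\<lambda>x. reg_one (x i - x j) e) \<in> borel_measurable (\<Pi>\<^sub>M i\<in>I. borel)"
    using assms by measurable
next
  fix x :: "'a \<Rightarrow> real"
  show "\<bar>reg_one (x i - x j) e\<bar> \<le> 1"
  proof (cases "(x i - x j)\<^sup>2 + e = 0")
    case False
    then have "0 < (x i - x j)\<^sup>2 + e" using assms by (simp add: order_less_le)
    then show ?thesis using assms by simp
  qed simp
qed

text \<open>The \<open>p\<close>-th power of the product of all variables is carried along in the integrands, so that the
  recursion for a fixed reference measure gives all integer moments of the product.\<close>

locale beta_cube =
  fixes I :: "'i set" and a b g :: real and p :: nat
  assumes fin [simp]: "finite I" and a: "a > 0" and b: "b > 0" and g: "g > 0"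
begin

abbreviation "B \<equiv> beta_distribution a b"
abbreviation "P \<equiv> (\<Pi>\<^sub>M i\<in>I. B)"

sublocale B: prob_space B
  by (rule prob_space_beta_distribution[OF a b])

sublocale product_prob_space "\<lambda>_. B" I ..

lemma sets_P [measurable_cong]: "sets P = sets (\<Pi>\<^sub>M i\<in>I. borel)"
  by (intro sets_PiM_cong) auto

lemma AE_cube: "AE x in P. \<forall>i\<in>I. 0 < x i \<and> x i < 1"
proof -
  have "AE x in P. 0 < x i \<and> x i < 1" if "i \<in> I" for i
    using AE_beta_distribution
    by (rule AE_PiM_component[rotated 2, where P = "\<lambda>y. 0 < y \<and> y < 1"])
      (auto simp: that B.prob_space_axioms)
  then show ?thesis by (intro AE_finite_allI) auto
qed

lemma cube_bounded_integrable:
  assumes "cube_bounded I h"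
  shows "integrable P h"
proof -
  obtain C where C: "\<And>x. (\<forall>i\<in>I. 0 < x i \<and> x i < 1) \<Longrightarrow> \<bar>h x\<bar> \<le> C"
    using assms unfolding cube_bounded_def by blast
  show ?thesis
  proof (rule integrable_const_bound[where B = C])
    show "AE x in P. norm (h x) \<le> C"
      using AE_cube by eventually_elim (simp add: C)
    show "h \<in> borel_measurable P" using cube_bounded_measurable[OF assms] by measurable
  qed
qed

lemma integral_swap:
  fixes h :: "_ \<Rightarrow> real"
  assumes [measurable]: "h \<in> borel_measurable (\<Pi>\<^sub>M i\<in>I. borel)" and jk: "j \<in> I" "k \<in> I"
  shows "(\<integral>x. h x \<partial>P) = (\<integral>x. h (\<lambda>i\<in>I. x (swap j k i)) \<partial>P)"
proof -
  have "distr P P (\<lambda>x. \<lambda>i\<in>I. x (swap j k i)) = P"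
    using jk by (intro distr_PiM_reindex[of I "\<lambda>_. B" "swap j k" I])
      (auto simp: B.prob_space_axioms Transposition.transpose_def inj_on_def split: if_splits)
  moreover have "(\<lambda>x. \<lambda>i\<in>I. x (swap j k i)) \<in> measurable P P"
    using jk by (intro measurable_restrict measurable_component_singleton) (auto simp: Transposition.transpose_def)
  moreover have "h \<in> borel_measurable P" by measurable
  ultimately show ?thesis
    using integral_distr[of "\<lambda>x. \<lambda>i\<in>I. x (swap j k i)" P P h]
    by simp
qed

definition integrand :: "'i set \<Rightarrow> real \<Rightarrow> ('i \<Rightarrow> real) \<Rightarrow> real" where
  "integrand S e x = (\<Prod>i\<in>I. x i) ^ p * (\<Prod>i\<in>S. x i) * reg_vandermonde I g e x"

lemma cube_bounded_integrand [cube_bounded_intros]: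
  "S \<subseteq> I \<Longrightarrow> 0 \<le> e \<Longrightarrow> e \<le> 1 \<Longrightarrow> cube_bounded I (integrand S e)"
  unfolding integrand_def using g by (intro cube_bounded_intros) auto

lemma integrand_swap:
  assumes "S \<subseteq> I" "j \<in> I" "k \<in> I"
  shows "integrand S e (\<lambda>i\<in>I. x (swap j k i)) = integrand (swap j k ` S) e x"
proof -
  have "swap j k ` I = I" using assms by (auto simp: Transposition.transpose_def image_iff split: if_splits)
  then show ?thesis
    unfolding integrand_def prod_swap[OF assms] prod_swap[OF subset_refl assms(2,3)]
    using assms by (simp add: reg_vandermonde_swap)
qed

text \<open>Integration by parts in the variable \<open>x k\<close> alone. The logarithmic derivative of the regularised
  Vandermonde factor is the sum over \<open>j\<close>, and \<open>p\<close> comes from the power of \<open>x k\<close>.\<close>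

lemma stein_coordinate:
  assumes k: "k \<in> I" and S: "S \<subseteq> I" "k \<notin> S" and e: "0 < e" "e \<le> 1"
  shows "(\<integral>x. (a + p - (a + p + b) * x k
      + x k * (1 - x k) * (\<Sum>j\<in>I - {k}. 2 * g * reg_inverse (x k - x j) e)) * integrand S e x \<partial>P) = 0"
    (is "integral\<^sup>L P ?D = 0")
proof -
  have cb: "cube_bounded I ?D"
    using S k e by (intro cube_bounded_intros) auto
  have I: "I = insert k (I - {k})" using k by auto
  have int: "integrable (Pi\<^sub>M (insert k (I - {k})) (\<lambda>_. B)) ?D"
    using cube_bounded_integrable[OF cb] I by simp
  have outer: "integral\<^sup>L P ?D = (\<integral>x. (\<integral>y. ?D (x(k := y)) \<partial>B) \<partial>Pi\<^sub>M (I - {k}) (\<lambda>_. B))"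
    using product_integral_insert[OF _ _ int] I by simp
  have inner: "(\<integral>y. ?D (x(k := y)) \<partial>B) = 0" for x
  proof -
    define C where "C = (\<Prod>i\<in>I - {k}. x i) ^ p * (\<Prod>i\<in>S. x i) * reg_vandermonde (I - {k}) g e x"
    \<comment> \<open>As a function of \<open>y = x k\<close> the integrand is \<open>C * (y ^ p * E y)\<close>, with logarithmic
       derivative \<open>E'\<close> of \<open>E\<close>.\<close>
    define E where "E y = exp (g * (\<Sum>j\<in>I - {k}. ln ((y - x j)\<^sup>2 + e)))" for y
    define E' where "E' y = (\<Sum>j\<in>I - {k}. 2 * g * reg_inverse (y - x j) e)" for y
    have pos: "0 < (y - x j)\<^sup>2 + e" for y j using e by (simp add: add_nonneg_pos)
    have ne: "(y - x j)\<^sup>2 + e \<noteq> 0" for y j using pos[of y j] by simp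
    have fE: "integrand S e (x(k := y)) = C * (y ^ p * E y)" for y
    proof -
      have "(\<Prod>i\<in>I. (x(k := y)) i) = y * (\<Prod>i\<in>I - {k}. x i)"
        using k by (subst prod.remove[of I k]) auto
      moreover have "(\<Prod>i\<in>S. (x(k := y)) i) = (\<Prod>i\<in>S. x i)"
        using S by (intro prod.cong) auto
      moreover have "reg_vandermonde (I - {k}) g e (x(k := y)) = reg_vandermonde (I - {k}) g e x"
        unfolding reg_vandermonde_def by (intro prod.cong) auto
      moreover have "(\<Prod>j\<in>I - {k}. (((x(k := y)) k - (x(k := y)) j)\<^sup>2 + e) powr g) = E y"
      proof -
        have "(\<Prod>j\<in>I - {k}. (((x(k := y)) k - (x(k := y)) j)\<^sup>2 + e) powr g)
            = (\<Prod>j\<in>I - {k}. exp (g * ln ((y - x j)\<^sup>2 + e)))"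
          using ne by (intro prod.cong) (auto simp: powr_def)
        then show ?thesis by (simp add: E_def exp_sum sum_distrib_left)
      qed
      ultimately show ?thesis
        unfolding integrand_def reg_vandermonde_split[OF fin k]
        by (simp add: C_def power_mult_distrib mult_ac)
    qed
    have dE: "(E has_real_derivative E' y * E y) (at y)" for y
    proof -
      have "((\<lambda>y. ln ((y - x j)\<^sup>2 + e)) has_real_derivative 2 * (y - x j) / ((y - x j)\<^sup>2 + e)) (at y)" for j
        using pos[of y j] by (auto intro!: derivative_eq_intros)
      then have "(E has_real_derivative E y * (g * (\<Sum>j\<in>I - {k}. 2 * (y - x j) / ((y - x j)\<^sup>2 + e)))) (at y)"
        unfolding E_def by (intro DERIV_fun_exp DERIV_cmult DERIV_sum)
      then show ?thesis
        by (simp add: E'_def sum_distrib_left mult_ac)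
    qed
    have cE: "continuous_on UNIV E" "continuous_on UNIV E'"
      unfolding E_def E'_def using ne by (auto intro!: continuous_intros)
    define F where "F y = y ^ p * E y" for y
    define F' where "F' y = real p * y ^ (p - 1) * E y + y ^ p * (E' y * E y)" for y
    have "(\<integral>y. y * (1 - y) * F' y + (a - (a + b) * y) * F y \<partial>B) = 0"
    proof (rule beta_distribution_stein[OF a b])
      show "(F has_real_derivative F' y) (at y)" for y
        unfolding F_def F'_def by (auto intro!: derivative_eq_intros dE)
      show "continuous_on UNIV F'" unfolding F'_def
        using cE by (intro continuous_intros) auto
    qed
    moreover have "?D (x(k := y)) = C * (y * (1 - y) * F' y + (a - (a + b) * y) * F y)" for y
    proof -
      have p: "y * (real p * y ^ (p - 1)) = real p * y ^ p"
        by (cases p) auto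
      have "y * (1 - y) * F' y = (1 - y) * (y * (real p * y ^ (p - 1)) * E y + y * y ^ p * (E' y * E y))"
        by (simp add: F'_def algebra_simps)
      then have "y * (1 - y) * F' y = (1 - y) * (real p * y ^ p * E y + y * y ^ p * (E' y * E y))"
        unfolding p .
      then have 1: "y * (1 - y) * F' y + (a - (a + b) * y) * F y
          = (1 - y) * (real p * y ^ p * E y + y * y ^ p * (E' y * E y)) + (a - (a + b) * y) * (y ^ p * E y)"
        by (simp only: F_def)
      have 2: "(\<Sum>j\<in>I - {k}. 2 * g * reg_inverse ((x(k := y)) k - (x(k := y)) j) e) = E' y"
        unfolding E'_def by (rule sum.cong) auto
      show ?thesis
        unfolding 1 fE 2 by (simp add: algebra_simps)
    qed
    ultimately show ?thesis by (simp only: integral_mult_right_zero mult_zero_right)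
  qed
  show ?thesis unfolding outer inner by (rule integral_zero)
qed

definition moment :: "'i set \<Rightarrow> real" where
  "moment S = (\<integral>x. integrand S 0 x \<partial>P)"

lemma reg_one_bounds:
  assumes "0 \<le> (e::real)"
  shows "0 \<le> d\<^sup>2 / (d\<^sup>2 + e)" "d\<^sup>2 / (d\<^sup>2 + e) \<le> 1"
proof -
  show "0 \<le> d\<^sup>2 / (d\<^sup>2 + e)" using assms by simp
  show "d\<^sup>2 / (d\<^sup>2 + e) \<le> 1"
  proof (cases "d\<^sup>2 + e = 0")
    case False
    then have "0 < d\<^sup>2 + e" using assms by (simp add: order_less_le)
    then show ?thesis using assms by simp
  qed simp
qed

lemma reg_vandermonde_tendsto:
  assumes "\<And>n. e n > 0" "e \<longlonglongrightarrow> 0"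
  shows "(\<lambda>n. reg_vandermonde I g (e n) x) \<longlonglongrightarrow> reg_vandermonde I g 0 x"
  unfolding reg_vandermonde_def
proof (rule tendsto_prod, clarify)
  fix i j
  show "(\<lambda>n. ((x i - x j)\<^sup>2 + e n) powr (g / 2)) \<longlonglongrightarrow> ((x i - x j)\<^sup>2 + 0) powr (g / 2)"
    using g assms less_imp_le[OF assms(1)]
    by (intro tendsto_powr2 tendsto_add tendsto_const) auto
qed

text \<open>Removal of the regularisation. The quotients \<open>reg_one\<close> tend to \<open>1\<close> only off the diagonal, but on the
  diagonal the limiting Vandermonde factor vanishes, so that convergence holds at every point.\<close>

lemma integral_integrand_tendsto:
  assumes e: "\<And>n. e n > 0" "\<And>n. e n \<le> 1" "e \<longlonglongrightarrow> 0" and S: "S \<subseteq> I"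
    and h: "cube_bounded I h"
  shows "(\<lambda>n. \<integral>x. h x * integrand S (e n) x \<partial>P) \<longlonglongrightarrow> (\<integral>x. h x * integrand S 0 x \<partial>P)"
    and "i \<in> I \<Longrightarrow> j \<in> I \<Longrightarrow> i \<noteq> j \<Longrightarrow>
      (\<lambda>n. \<integral>x. h x * reg_one (x i - x j) (e n) * integrand S (e n) x \<partial>P)
        \<longlonglongrightarrow> (\<integral>x. h x * integrand S 0 x \<partial>P)"
proof -
  define K where "K = (\<Prod>q\<in>off_diagonal I. (2::real) powr (g / 2))"
  obtain C where C: "\<And>x. (\<forall>i\<in>I. 0 < x i \<and> x i < 1) \<Longrightarrow> \<bar>h x\<bar> \<le> C"
    using h unfolding cube_bounded_def by blast
  have fb: "\<bar>integrand S (e n) x\<bar> \<le> K" if x: "\<forall>i\<in>I. 0 < x i \<and> x i < 1" for n x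
  proof -
    have V: "reg_vandermonde I g (e n) x \<le> K" unfolding K_def
      using reg_vandermonde_le[of I "e n" g x] e(1,2)[of n] g x by auto
    have "0 \<le> (\<Prod>i\<in>I. x i) ^ p" "(\<Prod>i\<in>I. x i) ^ p \<le> 1"
      using x by (auto intro!: prod_nonneg zero_le_power power_le_one prod_le_1 simp: less_imp_le)
    moreover have "0 \<le> (\<Prod>i\<in>S. x i)" "(\<Prod>i\<in>S. x i) \<le> 1"
      using x S by (auto intro!: prod_nonneg prod_le_1 simp: less_imp_le subset_iff)
    ultimately have "(\<Prod>i\<in>I. x i) ^ p * (\<Prod>i\<in>S. x i) \<le> 1 * 1" "0 \<le> (\<Prod>i\<in>I. x i) ^ p * (\<Prod>i\<in>S. x i)"
      by (intro mult_mono mult_nonneg_nonneg; auto)+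
    then have "(\<Prod>i\<in>I. x i) ^ p * (\<Prod>i\<in>S. x i) * reg_vandermonde I g (e n) x \<le> 1 * K"
      using V reg_vandermonde_nonneg[of I g "e n" x] by (intro mult_mono) auto
    then show ?thesis
      using mult_nonneg_nonneg[OF \<open>0 \<le> (\<Prod>i\<in>I. x i) ^ p * (\<Prod>i\<in>S. x i)\<close> reg_vandermonde_nonneg[of I g "e n" x]]
      unfolding integrand_def by linarith
  qed
  have flim: "(\<lambda>n. integrand S (e n) x) \<longlonglongrightarrow> integrand S 0 x" for x
    unfolding integrand_def by (intro tendsto_mult tendsto_const reg_vandermonde_tendsto e)
  have meas: "(\<lambda>x. h x * integrand S 0 x) \<in> borel_measurable P" "(\<lambda>x. h x * integrand S (e n) x) \<in> borel_measurable P" for n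
    using S e(1,2)[of n] h by (auto intro!: borel_measurable_integrable cube_bounded_integrable cube_bounded_intros)
  have hf: "\<bar>h x * integrand S (e n) x\<bar> \<le> C * K" if x: "\<forall>i\<in>I. 0 < x i \<and> x i < 1" for n x
    using C[OF x] fb[OF x, of n] unfolding abs_mult by (intro mult_mono) auto
  show "(\<lambda>n. \<integral>x. h x * integrand S (e n) x \<partial>P) \<longlonglongrightarrow> (\<integral>x. h x * integrand S 0 x \<partial>P)"
  proof (rule integral_dominated_convergence[OF meas])
    show "integrable P (\<lambda>x. C * K)" by simp
    show "AE x in P. (\<lambda>n. h x * integrand S (e n) x) \<longlonglongrightarrow> h x * integrand S 0 x"
      by (intro AE_I2 tendsto_mult tendsto_const flim)
    show "AE x in P. norm (h x * integrand S (e n) x) \<le> C * K" for n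
      using AE_cube by eventually_elim (use hf in auto)
  qed
  assume ij: "i \<in> I" "j \<in> I" "i \<noteq> j"
  show "(\<lambda>n. \<integral>x. h x * reg_one (x i - x j) (e n) * integrand S (e n) x \<partial>P)
        \<longlonglongrightarrow> (\<integral>x. h x * integrand S 0 x \<partial>P)"
  proof (rule integral_dominated_convergence[OF meas(1)])
    show "integrable P (\<lambda>x. C * K)" by simp
    show "(\<lambda>x. h x * reg_one (x i - x j) (e n) * integrand S (e n) x) \<in> borel_measurable P" for n
      using S e(1,2)[of n] h ij
      by (intro borel_measurable_integrable cube_bounded_integrable cube_bounded_intros) auto
    show "AE x in P. (\<lambda>n. h x * reg_one (x i - x j) (e n) * integrand S (e n) x) \<longlonglongrightarrow> h x * integrand S 0 x"
    proof (rule AE_I2)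
      fix x
      show "(\<lambda>n. h x * reg_one (x i - x j) (e n) * integrand S (e n) x) \<longlonglongrightarrow> h x * integrand S 0 x"
      proof (cases "x i = x j")
        case True
        have "reg_vandermonde I g 0 x = 0"
          unfolding reg_vandermonde_def using ij True by (auto intro!: prod_zero bexI[of _ "(i, j)"])
        then show ?thesis using True by (simp add: integrand_def)
      next
        case False
        then have "(\<lambda>n. reg_one (x i - x j) (e n)) \<longlonglongrightarrow> (x i - x j)\<^sup>2 / ((x i - x j)\<^sup>2 + 0)"
          by (intro tendsto_intros e) auto
        then have "(\<lambda>n. h x * reg_one (x i - x j) (e n) * integrand S (e n) x) \<longlonglongrightarrow> h x * ((x i - x j)\<^sup>2 / ((x i - x j)\<^sup>2 + 0)) * integrand S 0 x"
          by (intro tendsto_mult tendsto_const flim)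
        then show ?thesis using False by simp
      qed
    qed
    show "AE x in P. norm (h x * reg_one (x i - x j) (e n) * integrand S (e n) x) \<le> C * K" for n
      using AE_cube
    proof eventually_elim
      case (elim x)
      have "\<bar>h x * integrand S (e n) x\<bar> * reg_one (x i - x j) (e n) \<le> \<bar>h x * integrand S (e n) x\<bar> * 1"
        using e(1)[of n] by (intro mult_left_mono reg_one_bounds) auto
      then show ?case using hf[OF elim, of n] reg_one_bounds(1)[of "e n" "x i - x j"] e(1)[of n]
        by (simp add: abs_mult mult_ac del: times_divide_eq_left times_divide_eq_right)
    qed
  qed
qed

lemma moment_swap:
  assumes S: "insert j S \<subseteq> I" "k \<in> I" "j \<notin> S" "k \<notin> S"
  shows "moment (insert j S) = moment (insert k S)"
proof -
  have "swap j k ` insert j S = insert k S"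
    using assms by (force simp: Transposition.transpose_def image_iff split: if_splits)
  then show ?thesis
    unfolding moment_def
    using integral_swap[of "integrand (insert j S) 0" j k] integrand_swap[of "insert j S" j k 0] S
    by (simp add: cube_bounded_measurable cube_bounded_integrand)
qed

text \<open>The singular terms of the integration by parts, one for each \<open>j\<close>. Averaging with the image under the
  exchange of \<open>x k\<close> and \<open>x j\<close> produces a factor \<open>x k - x j\<close>, which turns
  \<open>reg_inverse\<close> into \<open>reg_one\<close>, and the latter lies between \<open>0\<close> and \<open>1\<close> for all \<open>e\<close>. The result depends on whether \<open>x j\<close> already occurs in the
  monomial.\<close>

lemma pair_term:
  assumes k: "k \<in> I" and S: "S \<subseteq> I" "k \<notin> S" and e: "0 < e" "e \<le> 1" and j: "j \<in> I" "j \<noteq> k"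
  shows "2 * (\<integral>x. x k * (1 - x k) * reg_inverse (x k - x j) e * integrand S e x \<partial>P)
     = (if j \<in> S then - (\<integral>x. 1 * reg_one (x k - x j) e * integrand (insert k S) e x \<partial>P)
        else (\<integral>x. (1 - x k - x j) * reg_one (x k - x j) e * integrand S e x \<partial>P))"
proof -
  define h where "h x = x k * (1 - x k) * reg_inverse (x k - x j) e * integrand S e x" for x
  have cb: "cube_bounded I h"
    unfolding h_def using k S e j by (intro cube_bounded_intros) auto
  define s where "s x = (\<lambda>i\<in>I. x (swap j k i))" for x :: "'i \<Rightarrow> real"
  have sw: "(\<integral>x. h x \<partial>P) = (\<integral>x. h (s x) \<partial>P)"
    unfolding s_def by (rule integral_swap) (auto simp: cb cube_bounded_measurable j k)
  have sk: "s x k = x j" "s x j = x k" for x using j k by (auto simp: s_def)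
  have fk: "x k * integrand S e x = integrand (insert k S) e x" for x
    using S finite_subset[OF S(1) fin] by (simp add: integrand_def)
  have combine: "u * (v / d) * q + u' * (v' / d) * q = (u * v + u' * v') / d * q" for u v u' v' d q :: real
    by (simp add: add_divide_distrib ring_distribs)
  have hs: "h x + h (s x) = (if j \<in> S then - (1 * reg_one (x k - x j) e * integrand (insert k S) e x)
     else (1 - x k - x j) * reg_one (x k - x j) e * integrand S e x)" for x
  proof (cases "j \<in> S")
    case True
    have h1: "h x = (1 - x k) * reg_inverse (x k - x j) e * integrand (insert k S) e x" for x
      unfolding h_def fk[symmetric] by (simp add: mult_ac)
    have "swap j k ` insert k S = insert k S"
      using True by (force simp: Transposition.transpose_def image_iff split: if_splits)
    then have "integrand (insert k S) e (s x) = integrand (insert k S) e x"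
      unfolding s_def using integrand_swap[of "insert k S" j k e x] S j k by simp
    then have "h x + h (s x) = ((1 - x k) * (x k - x j) + (1 - x j) * (x j - x k)) / ((x k - x j)\<^sup>2 + e) * integrand (insert k S) e x"
      unfolding h1 sk by (simp only: power2_commute[of "x j"] combine)
    also have "(1 - x k) * (x k - x j) + (1 - x j) * (x j - x k) = - (x k - x j)\<^sup>2"
      by (simp add: power2_eq_square algebra_simps)
    finally show ?thesis using True by simp
  next
    case False
    then have "swap j k ` S = S"
      using S by (force simp: Transposition.transpose_def image_iff split: if_splits)
    then have "integrand S e (s x) = integrand S e x"
      unfolding s_def using integrand_swap[of S j k e x] S j k by simp
    then have "h x + h (s x) = (x k * (1 - x k) * (x k - x j) + x j * (1 - x j) * (x j - x k)) / ((x k - x j)\<^sup>2 + e) * integrand S e x"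
      unfolding h_def sk by (simp only: power2_commute[of "x j"] combine)
    also have "x k * (1 - x k) * (x k - x j) + x j * (1 - x j) * (x j - x k) = (1 - x k - x j) * (x k - x j)\<^sup>2"
      by (simp add: power2_eq_square algebra_simps)
    finally show ?thesis using False by simp
  qed
  have int: "integrable P h" "integrable P (\<lambda>x. h (s x))"
  proof -
    show "integrable P h" by (rule cube_bounded_integrable[OF cb])
    have "integrable P (\<lambda>x. (h x + h (s x)) - h x)"
      unfolding hs
      by (rule Bochner_Integration.integrable_diff[OF _ \<open>integrable P h\<close>], cases "j \<in> S")
        (use S k j e in \<open>auto simp del: times_divide_eq_left times_divide_eq_right intro!: cube_bounded_integrable cube_bounded_intros\<close>)
    then show "integrable P (\<lambda>x. h (s x))" by simp
  qed
  have "2 * (\<integral>x. h x \<partial>P) = (\<integral>x. h x + h (s x) \<partial>P)"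
    using int by (subst Bochner_Integration.integral_add) (auto simp: sw[symmetric])
  then show ?thesis unfolding hs unfolding h_def by (simp only: integral_minus split: if_splits) simp
qed

text \<open>In the limit \<open>e \<rightarrow> 0\<close> of the symmetrised integration by parts, each \<open>j\<close> in \<open>S\<close> contributes
  \<open>- g * moment (insert k S)\<close>, and each of the other \<open>card I - card S - 1\<close> indices contributes
  \<open>g * (moment S - 2 * moment (insert k S))\<close>; collecting the coefficients gives the claim.\<close>

theorem aomoto_recursion:
  assumes k: "k \<in> I" and S: "S \<subseteq> I" "k \<notin> S"
  shows "(a + p + b + g * (2 * real (card I) - real (card S) - 2)) * moment (insert k S)
    = (a + p + g * (real (card I) - real (card S) - 1)) * moment S"
proof -
  define e where "e n = inverse (real (Suc n))" for n
  have e: "e n > 0" "e n \<le> 1" "e \<longlonglongrightarrow> 0" for n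
    using LIMSEQ_inverse_real_of_nat by (auto simp: e_def[abs_def] field_simps)
  have finS: "finite S" using S fin finite_subset by blast
  have fk: "x k * integrand S t x = integrand (insert k S) t x" for x t
    using S finS by (simp add: integrand_def)
  define R where "R n j = (if j \<in> S then - (\<integral>x. 1 * reg_one (x k - x j) (e n) * integrand (insert k S) (e n) x \<partial>P)
        else (\<integral>x. (1 - x k - x j) * reg_one (x k - x j) (e n) * integrand S (e n) x \<partial>P))" for n j
  define R' where "R' j = (if j \<in> S then - moment (insert k S) else moment S - 2 * moment (insert k S))" for j
  have eq: "(a + p) * (\<integral>x. 1 * integrand S (e n) x \<partial>P) - (a + p + b) * (\<integral>x. 1 * integrand (insert k S) (e n) x \<partial>P)
      + g * (\<Sum>j\<in>I - {k}. R n j) = 0" for n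
  proof -
    have [simp]: "integrable P (integrand S (e n))" "integrable P (integrand (insert k S) (e n))"
      using S k e(1,2)[of n] by (auto intro!: cube_bounded_integrable cube_bounded_intros)
    have [simp]: "integrable P (\<lambda>x. x k * (1 - x k) * reg_inverse (x k - x j) (e n) * integrand S (e n) x)"
      if "j \<in> I" "j \<noteq> k" for j
      using S k e(1,2)[of n] that by (intro cube_bounded_integrable cube_bounded_intros) auto
    have "0 = (\<integral>x. (a + p) * integrand S (e n) x - (a + p + b) * integrand (insert k S) (e n) x
       + (\<Sum>j\<in>I - {k}. 2 * g * (x k * (1 - x k) * reg_inverse (x k - x j) (e n) * integrand S (e n) x)) \<partial>P)"
      unfolding stein_coordinate[OF k S e(1)[of n] e(2)[of n], symmetric] fk[symmetric]
      by (intro Bochner_Integration.integral_cong)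
       (auto simp: ring_distribs sum_distrib_left sum_distrib_right mult_ac simp del: times_divide_eq_left times_divide_eq_right)
    also have "\<dots> = (a + p) * (\<integral>x. integrand S (e n) x \<partial>P) - (a + p + b) * (\<integral>x. integrand (insert k S) (e n) x \<partial>P)
       + (\<Sum>j\<in>I - {k}. 2 * g * (\<integral>x. x k * (1 - x k) * reg_inverse (x k - x j) (e n) * integrand S (e n) x \<partial>P))"
      by (subst Bochner_Integration.integral_add Bochner_Integration.integral_diff Bochner_Integration.integral_sum;
          (intro Bochner_Integration.integrable_diff integrable_mult_right Bochner_Integration.integrable_sum)?; 
          simp del: times_divide_eq_left times_divide_eq_right)+
    also have "(\<Sum>j\<in>I - {k}. 2 * g * (\<integral>x. x k * (1 - x k) * reg_inverse (x k - x j) (e n) * integrand S (e n) x \<partial>P))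
       = g * (\<Sum>j\<in>I - {k}. R n j)"
      unfolding sum_distrib_left R_def
      using pair_term[OF k S e(1)[of n] e(2)[of n]]
      by (intro sum.cong refl) (simp add: mult_ac del: times_divide_eq_left times_divide_eq_right)
    finally show ?thesis by simp
  qed
  have R: "(\<lambda>n. R n j) \<longlonglongrightarrow> R' j" if "j \<in> I - {k}" for j
  proof (cases "j \<in> S")
    case True
    have "(\<lambda>n. - (\<integral>x. 1 * reg_one (x k - x j) (e n) * integrand (insert k S) (e n) x \<partial>P))
        \<longlonglongrightarrow> - (\<integral>x. 1 * integrand (insert k S) 0 x \<partial>P)"
      using that k S e by (intro tendsto_minus integral_integrand_tendsto(2) cube_bounded_const) auto
    then show ?thesis using True by (simp add: R_def R'_def moment_def)
  next
    case False
    have "(\<lambda>n. (\<integral>x. (1 - x k - x j) * reg_one (x k - x j) (e n) * integrand S (e n) x \<partial>P))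
        \<longlonglongrightarrow> (\<integral>x. (1 - x k - x j) * integrand S 0 x \<partial>P)"
      using that k S e by (intro integral_integrand_tendsto(2) cube_bounded_intros) auto
    moreover have "(\<integral>x. (1 - x k - x j) * integrand S 0 x \<partial>P) = moment S - 2 * moment (insert k S)"
    proof -
      have fj: "x j * integrand S t x = integrand (insert j S) t x" for x t
        using False finS by (simp add: integrand_def)
      have [simp]: "integrable P (integrand S 0)" "integrable P (integrand (insert k S) 0)" "integrable P (integrand (insert j S) 0)"
        using S k that by (auto intro!: cube_bounded_integrable cube_bounded_intros)
      have "(\<integral>x. (1 - x k - x j) * integrand S 0 x \<partial>P) = (\<integral>x. integrand S 0 x - integrand (insert k S) 0 x - integrand (insert j S) 0 x \<partial>P)"
        by (intro Bochner_Integration.integral_cong) (auto simp: fk[symmetric] fj[symmetric] ring_distribs)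
      also have "\<dots> = moment S - moment (insert k S) - moment (insert j S)" by (simp add: moment_def)
      also have "moment (insert j S) = moment (insert k S)"
        using False that k S by (intro moment_swap) auto
      finally show ?thesis by simp
    qed
    ultimately show ?thesis using False by (simp add: R_def R'_def)
  qed
  have "(\<lambda>n. (a + p) * (\<integral>x. 1 * integrand S (e n) x \<partial>P) - (a + p + b) * (\<integral>x. 1 * integrand (insert k S) (e n) x \<partial>P)
      + g * (\<Sum>j\<in>I - {k}. R n j)) \<longlonglongrightarrow> (a + p) * (\<integral>x. 1 * integrand S 0 x \<partial>P) - (a + p + b) * (\<integral>x. 1 * integrand (insert k S) 0 x \<partial>P)
      + g * (\<Sum>j\<in>I - {k}. R' j)"
    using R S k e by (intro tendsto_intros integral_integrand_tendsto(1) cube_bounded_const) auto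
  then have "(a + p) * moment S - (a + p + b) * moment (insert k S) + g * (\<Sum>j\<in>I - {k}. R' j) = 0"
    unfolding eq by (simp add: LIMSEQ_const_iff moment_def)
  moreover have "(\<Sum>j\<in>I - {k}. R' j) = - real (card S) * moment (insert k S)
      + (real (card I) - 1 - real (card S)) * (moment S - 2 * moment (insert k S))"
  proof -
    have I: "I - {k} = S \<union> (I - {k} - S)" using S by auto
    have c: "real (card (I - {k} - S)) = real (card I) - 1 - real (card S)"
    proof -
      have "card (I - {k} - S) = card (I - {k}) - card S"
        using S finS by (intro card_Diff_subset) auto
      moreover have "card S \<le> card (I - {k})" using S by (intro card_mono) auto
      moreover have "card I \<ge> 1" using k fin by (metis One_nat_def Suc_leI card_gt_0_iff empty_iff)
      ultimately show ?thesis using k by simp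
    qed
    have "(\<Sum>j\<in>I - {k}. R' j) = (\<Sum>j\<in>S. R' j) + (\<Sum>j\<in>I - {k} - S. R' j)"
      using finS fin by (subst I, subst sum.union_disjoint) auto
    then show ?thesis by (simp add: R'_def c)
  qed
  ultimately show ?thesis by (simp add: algebra_simps)
qed

end

section \<open>The law of a Selberg product\<close>

text \<open>A recursive definition, rather than one on a product space, suits the exchange of one independent factor at a
  time. The factor with index \<open>k\<close> has the parameters \<open>al k\<close> and \<open>b k\<close>, and indices start at \<open>1\<close>.\<close>

primrec beta_prod :: "(nat \<Rightarrow> real) \<Rightarrow> (nat \<Rightarrow> real) \<Rightarrow> nat \<Rightarrow> real measure" where
  "beta_prod al b 0 = return borel 1"
| "beta_prod al b (Suc m) =
     distr (beta_prod al b m \<Otimes>\<^sub>M beta_distribution (al (Suc m)) (b (Suc m))) borel (\<lambda>(x, y). x * y)"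

lemma sets_beta_prod [simp, measurable_cong]: "sets (beta_prod al b m) = sets borel"
  by (cases m) auto

lemma space_beta_prod [simp]: "space (beta_prod al b m) = UNIV"
  by (cases m) auto

lemma prob_space_beta_prod:
  assumes "\<And>k. k \<in> {1..m} \<Longrightarrow> al k > 0 \<and> b k > 0"
  shows "prob_space (beta_prod al b m)"
  using assms
proof (induction m)
  case 0
  then show ?case by (auto intro!: prob_space_return)
next
  case (Suc m)
  interpret L: prob_space "beta_prod al b m" using Suc by auto
  interpret B: prob_space "beta_distribution (al (Suc m)) (b (Suc m))"
    using Suc.prems[of "Suc m"] by (intro prob_space_beta_distribution) auto
  interpret pair_prob_space "beta_prod al b m" "beta_distribution (al (Suc m)) (b (Suc m))" ..
  show ?case by (auto intro!: prob_space_distr)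
qed

lemma AE_beta_prod:
  assumes "\<And>k. k \<in> {1..m} \<Longrightarrow> al k > 0 \<and> b k > 0"
  shows "AE x in beta_prod al b m. 0 < x \<and> x \<le> 1"
  using assms
proof (induction m)
  case 0
  show ?case unfolding beta_prod.simps by (subst AE_return) auto
next
  case (Suc m)
  interpret L: prob_space "beta_prod al b m" using Suc by (intro prob_space_beta_prod) auto
  interpret B: prob_space "beta_distribution (al (Suc m)) (b (Suc m))"
    using Suc.prems[of "Suc m"] by (intro prob_space_beta_distribution) auto
  interpret pair_prob_space "beta_prod al b m" "beta_distribution (al (Suc m)) (b (Suc m))" ..
  have IH: "AE x in beta_prod al b m. 0 < x \<and> x \<le> 1"
    by (rule Suc.IH) (use Suc.prems in auto)
  have "AE x in beta_prod al b m. AE y in beta_distribution (al (Suc m)) (b (Suc m)). 0 < x * y \<and> x * y \<le> 1"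
    using IH
  proof eventually_elim
    case (elim x)
    show ?case
      using AE_beta_distribution
      by eventually_elim (use elim in \<open>auto intro: mult_le_one\<close>)
  qed
  then have "AE z in beta_prod al b m \<Otimes>\<^sub>M beta_distribution (al (Suc m)) (b (Suc m)). 0 < fst z * snd z \<and> fst z * snd z \<le> 1"
  proof (subst AE_pair_iff[symmetric])
    let ?M = "beta_prod al b m \<Otimes>\<^sub>M beta_distribution (al (Suc m)) (b (Suc m))"
    have "(\<lambda>x. fst x * snd x) \<in> borel_measurable ?M" by measurable
    then have "(\<lambda>x. fst x * snd x) -` {0<..1} \<inter> space ?M \<in> sets ?M"
      by (rule measurable_sets) simp
    also have "(\<lambda>x. fst x * snd x) -` {0<..1} \<inter> space ?M = {x \<in> space ?M. 0 < fst x * snd x \<and> fst x * snd x \<le> 1}"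
      by auto
    finally show "{x \<in> space ?M. 0 < fst x * snd x \<and> fst x * snd x \<le> 1} \<in> sets ?M" .
  qed
  then show ?case
    unfolding beta_prod.simps by (subst AE_distr_iff) (auto simp: case_prod_beta)
qed

lemma integral_beta_prod_Suc:
  fixes f :: "real \<Rightarrow> real"
  assumes "\<And>k. k \<in> {1..Suc m} \<Longrightarrow> al k > 0 \<and> b k > 0"
    and [measurable]: "f \<in> borel_measurable borel" and f: "\<And>x. 0 < x \<Longrightarrow> x \<le> 1 \<Longrightarrow> \<bar>f x\<bar> \<le> C"
  shows "(\<integral>z. f z \<partial>beta_prod al b (Suc m))
    = (\<integral>x. (\<integral>y. f (x * y) \<partial>beta_distribution (al (Suc m)) (b (Suc m))) \<partial>beta_prod al b m)"
proof -
  interpret L: prob_space "beta_prod al b m" using assms by (intro prob_space_beta_prod) auto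
  interpret B: prob_space "beta_distribution (al (Suc m)) (b (Suc m))"
    using assms(1)[of "Suc m"] by (intro prob_space_beta_distribution) auto
  interpret pair_prob_space "beta_prod al b m" "beta_distribution (al (Suc m)) (b (Suc m))" ..
  interpret L': prob_space "beta_prod al b (Suc m)" using assms by (intro prob_space_beta_prod) auto
  have "integrable (beta_prod al b (Suc m)) f"
  proof (rule L'.integrable_const_bound)
    have "AE x in beta_prod al b (Suc m). 0 < x \<and> x \<le> 1"
      by (rule AE_beta_prod) (use assms(1) in auto)
    then show "AE x in beta_prod al b (Suc m). norm (f x) \<le> C"
      by eventually_elim (use f in auto)
  qed (simp del: beta_prod.simps)
  then have "integrable (beta_prod al b m \<Otimes>\<^sub>M beta_distribution (al (Suc m)) (b (Suc m))) (\<lambda>z. f (fst z * snd z))"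
    by (simp add: integrable_distr_eq case_prod_beta)
  then show ?thesis
    by (simp add: integral_distr case_prod_beta integral_fst'[symmetric])
qed

text \<open>The integration by parts above, applied to \<open>x ^ p\<close>.\<close>

lemma beta_moment_ratio:
  fixes a b :: real
  assumes "a > 0" "b > 0"
  shows "(\<integral>x. x ^ Suc p \<partial>beta_distribution a b)
     = (\<integral>x. x ^ p \<partial>beta_distribution a b) * ((a + real p) / (a + b + real p))"
proof -
  interpret prob_space "beta_distribution a b" by (rule prob_space_beta_distribution[OF assms])
  have int [simp]: "integrable (beta_distribution a b) (\<lambda>x. x ^ q)" for q
  proof (rule integrable_const_bound[where B = 1])
    show "AE x in beta_distribution a b. norm (x ^ q) \<le> 1"
      using AE_beta_distribution[of a b] by eventually_elim (auto simp: power_le_one)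
  qed simp
  have "(\<integral>x. x * (1 - x) * (real p * x ^ (p - 1)) + (a - (a + b) * x) * x ^ p \<partial>beta_distribution a b) = 0"
    by (rule beta_distribution_stein[OF assms]) (auto intro!: derivative_eq_intros continuous_intros)
  also have "(\<lambda>x. x * (1 - x) * (real p * x ^ (p - 1)) + (a - (a + b) * x) * x ^ p)
     = (\<lambda>x. (a + real p) * x ^ p - (a + b + real p) * x ^ Suc p)"
    by (rule ext, cases p) (auto simp: algebra_simps)
  finally have "(a + real p) * (\<integral>x. x ^ p \<partial>beta_distribution a b)
     = (a + b + real p) * (\<integral>x. x ^ Suc p \<partial>beta_distribution a b)"
    using int[of "Suc p"] by (simp del: power_Suc)
  then show ?thesis using assms by (simp add: field_simps)
qed

lemma beta_prod_moment:
  assumes "\<And>k. k \<in> {1..m} \<Longrightarrow> al k > 0 \<and> b k > 0"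
  shows "(\<integral>x. x ^ p \<partial>beta_prod al b m) = (\<Prod>k\<in>{1..m}. \<integral>x. x ^ p \<partial>beta_distribution (al k) (b k))"
  using assms
proof (induction m)
  case 0
  show ?case by (simp add: integral_return)
next
  case (Suc m)
  have "(\<integral>x. x ^ p \<partial>beta_prod al b (Suc m)) = (\<integral>x. (\<integral>y. (x * y) ^ p \<partial>beta_distribution (al (Suc m)) (b (Suc m))) \<partial>beta_prod al b m)"
    by (rule integral_beta_prod_Suc[where C = 1]) (use Suc.prems in \<open>auto simp: power_le_one\<close>)
  then show ?case using Suc by (simp add: power_mult_distrib)
qed

lemma beta_prod_moment_ratio:
  assumes "\<And>k. k \<in> {1..m} \<Longrightarrow> al k > 0 \<and> b k > 0"
  shows "(\<integral>x. x ^ Suc p \<partial>beta_prod al b m)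
    = (\<integral>x. x ^ p \<partial>beta_prod al b m) * (\<Prod>k\<in>{1..m}. (al k + real p) / (al k + b k + real p))"
proof -
  have m: "(\<integral>x. x ^ q \<partial>beta_prod al b m) = (\<Prod>k\<in>{1..m}. \<integral>x. x ^ q \<partial>beta_distribution (al k) (b k))" for q
    by (rule beta_prod_moment) (use assms in auto)
  show ?thesis unfolding m prod.distrib[symmetric]
    by (intro prod.cong refl beta_moment_ratio) (use assms in auto)
qed

text \<open>On the unit interval the characteristic function is the sum of its Taylor series in the moments, and
  it determines the law.\<close>

lemma moments_determine:
  assumes "real_distribution M" "real_distribution N"
    and "AE x in M. 0 \<le> x \<and> x \<le> 1" "AE x in N. 0 \<le> x \<and> x \<le> 1"
    and "\<And>k. (\<integral>x. x ^ k \<partial>M) = (\<integral>x. x ^ k \<partial>N)"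
  shows "M = N"
proof (rule Levy_uniqueness[OF assms(1,2)], rule ext)
  fix t
  have lim: "(\<lambda>n. \<Sum>k \<le> n. ((\<i> * t)^k / fact k) * of_real (\<integral>x. x ^ k \<partial>M)) \<longlonglongrightarrow> char M t"
    if "real_distribution M" "AE x in M. 0 \<le> x \<and> x \<le> 1" for M
  proof -
    interpret real_distribution M by fact
    have int: "integrable M (\<lambda>x. x ^ k)" for k
    proof (rule integrable_const_bound[where B = 1])
      show "AE x in M. norm (x ^ k) \<le> 1"
        using that(2) by eventually_elim (auto simp: power_le_one power_abs)
    qed simp
    have le1: "expectation (\<lambda>x. \<bar>x\<bar> ^ n) \<le> 1" for n
    proof -
      have "integrable M (\<lambda>x. \<bar>x\<bar> ^ n)" using int[of n, THEN integrable_abs] by (simp add: power_abs)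
      then have "expectation (\<lambda>x. \<bar>x\<bar> ^ n) \<le> expectation (\<lambda>x. 1)"
      proof (intro integral_mono_AE)
        show "AE x in M. \<bar>x\<bar> ^ n \<le> 1"
          using that(2) by eventually_elim (auto simp: power_le_one)
      qed auto
      then show ?thesis using prob_space by simp
    qed
    have "(\<lambda>n. char M t - (\<Sum>k \<le> n. ((\<i> * t)^k / fact k) * of_real (expectation (\<lambda>x. x ^ k)))) \<longlonglongrightarrow> 0"
    proof (rule Lim_null_comparison)
      show "\<forall>\<^sub>F n in sequentially. norm (char M t - (\<Sum>k \<le> n. ((\<i> * t)^k / fact k) * of_real (expectation (\<lambda>x. x ^ k))))
         \<le> 2 * (\<bar>t\<bar> ^ n / fact n)"
      proof (rule always_eventually, rule allI)
        fix n
        have "cmod (char M t - (\<Sum>k \<le> n. ((\<i> * t)^k / fact k) * of_real (expectation (\<lambda>x. x ^ k))))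
          \<le> (2 * \<bar>t\<bar> ^ n / fact n) * expectation (\<lambda>x. \<bar>x\<bar> ^ n)"
          by (rule char_approx1[OF int])
        also have "\<dots> \<le> (2 * \<bar>t\<bar> ^ n / fact n) * 1" by (intro mult_left_mono le1) auto
        finally show "norm (char M t - (\<Sum>k \<le> n. ((\<i> * t)^k / fact k) * of_real (expectation (\<lambda>x. x ^ k))))
         \<le> 2 * (\<bar>t\<bar> ^ n / fact n)" by simp
      qed
      have "(\<lambda>n. \<bar>t\<bar> ^ n / fact n) \<longlonglongrightarrow> 0"
        using summable_LIMSEQ_zero[OF summable_exp[of "\<bar>t\<bar>"]] by (simp add: field_simps)
      then show "(\<lambda>n. 2 * (\<bar>t\<bar> ^ n / fact n)) \<longlonglongrightarrow> 0"
        by (rule tendsto_mult_right_zero)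
    qed
    from tendsto_diff[OF tendsto_const[of "char M t"] this] show ?thesis by simp
  qed
  show "char M t = char N t"
    using lim[OF assms(1,3)] lim[OF assms(2,4)] unfolding assms(5)
    by (rule LIMSEQ_unique)
qed

context beta_cube
begin

text \<open>One application of the recursion for each element of \<open>S\<close>.\<close>

lemma moment_prod:
  assumes "S \<subseteq> I"
  shows "moment S = moment {} * (\<Prod>s<card S. (a + p + g * (real (card I) - real s - 1)) / (a + p + b + g * (2 * real (card I) - real s - 2)))"
  using finite_subset[OF assms fin] assms
proof (induction S rule: finite_induct)
  case empty
  then show ?case by simp
next
  case (insert k S)
  have c: "card S + 1 \<le> card I"
    using card_mono[OF fin insert.prems] insert.hyps by simp
  have pos: "a + p + b + g * (2 * real (card I) - real (card S) - 2) > 0"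
  proof -
    have "2 * real (card I) - real (card S) - 2 \<ge> 0" using c by linarith
    then show ?thesis using a b g by (intro add_pos_nonneg) auto
  qed
  have "moment (insert k S) = moment S * ((a + p + g * (real (card I) - real (card S) - 1)) / (a + p + b + g * (2 * real (card I) - real (card S) - 2)))"
    using aomoto_recursion[of k S] insert pos by (simp add: field_simps)
  then show ?case using insert by (simp add: mult_ac)
qed

lemma moment_full:
  "moment I = moment {} * (\<Prod>k\<in>{1..card I}. (a + g * (real k - 1) + p) / (a + g * (real k - 1) + (b + g * (real (card I) - 1)) + p))"
proof -
  let ?N = "card I"
  have "(\<Prod>s<?N. (a + p + g * (real ?N - real s - 1)) / (a + p + b + g * (2 * real ?N - real s - 2)))
     = (\<Prod>k\<in>{1..?N}. (a + g * (real k - 1) + p) / (a + g * (real k - 1) + (b + g * (real ?N - 1)) + p))"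
    by (rule prod.reindex_bij_witness[where i = "\<lambda>k. ?N - k" and j = "\<lambda>s. ?N - s"])
      (auto simp: of_nat_diff algebra_simps)
  then show ?thesis using moment_prod[of I] by simp
qed

lemma AE_off_diagonal:
  assumes ij: "i \<in> I" "j \<in> I" "i \<noteq> j"
  shows "AE x in P. x i \<noteq> x j"
proof (rule AE_I)
  have I: "I = insert i (I - {i})" using ij by auto
  have meas: "{x \<in> space P. x i = x j} \<in> sets P" using ij by measurable
  show "{x \<in> space P. \<not> x i \<noteq> x j} \<subseteq> {x \<in> space P. x i = x j}" by auto
  show "{x \<in> space P. x i = x j} \<in> sets P" by (rule meas)
  have "emeasure P {x \<in> space P. x i = x j} = (\<integral>\<^sup>+x. indicator {x \<in> space P. x i = x j} x \<partial>P)"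
    using meas by simp
  also have "\<dots> = (\<integral>\<^sup>+x. indicator {0} (x i - x j) \<partial>P)"
    by (rule nn_integral_cong) (auto simp: indicator_def)
  also have "\<dots> = (\<integral>\<^sup>+x. indicator {0} (x i - x j) \<partial>Pi\<^sub>M (insert i (I - {i})) (\<lambda>_. B))"
    using I by simp
  also have "\<dots> = (\<integral>\<^sup>+x. (\<integral>\<^sup>+y. indicator {0} ((x(i := y)) i - (x(i := y)) j) \<partial>B) \<partial>Pi\<^sub>M (I - {i}) (\<lambda>_. B))"
    using ij by (subst product_nn_integral_insert) auto
  also have "\<dots> = (\<integral>\<^sup>+x. 0 \<partial>Pi\<^sub>M (I - {i}) (\<lambda>_. B))"
  proof (rule nn_integral_cong)
    fix x
    have "(\<integral>\<^sup>+y. indicator {0} ((x(i := y)) i - (x(i := y)) j) \<partial>B) = (\<integral>\<^sup>+y. indicator {x j} y \<partial>B)"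
      using ij by (intro nn_integral_cong) (auto simp: indicator_def)
    also have "\<dots> = emeasure B {x j}" by simp
    also have "\<dots> = 0"
      unfolding beta_distribution_def
      by (subst emeasure_density) (auto intro!: nn_integral_null_set simp: null_sets_def)
    finally show "(\<integral>\<^sup>+y. indicator {0} ((x(i := y)) i - (x(i := y)) j) \<partial>B) = 0" .
  qed
  finally show "emeasure P {x \<in> space P. x i = x j} = 0" by simp
qed

text \<open>Beta distributions have no atoms, so the coordinates are almost surely distinct. Positivity makes
  the division by this integral meaningful.\<close>

lemma reg_vandermonde_integral_pos: "(\<integral>x. reg_vandermonde I g 0 x \<partial>P) > 0"
proof -
  have int: "integrable P (reg_vandermonde I g 0)"
    using g by (intro cube_bounded_integrable cube_bounded_intros) auto
  have "AE x in P. \<forall>q\<in>off_diagonal I. x (fst q) \<noteq> x (snd q)"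
    by (intro AE_finite_allI) (auto intro: AE_off_diagonal)
  then have pos: "AE x in P. reg_vandermonde I g 0 x > 0"
    by eventually_elim (auto simp: reg_vandermonde_def intro!: prod_pos)
  have "(\<integral>x. reg_vandermonde I g 0 x \<partial>P) \<noteq> 0"
  proof
    assume "(\<integral>x. reg_vandermonde I g 0 x \<partial>P) = 0"
    then have "AE x in P. reg_vandermonde I g 0 x = 0"
      using integral_nonneg_eq_0_iff_AE[OF int AE_I2[OF reg_vandermonde_nonneg]] by simp
    with pos have "AE x in P. False" by eventually_elim auto
    then show False using AE_False by simp
  qed
  moreover have "(\<integral>x. reg_vandermonde I g 0 x \<partial>P) \<ge> 0"
    by (intro integral_nonneg_AE AE_I2 reg_vandermonde_nonneg)
  ultimately show ?thesis by linarith
qed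

end


lemma proportional_density_cmult:
  assumes "c > 0" and [measurable]: "w \<in> borel_measurable N"
  shows "proportional_density N (\<lambda>x. c * w x) = proportional_density N w"
proof -
  have "ennreal (c * w x) / (\<integral>\<^sup>+y. ennreal (c * w y) \<partial>N) = ennreal (w x) / (\<integral>\<^sup>+y. ennreal (w y) \<partial>N)" for x
  proof -
    have "ennreal (c * u) = ennreal c * ennreal u" for u
      using assms(1) by (simp add: ennreal_mult' less_imp_le)
    then have "ennreal (c * w x) / (\<integral>\<^sup>+y. ennreal (c * w y) \<partial>N)
      = (ennreal c * ennreal (w x)) / (ennreal c * (\<integral>\<^sup>+y. ennreal (w y) \<partial>N))"
      by (simp add: nn_integral_cmult)
    also have "\<dots> = ennreal (w x) / (\<integral>\<^sup>+y. ennreal (w y) \<partial>N)"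
      using assms(1) divide_mult_eq[of "ennreal c" "ennreal (w x)"] by (simp add: mult.commute[of "ennreal c"])
    finally show ?thesis .
  qed
  then show ?thesis by (simp add: proportional_density_def)
qed

lemma proportional_density_density:
  assumes [measurable]: "w \<in> borel_measurable N" "f \<in> borel_measurable N"
    and "\<And>x. w x \<ge> 0" "\<And>x. f x \<ge> 0"
  shows "proportional_density (density N (\<lambda>x. ennreal (f x))) w = proportional_density N (\<lambda>x. w x * f x)"
proof -
  have "(\<integral>\<^sup>+y. ennreal (w y) \<partial>density N (\<lambda>x. ennreal (f x))) = (\<integral>\<^sup>+y. ennreal (w y * f y) \<partial>N)"
    using assms by (subst nn_integral_density) (auto simp: ennreal_mult mult.commute intro!: nn_integral_cong)
  then show ?thesis
    unfolding proportional_density_def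
    using assms by (subst density_density_eq)
      (auto simp: ennreal_mult mult_ac ennreal_times_divide intro!: density_cong)
qed

lemma proportional_density_distr:
  assumes [measurable]: "T \<in> measurable P N" "w \<in> borel_measurable N"
  shows "proportional_density (distr P N T) w = distr (proportional_density P (\<lambda>x. w (T x))) N T"
  unfolding proportional_density_def
  by (subst density_distr) (auto simp: nn_integral_distr)

lemma sets_proportional_density [simp, measurable_cong]: "sets (proportional_density N w) = sets N"
  by (simp add: proportional_density_def)

lemma space_proportional_density [simp]: "space (proportional_density N w) = space N"
  by (simp add: proportional_density_def)

lemma proportional_density_real:
  assumes "integrable N w" "\<And>x. w x \<ge> 0" "(\<integral>x. w x \<partial>N) > 0"
  shows "proportional_density N w = density N (\<lambda>x. ennreal (w x / (\<integral>x. w x \<partial>N)))"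
  unfolding proportional_density_def nn_integral_eq_integral[OF assms(1) AE_I2[OF assms(2)]]
  using assms by (simp add: divide_ennreal)

lemma prob_space_proportional_density:
  assumes "integrable N w" "\<And>x. w x \<ge> 0" "(\<integral>x. w x \<partial>N) > 0"
  shows "prob_space (proportional_density N w)"
proof
  have [measurable]: "w \<in> borel_measurable N" using assms(1) by auto
  have "emeasure (proportional_density N w) (space (proportional_density N w))
     = (\<integral>\<^sup>+x. ennreal (w x / (\<integral>x. w x \<partial>N)) \<partial>N)"
    unfolding proportional_density_real[OF assms] by (subst emeasure_density) (auto intro!: nn_integral_cong)
  also have "\<dots> = ennreal (\<integral>x. w x / (\<integral>x. w x \<partial>N) \<partial>N)"
    using assms by (intro nn_integral_eq_integral) auto
  also have "\<dots> = 1" using assms by simp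
  finally show "emeasure (proportional_density N w) (space (proportional_density N w)) = 1" .
qed

lemma integral_proportional_density:
  fixes h :: "'a \<Rightarrow> real"
  assumes "integrable N w" "\<And>x. w x \<ge> 0" "(\<integral>x. w x \<partial>N) > 0" "h \<in> borel_measurable N"
  shows "(\<integral>x. h x \<partial>proportional_density N w) = (\<integral>x. h x * w x \<partial>N) / (\<integral>x. w x \<partial>N)"
proof -
  have [measurable]: "w \<in> borel_measurable N" using assms(1) by auto
  show ?thesis
    unfolding proportional_density_real[OF assms(1-3)]
    using assms by (subst integral_density) (auto simp: mult.commute)
qed

text \<open>The reference measure of the ensembles is a product of Lebesgue measures with a product density; this
  identifies it with a product of probability measures, to which Aomoto's recursion applies.\<close>

lemma PiM_density:
  fixes f :: "'a \<Rightarrow> real"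
  assumes I: "finite I" and M: "sigma_finite_measure M" and f [measurable]: "f \<in> borel_measurable M"
    and f0: "\<And>x. f x \<ge> 0" and pr: "sigma_finite_measure (density M (\<lambda>x. ennreal (f x)))"
  shows "(\<Pi>\<^sub>M i\<in>I. density M (\<lambda>x. ennreal (f x))) = density (\<Pi>\<^sub>M i\<in>I. M) (\<lambda>x. ennreal (\<Prod>i\<in>I. f (x i)))"
proof -
  interpret M: product_sigma_finite "\<lambda>_. M" by (intro product_sigma_finite.intro M)
  interpret D: product_sigma_finite "\<lambda>_. density M (\<lambda>x. ennreal (f x))" by (intro product_sigma_finite.intro pr)
  have "density (\<Pi>\<^sub>M i\<in>I. M) (\<lambda>x. ennreal (\<Prod>i\<in>I. f (x i))) = (\<Pi>\<^sub>M i\<in>I. density M (\<lambda>x. ennreal (f x)))"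
  proof (rule D.PiM_eqI[OF I])
    show "sets (density (\<Pi>\<^sub>M i\<in>I. M) (\<lambda>x. ennreal (\<Prod>i\<in>I. f (x i)))) = sets (\<Pi>\<^sub>M i\<in>I. density M (\<lambda>x. ennreal (f x)))"
      by (simp cong: sets_PiM_cong)
    fix A assume A: "\<And>i. i \<in> I \<Longrightarrow> A i \<in> sets (density M (\<lambda>x. ennreal (f x)))"
    then have A' [measurable]: "i \<in> I \<Longrightarrow> A i \<in> sets M" for i by simp
    have box: "Pi\<^sub>E I A \<in> sets (\<Pi>\<^sub>M i\<in>I. M)" using I by (intro sets_PiM_I_finite A')
    have "emeasure (density (\<Pi>\<^sub>M i\<in>I. M) (\<lambda>x. ennreal (\<Prod>i\<in>I. f (x i)))) (Pi\<^sub>E I A)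
        = (\<integral>\<^sup>+x. ennreal (\<Prod>i\<in>I. f (x i)) * indicator (Pi\<^sub>E I A) x \<partial>(\<Pi>\<^sub>M i\<in>I. M))"
      using box by (subst emeasure_density) auto
    also have "\<dots> = (\<integral>\<^sup>+x. (\<Prod>i\<in>I. ennreal (f (x i)) * indicator (A i) (x i)) \<partial>(\<Pi>\<^sub>M i\<in>I. M))"
    proof (rule nn_integral_cong)
      fix x assume x: "x \<in> space (\<Pi>\<^sub>M i\<in>I. M)"
      then have "x \<in> extensional I" by (auto simp: space_PiM PiE_def)
      then have "indicator (Pi\<^sub>E I A) x = (\<Prod>i\<in>I. indicator (A i) (x i) :: ennreal)"
        using I by (auto simp: indicator_def PiE_def Pi_def)
      then show "ennreal (\<Prod>i\<in>I. f (x i)) * indicator (Pi\<^sub>E I A) x = (\<Prod>i\<in>I. ennreal (f (x i)) * indicator (A i) (x i))"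
        using f0 by (simp add: prod.distrib prod_ennreal)
    qed
    also have "\<dots> = (\<Prod>i\<in>I. \<integral>\<^sup>+x. ennreal (f x) * indicator (A i) x \<partial>M)"
      using I by (intro M.product_nn_integral_prod) auto
    also have "\<dots> = (\<Prod>i\<in>I. emeasure (density M (\<lambda>x. ennreal (f x))) (A i))"
      by (intro prod.cong refl) (simp add: emeasure_density)
    finally show "emeasure (density (\<Pi>\<^sub>M i\<in>I. M) (\<lambda>x. ennreal (\<Prod>i\<in>I. f (x i)))) (Pi\<^sub>E I A)
      = (\<Prod>i\<in>I. emeasure (density M (\<lambda>x. ennreal (f x))) (A i))" .
  qed
  then show ?thesis by simp
qed

context beta_cube
begin

text \<open>Both sides are laws on the unit interval, and both sequences of moments satisfy the same first-order recursion:
  on the left by Aomoto's recursion with \<open>S\<close> the full index set, on the right factor by factor.\<close>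

lemma law_of_product:
  "distr (proportional_density P (reg_vandermonde I g 0)) borel (\<lambda>x. \<Prod>i\<in>I. x i)
     = beta_prod (\<lambda>k. a + g * (real k - 1)) (\<lambda>_. b + g * (real (card I) - 1)) (card I)"
    (is "?D = beta_prod ?al ?b ?N")
proof -
  have int: "integrable P (reg_vandermonde I g 0)"
    using g by (intro cube_bounded_integrable cube_bounded_intros) auto
  note pd = int reg_vandermonde_nonneg reg_vandermonde_integral_pos
  interpret Q: prob_space "proportional_density P (reg_vandermonde I g 0)"
    by (rule prob_space_proportional_density[OF pd])
  have par: "?al k > 0 \<and> b + g * (real ?N - 1) > 0" if "k \<in> {1..?N}" for k
    using a b g that by (auto intro!: add_pos_nonneg)
  interpret W: prob_space "beta_prod ?al ?b ?N"
    by (rule prob_space_beta_prod[OF par])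
  have [measurable]: "(\<lambda>x. \<Prod>i\<in>I. x i) \<in> borel_measurable P"
    by (rule cube_bounded_integrable[THEN borel_measurable_integrable]) (intro cube_bounded_intros)
  have AEQ: "AE x in proportional_density P (reg_vandermonde I g 0). 0 \<le> (\<Prod>i\<in>I. x i) \<and> (\<Prod>i\<in>I. x i) \<le> 1"
    unfolding proportional_density_real[OF pd]
  proof (subst AE_density)
    show "AE x in P. 0 < ennreal (reg_vandermonde I g 0 x / (\<integral>x. reg_vandermonde I g 0 x \<partial>P)) \<longrightarrow>
        0 \<le> (\<Prod>i\<in>I. x i) \<and> (\<Prod>i\<in>I. x i) \<le> 1"
      using AE_cube by eventually_elim (auto intro!: prod_nonneg prod_le_1 simp: less_imp_le)
  qed measurable
  have mom: "(\<integral>u. u ^ q \<partial>?D) = (\<integral>x. (\<Prod>i\<in>I. x i) ^ q * reg_vandermonde I g 0 x \<partial>P) / (\<integral>x. reg_vandermonde I g 0 x \<partial>P)" for q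
    by (subst integral_distr) (auto intro!: integral_proportional_density[OF pd])
  have eq: "(\<integral>u. u ^ q \<partial>?D) = (\<integral>u. u ^ q \<partial>beta_prod ?al ?b ?N)" for q
  proof (induction q)
    case 0
    have "prob_space ?D" by (rule Q.prob_space_distr) measurable
    then interpret D: prob_space ?D .
    show ?case using D.prob_space W.prob_space by simp
  next
    case (Suc q)
    interpret q: beta_cube I a b g q by unfold_locales (simp_all add: a b g)
    have "(\<integral>u. u ^ Suc q \<partial>?D) = q.moment I / (\<integral>x. reg_vandermonde I g 0 x \<partial>P)"
      unfolding mom q.moment_def q.integrand_def by (simp add: mult_ac)
    also have "q.moment I = q.moment {} * (\<Prod>k\<in>{1..?N}. (a + g * (real k - 1) + q) / (a + g * (real k - 1) + (b + g * (real (card I) - 1)) + q))"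
      by (rule q.moment_full)
    also have "\<dots> / (\<integral>x. reg_vandermonde I g 0 x \<partial>P) = (\<integral>u. u ^ q \<partial>?D) *
        (\<Prod>k\<in>{1..?N}. (a + g * (real k - 1) + q) / (a + g * (real k - 1) + (b + g * (real (card I) - 1)) + q))"
      unfolding mom q.moment_def q.integrand_def by simp
    also have "\<dots> = (\<integral>u. u ^ Suc q \<partial>beta_prod ?al ?b ?N)"
      unfolding Suc.IH by (rule beta_prod_moment_ratio[symmetric]) (rule par)
    finally show ?case .
  qed
  show ?thesis
  proof (rule moments_determine)
    show "real_distribution ?D" by (rule Q.real_distribution_distr) measurable
    show "real_distribution (beta_prod ?al ?b ?N)"
      by unfold_locales auto
    show "AE x in ?D. 0 \<le> x \<and> x \<le> 1"
      using AEQ by (subst AE_distr_iff) auto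
    have "AE x in beta_prod ?al ?b ?N. 0 < x \<and> x \<le> 1" by (rule AE_beta_prod) (rule par)
    then show "AE x in beta_prod ?al ?b ?N. 0 \<le> x \<and> x \<le> 1" by eventually_elim auto
  qed (rule eq)
qed

end

text \<open>The off-diagonal pairs are those below the diagonal together with their mirror images.\<close>

lemma reg_vandermonde_eq:
  "reg_vandermonde {1..n} g 0 x = vandermonde_abs n x powr (2 * g)"
proof -
  let ?S = "SIGMA k:{1..n}. {1..<k}"
  have abs_powr: "(d\<^sup>2) powr (g / 2) = \<bar>d\<bar> powr g" for d :: real
  proof (cases "d = 0")
    case False
    have "(d\<^sup>2) powr (g / 2) = (\<bar>d\<bar> powr 2) powr (g / 2)" using False by simp
    also have "\<dots> = \<bar>d\<bar> powr g" by (simp only: powr_powr) simp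
    finally show ?thesis .
  qed simp
  have split: "off_diagonal {1..n} = ?S \<union> prod.swap ` ?S"
    by (auto simp: image_iff) 
  have "reg_vandermonde {1..n} g 0 x = (\<Prod>(i, j)\<in>?S \<union> prod.swap ` ?S. \<bar>x i - x j\<bar> powr g)"
    unfolding reg_vandermonde_def split by (simp add: abs_powr)
  also have "\<dots> = (\<Prod>(i, j)\<in>?S. \<bar>x i - x j\<bar> powr g) * (\<Prod>(i, j)\<in>prod.swap ` ?S. \<bar>x i - x j\<bar> powr g)"
    by (intro prod.union_disjoint) auto
  also have "(\<Prod>(i, j)\<in>prod.swap ` ?S. \<bar>x i - x j\<bar> powr g) = (\<Prod>(i, j)\<in>?S. \<bar>x i - x j\<bar> powr g)"
    by (subst prod.reindex) (auto intro!: prod.cong simp: abs_minus_commute)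
  also have "(\<Prod>(i, j)\<in>?S. \<bar>x i - x j\<bar> powr g) = vandermonde_abs n x powr g"
  proof -
    have "vandermonde_abs n x = (\<Prod>(i, j)\<in>?S. \<bar>x i - x j\<bar>)"
      unfolding vandermonde_abs_def by (subst prod.Sigma) auto
    then show ?thesis by (simp add: case_prod_beta prod_powr_distrib)
  qed
  finally show ?thesis by (simp add: powr_add[symmetric])
qed

lemma scaled_beta_density:
  assumes ab: "a > 0" "b > 0" and L: "L > 0"
  defines "w \<equiv> \<lambda>x. indicator {0<..<L} x * x powr (a - 1) * (1 - x / L) powr (b - 1)"
  shows "distr (beta_distribution a b) borel (\<lambda>x. L * x)
     = density lborel (\<lambda>x. ennreal (L powr (- a) / Beta a b * w x))"
proof -
  define f where "f x = indicator {0<..<1} x * (x powr (a - 1) * (1 - x) powr (b - 1) / Beta a b)" for x :: real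
  have [measurable]: "f \<in> borel_measurable borel" unfolding f_def by measurable
  have f0: "f x \<ge> 0" for x using Beta_real_pos[OF ab] by (simp add: f_def)
  have "distr (beta_distribution a b) borel (\<lambda>x. L * x)
      = distr (density lborel (\<lambda>x. ennreal (f ((L * x) / L)))) borel ((*) L)"
    using L by (simp add: beta_distribution_def f_def)
  also have "\<dots> = density (distr lborel borel ((*) L)) (\<lambda>y. ennreal (f (y / L)))"
    by (rule density_distr[symmetric]) auto
  also have "\<dots> = density lborel (\<lambda>y. ennreal (inverse L) * ennreal (f (y / L)))"
    using L by (subst lborel_distr_mult) (auto simp: density_density_eq)
  also have "\<dots> = density lborel (\<lambda>x. ennreal (L powr (- a) / Beta a b * w x))"
  proof (rule density_cong)
    show "AE x in lborel. ennreal (inverse L) * ennreal (f (x / L)) = ennreal (L powr (- a) / Beta a b * w x)"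
    proof (rule AE_I2)
      fix x :: real
      have "inverse L * f (x / L) = L powr (- a) / Beta a b * w x"
      proof (cases "0 < x \<and> x < L")
        case True
        have "(x / L) powr (a - 1) = x powr (a - 1) * L powr (- a) * L"
          using True L by (simp add: powr_divide powr_diff powr_minus field_simps)
        then show ?thesis using True L by (simp add: f_def w_def field_simps)
      next
        case False
        then show ?thesis using L by (auto simp: f_def w_def indicator_def field_simps)
      qed
      then show "ennreal (inverse L) * ennreal (f (x / L)) = ennreal (L powr (- a) / Beta a b * w x)"
        using L f0 by (simp add: ennreal_mult[symmetric])
    qed
  qed (auto simp: w_def)
  finally show ?thesis .
qed

text \<open>Rescaling all coordinates by \<open>L\<close> multiplies the Vandermonde factor by a constant, which the
  normalisation absorbs. The interval \<open>{0<..<L}\<close> with the weight written in \<open>x / L\<close> covers the Jacobi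
  ensemble (\<open>L = 1\<close>) and, as \<open>L\<close> and \<open>b\<close> grow together, approximates the Laguerre ensemble.\<close>

theorem selberg_law:
  fixes a b g L :: real and n :: nat
  assumes ab: "a > 0" "b > 0" "g > 0" and L: "L > 0"
  defines "w \<equiv> \<lambda>x. indicator {0<..<L} x * x powr (a - 1) * (1 - x / L) powr (b - 1)"
  shows "distr (proportional_density (\<Pi>\<^sub>M k\<in>{1..n}. lborel)
           (\<lambda>x. vandermonde_abs n x powr (2 * g) * (\<Prod>k\<in>{1..n}. w (x k)))) borel (\<lambda>x. \<Prod>k\<in>{1..n}. x k)
      = distr (beta_prod (\<lambda>k. a + g * (real k - 1)) (\<lambda>_. b + g * (real n - 1)) n) borel (\<lambda>u. L ^ n * u)"
proof -
  interpret beta_cube "{1..n}" a b g 0 using ab by unfold_locales auto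
  let ?I = "{1..n}"
  define c where "c = L powr (- a) / Beta a b"
  have c: "c > 0" using L Beta_real_pos[OF ab(1,2)] by (simp add: c_def)
  have [measurable]: "w \<in> borel_measurable borel" unfolding w_def by measurable
  have w0: "w x \<ge> 0" for x unfolding w_def by simp
  let ?S = "distr B borel (\<lambda>x. L * x)"
  interpret S: prob_space ?S by (rule B.prob_space_distr) measurable
  have S: "?S = density lborel (\<lambda>x. ennreal (c * w x))"
    unfolding c_def w_def using scaled_beta_density[OF ab(1,2) L] by simp
  have V0: "reg_vandermonde ?I g 0 x \<ge> 0" for x :: "nat \<Rightarrow> real" by (rule reg_vandermonde_nonneg)
  have setsL: "sets (\<Pi>\<^sub>M k\<in>?I. lborel :: real measure) = sets (\<Pi>\<^sub>M k\<in>?I. borel)"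
    by (intro sets_PiM_cong) auto
  have VL [measurable]: "reg_vandermonde ?I g 0 \<in> borel_measurable (\<Pi>\<^sub>M k\<in>?I. lborel)"
    using reg_vandermonde_measurable[of ?I g 0] by (simp cong: measurable_cong_sets add: setsL)
  define T where "T = compose ?I ((*) L)"
  have T: "(\<Pi>\<^sub>M k\<in>?I. ?S) = distr P P T"
  proof -
    have "distr P P T = (\<Pi>\<^sub>M k\<in>?I. distr B B ((*) L))"
      unfolding T_def by (rule distr_PiM_finite_prob_space') (auto simp: B.prob_space_axioms)
    also have "distr B B ((*) L) = ?S" by (rule distr_cong) auto
    finally show ?thesis by simp
  qed
  have Tm [measurable]: "T \<in> measurable P P"
    unfolding T_def compose_def by (intro measurable_restrict) auto
  define K where "K = (\<Prod>q\<in>off_diagonal ?I. L powr g)"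
  have K: "K > 0" using L by (auto simp: K_def intro!: prod_pos)
  have VT: "reg_vandermonde ?I g 0 (T x) = K * reg_vandermonde ?I g 0 x" for x
  proof -
    have "reg_vandermonde ?I g 0 (T x) = (\<Prod>(i, j)\<in>off_diagonal ?I. L powr g * ((x i - x j)\<^sup>2 + 0) powr (g / 2))"
      unfolding reg_vandermonde_def
    proof (rule prod.cong, simp, clarify)
      fix i j assume "i \<in> ?I" "j \<in> ?I"
      then have "(T x i - T x j)\<^sup>2 = L\<^sup>2 * (x i - x j)\<^sup>2"
        by (simp add: T_def compose_def power_mult_distrib[symmetric] algebra_simps)
      moreover have "(L\<^sup>2) powr (g / 2) = L powr g"
        using L by (simp add: powr_powr powr_numeral[symmetric] del: powr_numeral)
      ultimately show "((T x i - T x j)\<^sup>2 + 0) powr (g / 2) = L powr g * ((x i - x j)\<^sup>2 + 0) powr (g / 2)"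
        using L by (simp add: powr_mult)
    qed
    then show ?thesis by (simp add: K_def reg_vandermonde_def case_prod_beta prod.distrib)
  qed
  have VP [measurable]: "reg_vandermonde ?I g 0 \<in> borel_measurable P"
    using reg_vandermonde_measurable[of ?I g 0] by (simp cong: measurable_cong_sets add: sets_P)
  have "proportional_density (\<Pi>\<^sub>M k\<in>?I. lborel)
           (\<lambda>x. vandermonde_abs n x powr (2 * g) * (\<Prod>k\<in>?I. w (x k)))
      = proportional_density (\<Pi>\<^sub>M k\<in>?I. lborel) (\<lambda>x. c ^ n * (reg_vandermonde ?I g 0 x * (\<Prod>k\<in>?I. w (x k))))"
    unfolding reg_vandermonde_eq[symmetric] using c
    by (intro proportional_density_cmult[symmetric]) auto
  also have "\<dots> = proportional_density (\<Pi>\<^sub>M k\<in>?I. lborel) (\<lambda>x. reg_vandermonde ?I g 0 x * (\<Prod>k\<in>?I. c * w (x k)))"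
    by (simp add: prod.distrib mult_ac)
  also have "\<dots> = proportional_density (density (\<Pi>\<^sub>M k\<in>?I. lborel) (\<lambda>x. ennreal (\<Prod>k\<in>?I. c * w (x k)))) (reg_vandermonde ?I g 0)"
    using V0 w0 c by (intro proportional_density_density[symmetric]) (auto intro!: prod_nonneg)
  also have "density (\<Pi>\<^sub>M k\<in>?I. lborel) (\<lambda>x. ennreal (\<Prod>k\<in>?I. c * w (x k))) = (\<Pi>\<^sub>M k\<in>?I. density lborel (\<lambda>x. ennreal (c * w x)))"
    using c w0 S.sigma_finite_measure S
    by (intro PiM_density[symmetric]) (auto intro: lborel.sigma_finite_measure_axioms)
  also have "\<dots> = distr P P T" unfolding S[symmetric] by (rule T)
  also have "proportional_density (distr P P T) (reg_vandermonde ?I g 0)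
      = distr (proportional_density P (\<lambda>x. K * reg_vandermonde ?I g 0 x)) P T"
    using proportional_density_distr[OF Tm VP] by (simp only: VT)
  also have "proportional_density P (\<lambda>x. K * reg_vandermonde ?I g 0 x) = proportional_density P (reg_vandermonde ?I g 0)"
    using K by (intro proportional_density_cmult) auto
  finally have main: "proportional_density (\<Pi>\<^sub>M k\<in>?I. lborel)
           (\<lambda>x. vandermonde_abs n x powr (2 * g) * (\<Prod>k\<in>?I. w (x k)))
     = distr (proportional_density P (reg_vandermonde ?I g 0)) P T" .
  have [measurable]: "(\<lambda>x. \<Prod>i\<in>?I. x i) \<in> borel_measurable P"
    by (rule cube_bounded_integrable[THEN borel_measurable_integrable]) (intro cube_bounded_intros)
  have "distr (distr (proportional_density P (reg_vandermonde ?I g 0)) P T) borel (\<lambda>x. \<Prod>k\<in>?I. x k)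
     = distr (proportional_density P (reg_vandermonde ?I g 0)) borel (\<lambda>x. L ^ n * (\<Prod>k\<in>?I. x k))"
  proof (subst distr_distr)
    show "T \<in> measurable (proportional_density P (reg_vandermonde ?I g 0)) P" by measurable
    show "distr (proportional_density P (reg_vandermonde ?I g 0)) borel ((\<lambda>x. \<Prod>k\<in>?I. x k) \<circ> T)
       = distr (proportional_density P (reg_vandermonde ?I g 0)) borel (\<lambda>x. L ^ n * (\<Prod>k\<in>?I. x k))"
      by (rule distr_cong) (auto simp: T_def compose_def prod.distrib)
  qed measurable
  also have "\<dots> = distr (distr (proportional_density P (reg_vandermonde ?I g 0)) borel (\<lambda>x. \<Prod>i\<in>?I. x i)) borel (\<lambda>u. L ^ n * u)"
    by (subst distr_distr) (auto simp: o_def)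
  finally show ?thesis unfolding main law_of_product by simp
qed

section \<open>Calculus of the normal distribution function and one exchange step\<close>

definition Phi :: "real \<Rightarrow> real" where
  "Phi x = cdf std_normal_distribution x"

interpretation std_normal: real_distribution std_normal_distribution
  by (rule real_dist_normal_dist)

lemma Phi_bounds: "0 \<le> Phi x" "Phi x \<le> 1"
  by (simp_all add: Phi_def std_normal.cdf_nonneg std_normal.cdf_bounded_prob)

lemma Phi_diff:
  assumes "a \<le> u"
  shows "Phi u = Phi a + integral {a..u} std_normal_density"
proof -
  have cont: "continuous_on {a..u} std_normal_density"
    unfolding std_normal_density_def by (intro continuous_intros) auto
  have "Phi u - Phi a = measure std_normal_distribution {a<..u}"
    unfolding Phi_def using assms
    by (cases "a = u") (auto simp: std_normal.cdf_diff_eq)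
  also have "\<dots> = (\<integral>x. indicator {a<..u} x \<partial>std_normal_distribution)" by simp
  also have "\<dots> = (\<integral>x. std_normal_density x *\<^sub>R indicator {a<..u} x \<partial>lborel)"
    by (subst integral_density) auto
  also have "\<dots> = (\<integral>x. indicator {a..u} x *\<^sub>R std_normal_density x \<partial>lborel)"
    by (intro integral_cong_AE) (auto intro!: AE_I[where N="{a}"] simp: indicator_def)
  also have "\<dots> = integral {a..u} std_normal_density"
    using set_borel_integral_eq_integral(2)[OF borel_integrable_atLeastAtMost'[OF cont]]
    by (simp add: set_lebesgue_integral_def)
  finally show ?thesis by simp
qed

lemma DERIV_Phi [derivative_intros]:
  assumes "(f has_real_derivative f') (at x within A)"
  shows "((\<lambda>x. Phi (f x)) has_real_derivative std_normal_density (f x) * f') (at x within A)"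
proof -
  have "(Phi has_real_derivative std_normal_density y) (at y)" for y
  proof -
    have cont: "continuous_on {y-1..y+1} std_normal_density"
      unfolding std_normal_density_def by (intro continuous_intros) auto
    have "((\<lambda>u. Phi (y - 1) + integral {y-1..u} std_normal_density) has_real_derivative (0 + std_normal_density y)) (at y within {y-1..y+1})"
      by (rule DERIV_add[OF DERIV_const integral_has_real_derivative[OF cont]]) auto
    then have "((\<lambda>u. Phi (y - 1) + integral {y-1..u} std_normal_density) has_real_derivative std_normal_density y) (at y)"
      using at_within_Icc_at[of "y - 1" y "y + 1"] by (simp only: add_0)
    then show ?thesis
    proof (rule DERIV_cong_ev[OF refl _ refl, THEN iffD1, rotated])
      show "\<forall>\<^sub>F u in nhds y. Phi (y - 1) + integral {y-1..u} std_normal_density = Phi u"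
        using eventually_nhds_in_open[of "{y-1<..<y+1}" y]
        by (force elim!: eventually_mono intro: Phi_diff[symmetric])
    qed
  qed
  from DERIV_chain2[OF this assms] show ?thesis .
qed

lemma DERIV_std_normal_density [derivative_intros]:
  assumes "(f has_real_derivative f') (at x within A)"
  shows "((\<lambda>x. std_normal_density (f x)) has_real_derivative - f x * std_normal_density (f x) * f') (at x within A)"
proof -
  have "((\<lambda>x. exp (- (f x)\<^sup>2 / 2)) has_real_derivative exp (- (f x)\<^sup>2 / 2) * (- f x * f')) (at x within A)"
    using assms by (auto intro!: derivative_eq_intros)
  from DERIV_cmult[OF this, of "1 / sqrt (2 * pi)"] show ?thesis
    unfolding std_normal_density_def by (simp only: mult_ac mult_minus_left mult_minus_right)
qed

lemma isCont_Phi: "isCont Phi x"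
  using DERIV_Phi[OF DERIV_ident] by (rule DERIV_isCont)

lemma Phi_measurable [measurable]: "Phi \<in> borel_measurable borel"
  using isCont_Phi by (intro borel_measurable_continuous_onI continuous_at_imp_continuous_on) auto

text \<open>These polynomials in \<open>z\<close> arise from the first three derivatives of \<open>Phi\<close> in space and the first two in
  the variance. All bounds come from \<open>exp (z\<^sup>2 / 2) \<ge> 1 + z\<^sup>2 / 2 + z ^ 4 / 8\<close> and
  \<open>sqrt (2 * pi) \<ge> 2\<close>.\<close>

lemma std_normal_density_bounds:
  fixes z :: real
  shows "std_normal_density z \<le> 1" "\<bar>z\<bar> * std_normal_density z \<le> 1"
    "\<bar>1 - z\<^sup>2\<bar> * std_normal_density z \<le> 1" "\<bar>3 * z - z ^ 3\<bar> * std_normal_density z \<le> 4"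
proof -
  define E where "E = exp (z\<^sup>2 / 2)"
  have E: "E \<ge> 1 + z\<^sup>2 / 2 + z ^ 4 / 8"
    using exp_lower_Taylor_quadratic[of "z\<^sup>2 / 2"] by (simp add: E_def power_divide flip: power_mult)
  have E0: "E > 0" by (simp add: E_def)
  have "2 \<le> sqrt (2 * pi)" using pi_gt3 by (intro real_le_rsqrt) auto
  then have "1 / sqrt (2 * pi) \<le> 1 / 2" by (intro divide_left_mono) auto
  then have dens: "std_normal_density z \<le> 1 / (2 * E)"
    using E0 unfolding std_normal_density_def E_def by (simp add: exp_minus field_simps)
  have key: "c * std_normal_density z \<le> K" if "0 \<le> c" "c \<le> 2 * K * E" for c K
  proof -
    have "c * std_normal_density z \<le> c * (1 / (2 * E))" using dens that by (intro mult_left_mono) auto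
    also have "\<dots> \<le> K" using that E0 by (simp add: field_simps)
    finally show ?thesis .
  qed
  have z4: "z ^ 4 \<ge> 0" "z\<^sup>2 \<ge> 0" by auto
  have "1 * std_normal_density z \<le> 1" by (rule key) (use E z4 in linarith)+
  then show "std_normal_density z \<le> 1" by simp
  have z1: "2 * \<bar>z\<bar> \<le> 1 + z\<^sup>2" using sum_squares_ge_zero[of "\<bar>z\<bar> - 1" 0] by (simp add: power2_eq_square algebra_simps)
  show "\<bar>z\<bar> * std_normal_density z \<le> 1" by (rule key) (use E z4 z1 in linarith)+
  show "\<bar>1 - z\<^sup>2\<bar> * std_normal_density z \<le> 1" by (rule key) (use E z4 in linarith)+
  have z3: "2 * \<bar>z ^ 3\<bar> \<le> z\<^sup>2 + z ^ 4"
  proof -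
    have "0 \<le> z\<^sup>2 * (\<bar>z\<bar> - 1)\<^sup>2" by simp
    also have "\<dots> = z\<^sup>2 * \<bar>z\<bar>\<^sup>2 - 2 * (z\<^sup>2 * \<bar>z\<bar>) + z\<^sup>2"
      by (simp add: power2_eq_square algebra_simps)
    also have "\<dots> = z ^ 4 - 2 * \<bar>z ^ 3\<bar> + z\<^sup>2"
      by (simp add: power_abs power3_eq_cube power2_eq_square power4_eq_xxxx abs_mult)
    finally show ?thesis by simp
  qed
  have "\<bar>3 * z - z ^ 3\<bar> \<le> 3 * \<bar>z\<bar> + \<bar>z ^ 3\<bar>" using abs_triangle_ineq4[of "3 * z" "z ^ 3"] by (simp add: abs_mult)
  then show "\<bar>3 * z - z ^ 3\<bar> * std_normal_density z \<le> 4"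
    by (intro key) (use E z4 z1 z3 in linarith)+
qed

lemma Phi_lipschitz: "\<bar>Phi x - Phi y\<bar> \<le> \<bar>x - y\<bar>"
proof -
  have "\<bar>Phi x - Phi y\<bar> \<le> 1 * \<bar>x - y\<bar>"
    using field_differentiable_bound[of UNIV Phi std_normal_density 1 x y]
      DERIV_Phi[OF DERIV_ident] std_normal_density_bounds(1)
    by (auto simp: real_norm_def)
  then show ?thesis by simp
qed

text \<open>Taylor's formula of order three in \<open>x\<close>; the coefficient of \<open>x\<^sup>2 / 2\<close> is the one that the Gaussian of
  \<open>Phi_heat\<close> has to match.\<close>

lemma Phi_taylor:
  assumes t: "t > 0"
  shows "\<bar>Phi ((y - x) / t) - Phi (y / t) + std_normal_density (y / t) / t * x
      + (y / t) * std_normal_density (y / t) / t\<^sup>2 * x\<^sup>2 / 2\<bar> \<le> \<bar>x\<bar> ^ 3 / t ^ 3"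
proof -
  define u where "u x = (y - x) / t" for x
  define d where "d m x = (if m = 0 then Phi (u x)
     else if m = 1 then - std_normal_density (u x) / t
     else if m = 2 then - u x * std_normal_density (u x) / t\<^sup>2
     else (1 - (u x)\<^sup>2) * std_normal_density (u x) / t ^ 3)" for m :: nat and x
  have u: "(u has_real_derivative - 1 / t) (at x)" for x
    unfolding u_def using t by (auto intro!: derivative_eq_intros)
  have D: "(d m has_real_derivative d (Suc m) x) (at x)" if "m < 3" for m x
  proof -
    consider "m = 0" | "m = 1" | "m = 2" using \<open>m < 3\<close> by linarith
    then show ?thesis
    proof cases
      case 1
      have "((\<lambda>x. Phi (u x)) has_real_derivative std_normal_density (u x) * (- 1 / t)) (at x)"
        by (intro derivative_intros u)
      then show ?thesis using 1 by (simp add: d_def[abs_def])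
    next
      case 2
      have "((\<lambda>x. - std_normal_density (u x) / t) has_real_derivative
          - (- u x * std_normal_density (u x) * (- 1 / t)) / t) (at x)"
        by (intro DERIV_cdivide DERIV_minus DERIV_std_normal_density u)
      then show ?thesis using 2 by (simp add: d_def[abs_def] power2_eq_square)
    next
      case 3
      have "((\<lambda>x. - u x * std_normal_density (u x) / t\<^sup>2) has_real_derivative
          (- (- 1 / t) * std_normal_density (u x) + (- u x * std_normal_density (u x) * (- 1 / t)) * (- u x)) / t\<^sup>2) (at x)"
        using t by (auto intro!: derivative_eq_intros u simp: field_simps)
      moreover have "(- (- 1 / t) * std_normal_density (u x) + (- u x * std_normal_density (u x) * (- 1 / t)) * (- u x)) / t\<^sup>2
         = (1 - (u x)\<^sup>2) * std_normal_density (u x) / t ^ 3"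
        using t by (simp add: field_simps power2_eq_square power3_eq_cube)
      ultimately show ?thesis using 3 by (simp add: d_def[abs_def])
    qed
  qed
  obtain s where s: "Phi (u x) = (\<Sum>m<3. d m 0 / fact m * x ^ m) + d 3 s / fact 3 * x ^ 3"
    using Maclaurin_bi_le[of d "\<lambda>x. Phi (u x)" 3 x] D by (auto simp: d_def[abs_def])
  have "(\<Sum>m<3. d m 0 / fact m * x ^ m) = Phi (y / t) - std_normal_density (y / t) / t * x
      - (y / t) * std_normal_density (y / t) / t\<^sup>2 * x\<^sup>2 / 2"
    by (simp add: numeral_3_eq_3 d_def u_def power2_eq_square)
  then have "Phi ((y - x) / t) - Phi (y / t) + std_normal_density (y / t) / t * x
      + (y / t) * std_normal_density (y / t) / t\<^sup>2 * x\<^sup>2 / 2 = d 3 s / fact 3 * x ^ 3"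
    using s by (simp add: u_def)
  also have "\<bar>\<dots>\<bar> = \<bar>d 3 s\<bar> / 6 * \<bar>x\<bar> ^ 3" by (simp add: abs_mult power_abs fact_numeral)
  also have "\<dots> \<le> (1 / t ^ 3) * \<bar>x\<bar> ^ 3"
  proof (rule mult_right_mono)
    have "\<bar>d 3 s\<bar> = (\<bar>1 - (u s)\<^sup>2\<bar> * std_normal_density (u s)) / t ^ 3"
      using t by (simp add: d_def abs_mult)
    also have "\<dots> \<le> 1 / t ^ 3"
      using t by (intro divide_right_mono std_normal_density_bounds) auto
    finally show "\<bar>d 3 s\<bar> / 6 \<le> 1 / t ^ 3" by linarith
  qed auto
  finally show ?thesis by simp
qed

text \<open>Replacing the width \<open>t\<close> by \<open>sqrt (t\<^sup>2 + s)\<close> is the convolution with a centered Gaussian of variance \<open>s\<close>.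
  Because of the heat equation, the derivative in \<open>s\<close> is half of the second derivative in \<open>y\<close>; so the
  effect of the Gaussian is computed by differentiating in the variance, without a convolution.\<close>

lemma Phi_heat:
  assumes t: "t > 0" and s: "s \<ge> 0"
  shows "\<bar>Phi (y / sqrt (t\<^sup>2 + s)) - Phi (y / t)\<bar> \<le> s / t\<^sup>2"
    and "\<bar>Phi (y / sqrt (t\<^sup>2 + s)) - Phi (y / t) + (y / t) * std_normal_density (y / t) / t\<^sup>2 * s / 2\<bar> \<le> s\<^sup>2 / t ^ 4"
proof -
  define z where "z v = y / sqrt (t\<^sup>2 + v)" for v
  have z: "(z has_real_derivative - z v / (2 * (t\<^sup>2 + v))) (at v)" if "v \<ge> 0" for v
  proof -
    have p: "t\<^sup>2 + v > 0" using t that by (simp add: add_pos_nonneg)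
    then show ?thesis unfolding z_def
      by (auto intro!: derivative_eq_intros simp: field_simps power2_eq_square)
  qed
  define H' where "H' v = - z v * std_normal_density (z v) / (2 * (t\<^sup>2 + v))" for v
  define H'' where "H'' v = std_normal_density (z v) * (3 * z v - z v ^ 3) / (4 * (t\<^sup>2 + v)\<^sup>2)" for v
  have d1: "((\<lambda>v. Phi (z v)) has_real_derivative H' v) (at v)" if "v \<ge> 0" for v
    unfolding H'_def using z[OF that] by (auto intro!: derivative_eq_intros)
  have d2: "(H' has_real_derivative H'' v) (at v)" if v: "v \<ge> 0" for v
  proof -
    have p: "t\<^sup>2 + v > 0" using t that by (simp add: add_pos_nonneg)
    define q where "q = t\<^sup>2 + v"
    have num: "((\<lambda>v. - z v * std_normal_density (z v)) has_real_derivative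
        - (- z v / (2 * (t\<^sup>2 + v))) * std_normal_density (z v)
          + (- z v * std_normal_density (z v) * (- z v / (2 * (t\<^sup>2 + v)))) * (- z v)) (at v)"
      by (rule DERIV_mult[OF DERIV_minus[OF z[OF v]] DERIV_std_normal_density[OF z[OF v]]])
    have den: "((\<lambda>v. 2 * (t\<^sup>2 + v)) has_real_derivative 2) (at v)"
      by (auto intro!: derivative_eq_intros)
    have "(H' has_real_derivative
        ((- (- z v / (2 * (t\<^sup>2 + v))) * std_normal_density (z v) + (- z v * std_normal_density (z v) * (- z v / (2 * (t\<^sup>2 + v)))) * (- z v)) * (2 * (t\<^sup>2 + v))
          - (- z v * std_normal_density (z v)) * 2) / ((2 * (t\<^sup>2 + v)) * (2 * (t\<^sup>2 + v)))) (at v)"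
      unfolding H'_def[abs_def] using p by (intro DERIV_divide num den) simp
    moreover have "((- (- z v / (2 * q)) * std_normal_density (z v) + (- z v * std_normal_density (z v) * (- z v / (2 * q))) * (- z v)) * (2 * q)
          - (- z v * std_normal_density (z v)) * 2) / ((2 * q) * (2 * q)) = std_normal_density (z v) * (3 * z v - z v ^ 3) / (4 * q\<^sup>2)"
      using p unfolding q_def[symmetric] by (simp add: field_simps power2_eq_square power3_eq_cube)
    ultimately show ?thesis unfolding H''_def q_def by simp
  qed
  have z0: "z 0 = y / t" using t by (simp add: z_def)
  have b1: "\<bar>H' v\<bar> \<le> 1 / t\<^sup>2" if "v \<ge> 0" for v
  proof -
    have "\<bar>H' v\<bar> = (\<bar>z v\<bar> * std_normal_density (z v)) / (2 * (t\<^sup>2 + v))"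
      using that t by (simp add: H'_def abs_mult)
    also have "\<dots> \<le> 1 / t\<^sup>2"
      using that t std_normal_density_bounds(2)[of "z v"] by (intro frac_le) auto
    finally show ?thesis .
  qed
  have b2: "\<bar>H'' v\<bar> \<le> 1 / t ^ 4" if "v \<ge> 0" for v
  proof -
    have "\<bar>H'' v\<bar> = (\<bar>3 * z v - z v ^ 3\<bar> * std_normal_density (z v) / 4) / (t\<^sup>2 + v)\<^sup>2"
      by (simp add: H''_def abs_mult)
    also have "\<dots> \<le> 1 / t ^ 4"
    proof (rule frac_le)
      have "(t\<^sup>2)\<^sup>2 \<le> (t\<^sup>2 + v)\<^sup>2" using that by (intro power_mono) auto
      then show "t ^ 4 \<le> (t\<^sup>2 + v)\<^sup>2" by (simp flip: power_mult)
    qed (use t std_normal_density_bounds(4)[of "z v"] in auto)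
    finally show ?thesis .
  qed
  define df where "df m v = (if m = 0 then Phi (z v) else if m = 1 then H' v else H'' v)" for m :: nat and v
  have DF: "(df m has_real_derivative df (Suc m) v) (at v)" if "m < 2" "v \<ge> 0" for m v
  proof -
    have "m = 0 \<or> m = 1" using that by linarith
    then show ?thesis using d1[OF that(2)] d2[OF that(2)] by (auto simp: df_def[abs_def])
  qed
  have "\<exists>w. 0 \<le> w \<and> Phi (z s) = Phi (z 0) + s * H' w"
  proof (cases "s = 0")
    case False
    then have "0 < s" using s by simp
    then obtain w where "0 < w" "Phi (z s) - Phi (z 0) = (s - 0) * H' w"
      using MVT2[of 0 s "\<lambda>v. Phi (z v)" H'] d1 by blast
    then show ?thesis by (intro exI[of _ w]) auto
  qed auto
  then obtain w where w: "0 \<le> w" "Phi (z s) = Phi (z 0) + s * H' w" by blast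
  show "\<bar>Phi (y / sqrt (t\<^sup>2 + s)) - Phi (y / t)\<bar> \<le> s / t\<^sup>2"
  proof -
    have "Phi (y / sqrt (t\<^sup>2 + s)) - Phi (y / t) = s * H' w"
      using w(2) unfolding z0 by (simp add: z_def)
    then show ?thesis using mult_left_mono[OF b1[OF w(1)] s] s by (simp add: abs_mult)
  qed
  have "\<exists>w. 0 \<le> w \<and> Phi (z s) = Phi (z 0) + H' 0 * s + H'' w / 2 * s\<^sup>2"
  proof (cases "s = 0")
    case False
    then have "0 < s" using s by simp
    from Maclaurin[OF this, of 2 df "\<lambda>v. Phi (z v)"] DF
    have "\<exists>w. 0 < w \<and> w < s \<and> Phi (z s) = (\<Sum>m<2. df m 0 / fact m * s ^ m) + df 2 w / fact 2 * s ^ 2"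
      by (auto simp: df_def[abs_def])
    then show ?thesis by (auto simp: df_def numeral_2_eq_2 intro: less_imp_le)
  qed auto
  moreover have zs: "z s = y / sqrt (t\<^sup>2 + s)" by (simp add: z_def)
  ultimately obtain w where w: "0 \<le> w" "Phi (z s) = Phi (z 0) + H' 0 * s + H'' w / 2 * s\<^sup>2" by blast
  have "Phi (y / sqrt (t\<^sup>2 + s)) - Phi (y / t) + (y / t) * std_normal_density (y / t) / t\<^sup>2 * s / 2 = H'' w / 2 * s\<^sup>2"
    using w(2) zs unfolding H'_def z0 by simp
  also have "\<bar>\<dots>\<bar> = \<bar>H'' w\<bar> / 2 * s\<^sup>2" by (simp add: abs_mult)
  also have "\<dots> \<le> (1 / t ^ 4) * s\<^sup>2"
    using b2[OF w(1)] by (intro mult_right_mono) auto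
  finally show "\<bar>Phi (y / sqrt (t\<^sup>2 + s)) - Phi (y / t) + (y / t) * std_normal_density (y / t) / t\<^sup>2 * s / 2\<bar> \<le> s\<^sup>2 / t ^ 4"
    by simp
qed

text \<open>In the variable \<open>u = ln k\<close> the derivative of \<open>Phi (exp u * x)\<close> is \<open>z\<close> times the density at
  \<open>z = exp u * x\<close>, hence at most \<open>1\<close> uniformly in \<open>x\<close>.\<close>

lemma Phi_scale:
  assumes "k > 0"
  shows "\<bar>Phi (k * x) - Phi x\<bar> \<le> \<bar>ln k\<bar>"
proof -
  define h where "h u = Phi (exp u * x)" for u
  have "(h has_real_derivative (exp u * x) * std_normal_density (exp u * x)) (at u)" for u
    unfolding h_def by (auto intro!: derivative_eq_intros)
  moreover have "\<bar>(exp u * x) * std_normal_density (exp u * x)\<bar> \<le> 1" for u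
    using std_normal_density_bounds(2)[of "exp u * x"] by (simp add: abs_mult)
  ultimately have "\<bar>h (ln k) - h 0\<bar> \<le> 1 * \<bar>ln k - 0\<bar>"
    using field_differentiable_bound[of UNIV h "\<lambda>u. (exp u * x) * std_normal_density (exp u * x)" 1 "ln k" 0]
    by (auto simp: real_norm_def)
  then show ?thesis using assms by (simp add: h_def)
qed

text \<open>Exchange of \<open>X\<close> for a centered Gaussian of variance \<open>s\<close>, in the presence of an independent Gaussian of
  variance \<open>t\<^sup>2\<close>. The defects of the mean and of the variance of \<open>X\<close> enter the bound linearly.
  All negative powers of \<open>t\<close> are weakened to the first one, which suffices since \<open>t \<ge> 1\<close>.\<close>

lemma lindeberg_step:
  fixes X :: "'a \<Rightarrow> real"
  assumes M: "prob_space M" and [measurable]: "X \<in> borel_measurable M" and t: "t \<ge> 1" and s: "s \<ge> 0"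
    and i3: "integrable M (\<lambda>w. \<bar>X w\<bar> ^ 3)" and i2: "integrable M (\<lambda>w. (X w)\<^sup>2)" and i1: "integrable M X"
  shows "\<bar>(\<integral>w. Phi ((y - X w) / t) \<partial>M) - Phi (y / sqrt (t\<^sup>2 + s))\<bar>
     \<le> (\<bar>\<integral>w. X w \<partial>M\<bar> + \<bar>(\<integral>w. (X w)\<^sup>2 \<partial>M) - s\<bar> + (\<integral>w. \<bar>X w\<bar> ^ 3 \<partial>M) + s\<^sup>2) / t"
proof -
  interpret prob_space M by fact
  define A where "A = Phi (y / t)"
  define B where "B = std_normal_density (y / t) / t"
  define C where "C = (y / t) * std_normal_density (y / t) / t\<^sup>2 / 2"
  have iP: "integrable M (\<lambda>w. Phi ((y - X w) / t))"
    using Phi_bounds by (intro integrable_const_bound[where B=1]) auto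
  have B: "\<bar>B\<bar> \<le> 1 / t"
    using t std_normal_density_bounds(1)[of "y / t"] by (auto simp: B_def intro: divide_right_mono)
  have C: "\<bar>C\<bar> \<le> 1 / t"
  proof -
    have "\<bar>C\<bar> = (\<bar>y / t\<bar> * std_normal_density (y / t)) / (2 * t\<^sup>2)" by (simp add: C_def abs_mult)
    also have "\<dots> \<le> 1 / (2 * t\<^sup>2)"
      using std_normal_density_bounds(2)[of "y / t"] t by (intro divide_right_mono) auto
    also have "\<dots> \<le> 1 / t" using t by (intro divide_left_mono) (auto simp: power2_eq_square)
    finally show ?thesis .
  qed
  have pw: "1 / t ^ 3 \<le> 1 / t" "1 / t ^ 4 \<le> 1 / t"
    using t power_increasing[of 1 3 t] power_increasing[of 1 4 t] by (auto intro!: divide_left_mono)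
  have T: "\<bar>Phi ((y - X w) / t) - A + B * X w + C * (X w)\<^sup>2\<bar> \<le> \<bar>X w\<bar> ^ 3 / t" for w
  proof -
    have "\<bar>Phi ((y - X w) / t) - A + B * X w + C * (X w)\<^sup>2\<bar> \<le> \<bar>X w\<bar> ^ 3 * (1 / t ^ 3)"
      using Phi_taylor[of t y "X w"] t by (simp add: A_def B_def C_def)
    also have "\<dots> \<le> \<bar>X w\<bar> ^ 3 * (1 / t)" by (intro mult_left_mono pw) auto
    finally show ?thesis by simp
  qed
  have "\<bar>\<integral>w. Phi ((y - X w) / t) - A + B * X w + C * (X w)\<^sup>2 \<partial>M\<bar> \<le> (\<integral>w. \<bar>Phi ((y - X w) / t) - A + B * X w + C * (X w)\<^sup>2\<bar> \<partial>M)"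
    by (rule integral_abs_bound)
  also have "\<dots> \<le> (\<integral>w. \<bar>X w\<bar> ^ 3 / t \<partial>M)"
    using iP i1 i2 i3 T by (intro integral_mono) auto
  finally have 1: "\<bar>(\<integral>w. Phi ((y - X w) / t) \<partial>M) - A + B * (\<integral>w. X w \<partial>M) + C * (\<integral>w. (X w)\<^sup>2 \<partial>M)\<bar> \<le> (\<integral>w. \<bar>X w\<bar> ^ 3 \<partial>M) / t"
    using iP i1 i2 i3 prob_space by simp
  have 2: "\<bar>Phi (y / sqrt (t\<^sup>2 + s)) - A + C * s\<bar> \<le> s\<^sup>2 / t"
  proof -
    have "\<bar>Phi (y / sqrt (t\<^sup>2 + s)) - A + C * s\<bar> \<le> s\<^sup>2 * (1 / t ^ 4)"
      using Phi_heat(2)[of t s y] t s by (simp add: A_def C_def)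
    also have "\<dots> \<le> s\<^sup>2 * (1 / t)" by (intro mult_left_mono pw) auto
    finally show ?thesis by simp
  qed
  have 3: "\<bar>B * (\<integral>w. X w \<partial>M)\<bar> \<le> \<bar>\<integral>w. X w \<partial>M\<bar> / t"
    using mult_right_mono[OF B, of "\<bar>\<integral>w. X w \<partial>M\<bar>"] by (simp add: abs_mult)
  have 4: "\<bar>C * ((\<integral>w. (X w)\<^sup>2 \<partial>M) - s)\<bar> \<le> \<bar>(\<integral>w. (X w)\<^sup>2 \<partial>M) - s\<bar> / t"
    using mult_right_mono[OF C, of "\<bar>(\<integral>w. (X w)\<^sup>2 \<partial>M) - s\<bar>"] by (simp add: abs_mult)
  have "(\<integral>w. Phi ((y - X w) / t) \<partial>M) - Phi (y / sqrt (t\<^sup>2 + s))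
     = ((\<integral>w. Phi ((y - X w) / t) \<partial>M) - A + B * (\<integral>w. X w \<partial>M) + C * (\<integral>w. (X w)\<^sup>2 \<partial>M))
       - (Phi (y / sqrt (t\<^sup>2 + s)) - A + C * s) - B * (\<integral>w. X w \<partial>M) - C * ((\<integral>w. (X w)\<^sup>2 \<partial>M) - s)"
    by (simp add: algebra_simps)
  then show ?thesis using 1 2 3 4 unfolding add_divide_distrib by linarith
qed

text \<open>The Lipschitz bound for \<open>Phi\<close> alone. It serves the finitely many summands for which the moments of higher
  order are not small.\<close>

lemma lindeberg_step_crude:
  fixes X :: "'a \<Rightarrow> real"
  assumes M: "prob_space M" and t: "t \<ge> 1" and s: "s \<ge> 0" and i1: "integrable M X"
  shows "\<bar>(\<integral>w. Phi ((y - X w) / t) \<partial>M) - Phi (y / sqrt (t\<^sup>2 + s))\<bar> \<le> ((\<integral>w. \<bar>X w\<bar> \<partial>M) + s) / t"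
proof -
  interpret prob_space M by fact
  have [measurable]: "X \<in> borel_measurable M" using i1 by auto
  have iP: "integrable M (\<lambda>w. Phi ((y - X w) / t))"
    using Phi_bounds by (intro integrable_const_bound[where B=1]) auto
  have "\<bar>(\<integral>w. Phi ((y - X w) / t) - Phi (y / t) \<partial>M)\<bar> \<le> (\<integral>w. \<bar>Phi ((y - X w) / t) - Phi (y / t)\<bar> \<partial>M)"
    by (rule integral_abs_bound)
  also have "\<dots> \<le> (\<integral>w. \<bar>X w\<bar> / t \<partial>M)"
  proof (rule integral_mono)
    fix w
    have "\<bar>Phi ((y - X w) / t) - Phi (y / t)\<bar> \<le> \<bar>(y - X w) / t - y / t\<bar>" by (rule Phi_lipschitz)
    also have "\<dots> = \<bar>X w\<bar> / t" using t by (simp add: diff_divide_distrib)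
    finally show "\<bar>Phi ((y - X w) / t) - Phi (y / t)\<bar> \<le> \<bar>X w\<bar> / t" .
  qed (use iP i1 in auto)
  finally have 1: "\<bar>(\<integral>w. Phi ((y - X w) / t) \<partial>M) - Phi (y / t)\<bar> \<le> (\<integral>w. \<bar>X w\<bar> \<partial>M) / t"
    using iP prob_space by simp
  have "\<bar>Phi (y / sqrt (t\<^sup>2 + s)) - Phi (y / t)\<bar> \<le> s / t\<^sup>2" using t s by (intro Phi_heat) auto
  also have "\<dots> \<le> s / t" using t s by (intro divide_left_mono) (auto simp: power2_eq_square)
  finally show ?thesis using 1 unfolding add_divide_distrib by linarith
qed

text \<open>Let \<open>Del\<close> be the supremum of \<open>\<bar>cdf M - G\<bar>\<close>. If the difference is \<open>d > 0\<close> at \<open>x\<close>, then by monotonicity of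
  the distribution function it is at least \<open>d - 4 * l\<close> on an interval of length \<open>4\<close> to the right of
  \<open>x\<close>. A standard normal variable puts mass at least \<open>3 / 4\<close> on the corresponding interval
  \<open>{-2..2}\<close> by Chebyshev's inequality, so the smoothed difference at \<open>x + 2\<close> is at least
  \<open>3 / 4 * (d - 4 * l) - Del / 4\<close>. Taking the supremum over \<open>d\<close>, the term \<open>Del / 4\<close> is absorbed. Negative
  differences are treated on the left of \<open>x\<close>.\<close>

lemma gaussian_smoothing:
  fixes M :: "real measure"
  assumes M: "real_distribution M" and G01: "\<And>x. 0 \<le> G x \<and> G x \<le> 1"
    and lip: "\<And>x y. \<bar>G x - G y\<bar> \<le> l * \<bar>x - y\<bar>" and l: "l \<ge> 0"
    and sm: "\<And>x. \<bar>(\<integral>y. Phi (x - y) \<partial>M) - G x\<bar> \<le> e"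
  shows "\<bar>cdf M x - G x\<bar> \<le> 2 * e + 8 * l"
proof -
  interpret M: real_distribution M by fact
  let ?N = std_normal_distribution
  interpret pair_prob_space M ?N ..
  have contG: "continuous_on UNIV G"
    unfolding continuous_on_iff
  proof (intro ballI allI impI)
    fix x e :: real assume "0 < e"
    then show "\<exists>d>0. \<forall>x'\<in>UNIV. dist x' x < d \<longrightarrow> dist (G x') (G x) < e"
    proof (intro exI[of _ "e / (l + 1)"] conjI ballI impI)
      fix x' assume d: "dist x' x < e / (l + 1)"
      have "dist (G x') (G x) \<le> l * dist x' x" using lip by (simp add: dist_real_def)
      also have "\<dots> \<le> (l + 1) * dist x' x" by (intro mult_right_mono) auto
      also have "\<dots> < e" using d l by (simp add: field_simps)
      finally show "dist (G x') (G x) < e" .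
    qed (use l in auto)
  qed
  then have [measurable]: "G \<in> borel_measurable borel" by (rule borel_measurable_continuous_onI)
  have [measurable]: "cdf M \<in> borel_measurable borel"
    by (rule borel_measurable_mono) (auto intro!: monoI M.cdf_nondecreasing)
  define D where "D x = cdf M x - G x" for x
  have [measurable]: "D \<in> borel_measurable borel" unfolding D_def by measurable
  have D1: "\<bar>D x\<bar> \<le> 1" for x
    using M.cdf_nonneg[of x] M.cdf_bounded_prob[of x] G01[of x] by (auto simp: D_def abs_le_iff)
  \<comment> \<open>Both sides are the probability that the sum of a variable with law \<open>M\<close> and an independent
     standard normal variable is at most \<open>x\<close>.\<close>
  have conv: "(\<integral>y. Phi (x - y) \<partial>M) = (\<integral>z. cdf M (x - z) \<partial>?N)" for x
  proof -
    have "(\<integral>y. Phi (x - y) \<partial>M) = (\<integral>y. (\<integral>z. indicat_real {..x} (y + z) \<partial>?N) \<partial>M)"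
    proof (rule Bochner_Integration.integral_cong[OF refl])
      fix y
      have "(\<integral>z. indicat_real {..x} (y + z) \<partial>?N) = (\<integral>z. indicat_real {..x - y} z \<partial>?N)"
        by (rule Bochner_Integration.integral_cong) (auto simp: indicator_def)
      then show "Phi (x - y) = (\<integral>z. indicat_real {..x} (y + z) \<partial>?N)"
        by (simp add: Phi_def cdf_def)
    qed
    also have "\<dots> = (\<integral>z. (\<integral>y. indicat_real {..x} (y + z) \<partial>M) \<partial>?N)"
    proof (rule Fubini_integral[symmetric])
      show "integrable (M \<Otimes>\<^sub>M ?N) (\<lambda>(y, z). indicat_real {..x} (y + z) :: real)"
        by (rule integrable_const_bound[where B=1]) (auto simp: indicator_def)
    qed
    also have "\<dots> = (\<integral>z. cdf M (x - z) \<partial>?N)"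
    proof (rule Bochner_Integration.integral_cong[OF refl])
      fix z
      have "(\<integral>y. indicat_real {..x} (y + z) \<partial>M) = (\<integral>y. indicat_real {..x - z} y \<partial>M)"
        by (rule Bochner_Integration.integral_cong) (auto simp: indicator_def)
      then show "(\<integral>y. indicat_real {..x} (y + z) \<partial>M) = cdf M (x - z)"
        by (simp add: cdf_def)
    qed
    finally show ?thesis .
  qed
  have iN: "integrable ?N f" if "f \<in> borel_measurable borel" "\<And>x. \<bar>f x\<bar> \<le> 1" for f :: "real \<Rightarrow> real"
    using that by (intro std_normal.integrable_const_bound[where B=1]) auto
  have EZ: "(\<integral>z. \<bar>z\<bar> \<partial>?N) \<le> 1" "integrable ?N (\<lambda>z. \<bar>z\<bar>)"
  proof -
    show i: "integrable ?N (\<lambda>z. \<bar>z\<bar>)"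
      using integrable_std_normal_distribution_moment[of 1] by simp
    have i2: "integrable ?N (\<lambda>z. (1 + z\<^sup>2) / 2)"
      using integrable_std_normal_distribution_moment[of 2] by simp
    have "(\<integral>z. \<bar>z\<bar> \<partial>?N) \<le> (\<integral>z. (1 + z\<^sup>2) / 2 \<partial>?N)"
    proof (rule integral_mono[OF i i2])
      fix z :: real
      show "\<bar>z\<bar> \<le> (1 + z\<^sup>2) / 2"
        using sum_squares_ge_zero[of "\<bar>z\<bar> - 1" 0] by (simp add: power2_eq_square algebra_simps)
    qed
    also have "\<dots> = 1"
      using std_normal_distribution_even_moments[of 1] std_normal.prob_space by simp
    finally show "(\<integral>z. \<bar>z\<bar> \<partial>?N) \<le> 1" .
  qed
  have eta: "\<bar>\<integral>z. D (x - z) \<partial>?N\<bar> \<le> e + l" for x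
  proof -
    have [simp]: "integrable ?N (\<lambda>z. cdf M (x - z))" "integrable ?N (\<lambda>z. G (x - z))"
      using M.cdf_nonneg M.cdf_bounded_prob G01 by (auto intro!: iN)
    have "\<bar>\<integral>z. G x - G (x - z) \<partial>?N\<bar> \<le> (\<integral>z. \<bar>G x - G (x - z)\<bar> \<partial>?N)" by (rule integral_abs_bound)
    also have "\<dots> \<le> (\<integral>z. l * \<bar>z\<bar> \<partial>?N)"
      using EZ lip[of x "x - z" for z] by (intro integral_mono) auto
    also have "\<dots> \<le> l * 1" using EZ l mult_left_mono[OF EZ(1) l] by simp
    finally have "\<bar>G x - (\<integral>z. G (x - z) \<partial>?N)\<bar> \<le> l" using std_normal.prob_space by simp
    moreover have "(\<integral>z. D (x - z) \<partial>?N) = (\<integral>y. Phi (x - y) \<partial>M) - (\<integral>z. G (x - z) \<partial>?N)"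
      unfolding conv D_def by simp
    ultimately show ?thesis using sm[of x] by linarith
  qed
  have P2: "measure ?N {-2..2} \<ge> 3 / 4"
  proof -
    have i2: "integrable ?N (\<lambda>z. 1 - z\<^sup>2 / 4)"
      using integrable_std_normal_distribution_moment[of 2] by simp
    have "(\<integral>z. 1 - z\<^sup>2 / 4 \<partial>?N) \<le> (\<integral>z. indicat_real {-2..2} z \<partial>?N)"
    proof (rule integral_mono[OF i2])
      show "integrable ?N (indicat_real {-2..2})" by (intro iN) (auto simp: indicator_def)
      fix z :: real
      have "z\<^sup>2 \<ge> 2\<^sup>2" if "z \<notin> {-2..2}"
        using that abs_le_square_iff[of 2 z] by auto
      then show "1 - z\<^sup>2 / 4 \<le> indicat_real {-2..2} z" by (auto simp: indicator_def)
    qed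
    moreover have "(\<integral>z. 1 - z\<^sup>2 / 4 \<partial>?N) = 3 / 4"
      using std_normal_distribution_even_moments[of 1] std_normal.prob_space by simp
    ultimately show ?thesis by simp
  qed
  define Del where "Del = (SUP x. \<bar>D x\<bar>)"
  have bdd: "bdd_above (range (\<lambda>x. \<bar>D x\<bar>))" using D1 by (intro bdd_aboveI[where M=1]) auto
  have Del: "\<bar>D x\<bar> \<le> Del" for x unfolding Del_def by (rule cSUP_upper[OF _ bdd]) auto
  have low: "c * (3 / 4) - Del \<le> (\<integral>z. h z \<partial>?N)"
    if [measurable]: "h \<in> borel_measurable borel" and h: "\<And>z. \<bar>h z\<bar> \<le> Del" "\<And>z. z \<in> {-2..2} \<Longrightarrow> h z \<ge> c - Del" "c \<ge> 0"
      "\<And>z. \<bar>h z\<bar> \<le> 1"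
    for h c
  proof -
    have "c * (3 / 4) - Del \<le> c * measure ?N {-2..2} - Del"
      using P2 \<open>c \<ge> 0\<close> by (intro diff_right_mono mult_left_mono) auto
    also have "\<dots> = (\<integral>z. c * indicator {-2..2} z - Del \<partial>?N)"
    proof -
      have "integrable ?N (indicat_real {-2..2})" by (rule iN) (auto simp: indicator_def)
      then have "(\<integral>z. c * indicat_real {-2..2} z - Del \<partial>?N) = c * (\<integral>z. indicat_real {-2..2} z \<partial>?N) - Del"
        using std_normal.prob_space by (subst Bochner_Integration.integral_diff) (auto simp del: Bochner_Integration.integral_indicator)
      then show ?thesis by simp
    qed
    also have "\<dots> \<le> (\<integral>z. h z \<partial>?N)"
    proof (rule integral_mono)
      show "integrable ?N (\<lambda>z. c * indicator {-2..2} z - Del)"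
        by (rule Bochner_Integration.integrable_diff[OF integrable_mult_right[OF iN[of "indicat_real {-2..2}"]] std_normal.integrable_const])
          (auto simp: indicator_def)
      show "integrable ?N h" by (rule iN) (use h in auto)
      fix z
      show "c * indicator {-2..2} z - Del \<le> h z"
        using h(2)[of z] h(1)[of z] by (auto simp: indicator_def abs_le_iff)
    qed
    finally show ?thesis .
  qed
  have key: "d \<le> 4 * l + 4 / 3 * (e + l) + Del / 3"
    if "(d - 4 * l + Del) * (3 / 4) - Del \<le> I" "\<bar>I\<bar> \<le> e + l" for d I :: real
  proof -
    have "I \<le> e + l" using that(2) by (simp add: abs_le_iff)
    then show ?thesis using that(1) by (simp add: field_simps)
  qed
  have one: "\<bar>D x\<bar> \<le> 4 * l + 4 / 3 * (e + l) + Del / 3" for x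
  proof -
    have el: "e + l \<ge> 0" using eta[of 0] by linarith
    show ?thesis
    proof (cases "\<bar>D x\<bar> - 4 * l + Del \<ge> 0")
      case False
      then have "\<bar>D x\<bar> < 4 * l - Del" by simp
      moreover have "0 \<le> Del" using Del[of x] abs_ge_zero[of "D x"] by (rule order_trans[rotated])
      moreover have "0 \<le> 4 / 3 * (e + l)" using el by simp
      ultimately show ?thesis by (simp add: field_simps)
    next
      case True
      show ?thesis
      proof (cases "D x \<ge> 0")
        case pos: True
        have "(\<bar>D x\<bar> - 4 * l + Del) * (3 / 4) - Del \<le> (\<integral>z. D ((x + 2) - z) \<partial>?N)"
        proof (rule low)
          fix z :: real assume z: "z \<in> {-2..2}"
          then have "cdf M x \<le> cdf M (x + 2 - z)" by (intro M.cdf_nondecreasing) auto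
          moreover have "\<bar>G (x + 2 - z) - G x\<bar> \<le> l * \<bar>(x + 2 - z) - x\<bar>" by (rule lip)
          moreover have "l * \<bar>(x + 2 - z) - x\<bar> \<le> l * 4" using z l by (intro mult_left_mono) auto
          ultimately show "\<bar>D x\<bar> - 4 * l + Del - Del \<le> D (x + 2 - z)"
            using pos by (simp add: D_def)
        qed (use True Del D1 in auto)
        then show ?thesis using eta[of "x + 2"] by (rule key)
      next
        case neg: False
        have "(\<bar>D x\<bar> - 4 * l + Del) * (3 / 4) - Del \<le> (\<integral>z. - D ((x - 2) - z) \<partial>?N)"
        proof (rule low)
          fix z :: real assume z: "z \<in> {-2..2}"
          then have "cdf M (x - 2 - z) \<le> cdf M x" by (intro M.cdf_nondecreasing) auto
          moreover have "\<bar>G (x - 2 - z) - G x\<bar> \<le> l * \<bar>(x - 2 - z) - x\<bar>" by (rule lip)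
          moreover have "l * \<bar>(x - 2 - z) - x\<bar> \<le> l * 4" using z l by (intro mult_left_mono) auto
          ultimately show "\<bar>D x\<bar> - 4 * l + Del - Del \<le> - D (x - 2 - z)"
            using neg by (simp add: D_def)
        qed (use True Del D1 in auto)
        then show ?thesis
          by (rule key) (use eta[of "x - 2"] in simp)
      qed
    qed
  qed
  have "Del \<le> 4 * l + 4 / 3 * (e + l) + Del / 3"
    unfolding Del_def by (rule cSUP_least) (use one Del_def in auto)
  then have "Del \<le> 2 * e + 8 * l" by (simp add: field_simps)
  then show ?thesis using Del[of x] by (simp add: D_def)
qed

section \<open>Logarithmic moments of beta variables\<close>

lemma sinh_diff_le_cube:
  fixes v :: real
  assumes "v \<ge> 0"
  shows "v \<le> sinh v" "sinh v - v \<le> sinh v ^ 3 / 6" "cosh v - 1 \<le> sinh v ^ 2 / 2"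
proof -
  have c: "cosh u - 1 \<le> sinh u ^ 2 / 2" for u :: real
  proof -
    have "cosh u ^ 2 = sinh u ^ 2 + 1" by (rule cosh_square_eq)
    moreover have "0 \<le> (cosh u - 1)\<^sup>2" by simp
    moreover have "(cosh u - 1)\<^sup>2 = cosh u ^ 2 - 2 * cosh u + 1" by (simp add: power2_eq_square algebra_simps)
    ultimately show ?thesis by simp
  qed
  show "cosh v - 1 \<le> sinh v ^ 2 / 2" by (rule c)
  have "sinh 0 - 0 \<le> sinh v - v"
  proof (rule DERIV_nonneg_imp_nondecreasing[OF assms])
    fix u :: real
    show "\<exists>y. ((\<lambda>v. sinh v - v) has_real_derivative y) (at u) \<and> 0 \<le> y"
      by (rule exI[of _ "cosh u - 1"]) (auto intro!: derivative_eq_intros simp: cosh_real_ge_1)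
  qed
  then show "v \<le> sinh v" by simp
  have "sinh 0 ^ 3 / 6 - sinh 0 + 0 \<le> sinh v ^ 3 / 6 - sinh v + v"
  proof (rule DERIV_nonneg_imp_nondecreasing[OF assms])
    fix u :: real
    have "((\<lambda>v. sinh v ^ 3 / 6 - sinh v + v) has_real_derivative (sinh u ^ 2 / 2 * cosh u - cosh u + 1)) (at u)"
      by (auto intro!: derivative_eq_intros simp: power2_eq_square)
    moreover have "sinh u ^ 2 / 2 * 1 \<le> sinh u ^ 2 / 2 * cosh u"
      by (intro mult_left_mono) (auto simp: cosh_real_ge_1)
    ultimately show "\<exists>y. ((\<lambda>v. sinh v ^ 3 / 6 - sinh v + v) has_real_derivative y) (at u) \<and> 0 \<le> y"
      using c[of u] by (intro exI[of _ "sinh u ^ 2 / 2 * cosh u - cosh u + 1"]) auto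
  qed
  then show "sinh v - v \<le> sinh v ^ 3 / 6" by simp
qed

text \<open>Moments of \<open>Y\<close> are hard to compute when \<open>Y\<close> is the logarithm of a beta variable, but moments of
  \<open>exp (k * Y)\<close> are rational functions of the parameters. With \<open>q = 4 * sinh (Y / 2)\<^sup>2\<close> all deviations
  are bounded by \<open>q\<close>, \<open>q\<^sup>2\<close> and the power \<open>3 / 2\<close> of \<open>q\<close>, and the latter is interpolated between the other
  two with a free parameter \<open>l\<close>, so that only integer powers of \<open>q\<close> have to be integrated.\<close>

lemma exp_moment_bounds:
  fixes Y l :: real
  assumes l: "l > 0"
  defines "q \<equiv> exp Y + exp (- Y) - 2"
  shows "Y\<^sup>2 \<le> q" "q - Y\<^sup>2 \<le> q\<^sup>2 / 12"
    "\<bar>Y\<bar> ^ 3 \<le> (l * q\<^sup>2 + q / l) / 2"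
    "\<bar>(exp Y - exp (- Y)) / 2 - Y\<bar> \<le> (l * q\<^sup>2 + q / l) / 12"
proof -
  define v where "v = \<bar>Y\<bar> / 2"
  define S where "S = sinh v"
  have v: "v \<ge> 0" by (simp add: v_def)
  note b = sinh_diff_le_cube[OF v, folded S_def]
  have S0: "S \<ge> 0" using v by (simp add: S_def)
  have aY: "\<bar>Y\<bar> = 2 * v" by (simp add: v_def)
  have q: "q = 4 * S\<^sup>2"
  proof -
    have "q = 2 * cosh \<bar>Y\<bar> - 2" by (simp add: q_def cosh_def scaleR_conv_of_real abs_if)
    also have "cosh \<bar>Y\<bar> = cosh (2 * v)" by (simp add: aY)
    also have "\<dots> = cosh v ^ 2 + sinh v ^ 2" by (rule cosh_double)
    also have "\<dots> = 2 * S\<^sup>2 + 1" by (simp add: cosh_square_eq S_def)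
    finally show ?thesis by simp
  qed
  have Y2: "Y\<^sup>2 = 4 * v\<^sup>2" using aY by (metis power2_abs power_mult_distrib four_x_squared)
  show "Y\<^sup>2 \<le> q" unfolding q Y2 using b(1) v by (simp add: power_mono)
  have "S\<^sup>2 - v\<^sup>2 = (S - v) * (S + v)" by (simp add: power2_eq_square algebra_simps)
  also have "\<dots> \<le> (S ^ 3 / 6) * (2 * S)" using b v S0 by (intro mult_mono) auto
  also have "\<dots> = S ^ 4 / 3" by (simp add: power3_eq_cube power4_eq_xxxx)
  finally have "4 * (S\<^sup>2 - v\<^sup>2) \<le> 4 * S ^ 4 / 3" by simp
  moreover have q2: "q\<^sup>2 = 16 * S ^ 4" by (simp add: q power_mult_distrib flip: power_mult)
  ultimately show "q - Y\<^sup>2 \<le> q\<^sup>2 / 12" by (simp add: q Y2)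
  \<comment> \<open>The arithmetic-geometric mean inequality for \<open>l * q\<^sup>2\<close> and \<open>q / l\<close>.\<close>
  have cube: "(2 * S) ^ 3 \<le> (l * q\<^sup>2 + q / l) / 2"
  proof -
    have "0 \<le> (2 * S)\<^sup>2 * (l * (2 * S) - 1)\<^sup>2 / l" using l by simp
    also have "\<dots> = l * q\<^sup>2 + q / l - 2 * (2 * S) ^ 3"
      using l unfolding q2 q by (simp add: field_simps power2_eq_square power3_eq_cube power4_eq_xxxx)
    finally show ?thesis by simp
  qed
  have "\<bar>Y\<bar> ^ 3 \<le> (2 * S) ^ 3" unfolding aY using b v by (intro power_mono) auto
  then show "\<bar>Y\<bar> ^ 3 \<le> (l * q\<^sup>2 + q / l) / 2" using cube by linarith
  have "sinh (2 * v) - 2 * v = 2 * S * (cosh v - 1) + 2 * (S - v)"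
    unfolding sinh_double S_def by (simp add: algebra_simps)
  also have "\<dots> \<le> 2 * S * (S\<^sup>2 / 2) + 2 * (S ^ 3 / 6)"
    using b S0 by (intro add_mono mult_left_mono) auto
  also have "\<dots> = (2 * S) ^ 3 / 6" by (simp add: power2_eq_square power3_eq_cube)
  finally have up: "sinh (2 * v) - 2 * v \<le> (2 * S) ^ 3 / 6" .
  have lo: "0 \<le> sinh (2 * v) - 2 * v" using sinh_diff_le_cube(1)[of "2 * v"] v by simp
  have "\<bar>sinh Y - Y\<bar> = \<bar>sinh (2 * v) - 2 * v\<bar>"
  proof (cases "Y \<ge> 0")
    case True then show ?thesis by (simp add: v_def)
  next
    case False
    then have "Y = - (2 * v)" by (simp add: v_def)
    then show ?thesis by (simp add: abs_minus_commute)
  qed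
  moreover have "(exp Y - exp (- Y)) / 2 = sinh Y" by (simp add: sinh_def scaleR_conv_of_real)
  ultimately show "\<bar>(exp Y - exp (- Y)) / 2 - Y\<bar> \<le> (l * q\<^sup>2 + q / l) / 12"
    using up lo cube by simp
qed

lemma beta_powr_moment:
  fixes a b s :: real
  assumes "a > 0" "b > 0" "a + s > 0"
  shows "integrable (beta_distribution a b) (\<lambda>x. x powr s)"
    "(\<integral>x. x powr s \<partial>beta_distribution a b) = Beta (a + s) b / Beta a b"
proof -
  have eq: "indicator {0<..<1} x * (x powr (a - 1) * (1 - x) powr (b - 1)) * x powr s
      = indicator {0<..<1} x * (x powr (a + s - 1) * (1 - x) powr (b - 1))" for x :: real
    by (auto simp: indicator_def powr_add[symmetric] algebra_simps)
  show "(\<integral>x. x powr s \<partial>beta_distribution a b) = Beta (a + s) b / Beta a b"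
    by (subst beta_distribution_integral[OF assms(1,2)])
      (simp_all add: eq beta_density_integral[OF assms(3,2)])
  have "integrable lborel (\<lambda>x. (indicator {0<..<1} x * (x powr (a - 1) * (1 - x) powr (b - 1) / Beta a b)) *\<^sub>R x powr s)"
  proof -
    have "integrable lborel (\<lambda>x. indicator {0<..<1} x * (x powr (a + s - 1) * (1 - x) powr (b - 1)) / Beta a b)"
      by (intro integrable_divide beta_density_integrable assms)
    then show ?thesis unfolding eq[symmetric] by (simp add: mult_ac)
  qed
  then show "integrable (beta_distribution a b) (\<lambda>x. x powr s)"
    unfolding beta_distribution_def using Beta_real_pos[OF assms(1,2)]
    by (subst integrable_density) auto
qed

lemma Beta_real_plus1:
  fixes a b :: real
  assumes "a > 0" "b > 0"
  shows "Beta (a + 1) b = a / (a + b) * Beta a b"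
proof -
  have "a \<notin> \<int>\<^sub>\<le>\<^sub>0" using assms by (auto elim!: nonpos_Ints_cases)
  then show ?thesis using Beta_plus1_left[of a b] assms by (simp add: field_simps)
qed

text \<open>The centering used for the logarithm of a beta variable: the logarithm of the mean, corrected by half of
  the approximate variance \<open>1 / a - 1 / (a + b)\<close>, as for a log-normal variable of mean \<open>a / (a + b)\<close>.\<close>

definition log_shift :: "real \<Rightarrow> real \<Rightarrow> real" where
  "log_shift a b = ln (a / (a + b)) - (1 / a - 1 / (a + b)) / 2"

text \<open>Let \<open>Y\<close> be the logarithm of the variable divided by its mean. With \<open>u = 1 / a\<close>, \<open>w = 1 / (a + b)\<close> and
  \<open>d = u - w\<close>, the moments of \<open>exp (k * Y)\<close> for \<open>k = 1, 2, -1, -2\<close> are rational in \<open>u\<close> and \<open>w\<close>; in the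
  combinations for \<open>q\<close> and \<open>q\<^sup>2\<close> the lower orders cancel, leaving \<open>d / (1 - u)\<close> and \<open>O(u\<^sup>2)\<close>. All bounds are
  uniform in \<open>b\<close>. The condition \<open>a \<ge> 4\<close> provides the inverse moments and keeps \<open>1 - 2 * u\<close>
  away from \<open>0\<close>.\<close>

lemma beta_log_moments:
  fixes a b :: real
  assumes a: "a \<ge> 4" and b: "b > 0"
  defines "s \<equiv> 1 / a - 1 / (a + b)" and "B \<equiv> beta_distribution a b"
    and "X \<equiv> \<lambda>x. ln x - log_shift a b"
  shows "integrable B X" "integrable B (\<lambda>x. (X x)\<^sup>2)" "integrable B (\<lambda>x. \<bar>X x\<bar> ^ 3)"
    "\<bar>\<integral>x. X x \<partial>B\<bar> + \<bar>(\<integral>x. (X x)\<^sup>2 \<partial>B) - s\<bar> + (\<integral>x. \<bar>X x\<bar> ^ 3 \<partial>B) + s\<^sup>2 \<le> 40 * a powr (- 3 / 2)"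
proof -
  have a0: "a > 0" using a by simp
  interpret prob_space B unfolding B_def by (rule prob_space_beta_distribution[OF a0 b])
  have [measurable_cong]: "sets B = sets borel" by (simp add: B_def)
  define p where "p = a / (a + b)"
  have p: "p > 0" using a0 b by (simp add: p_def)
  define u where "u = 1 / a"
  define w where "w = 1 / (a + b)"
  have uw: "0 < w" "w < u" "u \<le> 1 / 4" using a b by (auto simp: u_def w_def field_simps)
  define d where "d = u - w"
  have d: "0 < d" "d < u" "s = d" using uw by (auto simp: d_def s_def u_def w_def)
  define Y where "Y x = ln (x / p)" for x
  have [measurable]: "Y \<in> borel_measurable borel" unfolding Y_def by measurable
  have XY: "AE x in B. X x = Y x + d / 2"
    using AE_beta_distribution[of a b, folded B_def]
    by eventually_elim (use p in \<open>simp add: X_def Y_def log_shift_def ln_div p_def[symmetric] d(3)[symmetric] s_def\<close>)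
  have BB: "Beta a b > 0" by (rule Beta_real_pos[OF a0 b])
  \<comment> \<open>The moments of order \<open>1, 2, -1, -2\<close>, as quotients of beta functions.\<close>
  have m1: "Beta (a + 1) b = p * Beta a b"
    using Beta_real_plus1[OF a0 b] by (simp add: p_def)
  have m2: "Beta (a + 2) b = ((1 + u) / (1 + w)) * p\<^sup>2 * Beta a b"
  proof -
    have "Beta (a + 2) b = (a + 1) / (a + 1 + b) * Beta (a + 1) b"
      using Beta_real_plus1[of "a + 1" b] a0 b by (simp add: add.assoc)
    also have "(a + 1) / (a + 1 + b) = ((1 + u) / (1 + w)) * p"
    proof -
      have "1 + u = (a + 1) / a" "1 + w = (a + 1 + b) / (a + b)"
        using a0 b unfolding u_def w_def by (simp_all add: field_simps)
      then show ?thesis using a0 b by (simp add: p_def)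
    qed
    finally show ?thesis by (simp add: m1 power2_eq_square)
  qed
  have n1: "Beta (a - 1) b = ((1 - w) / (1 - u)) / p * Beta a b"
  proof -
    have "Beta a b = (a - 1) / (a - 1 + b) * Beta (a - 1) b"
      using Beta_real_plus1[of "a - 1" b] a b by simp
    moreover have "(a - 1) / (a - 1 + b) = (1 - u) / (1 - w) * p"
    proof -
      have "1 - u = (a - 1) / a" "1 - w = (a - 1 + b) / (a + b)"
        using a0 b unfolding u_def w_def by (simp_all add: field_simps)
      then show ?thesis using a b by (simp add: p_def)
    qed
    ultimately have e: "Beta a b = (1 - u) / (1 - w) * p * Beta (a - 1) b" by (simp only:)
    show ?thesis unfolding e using uw p by simp
  qed
  have n2: "Beta (a - 2) b = ((1 - w) / (1 - u)) * ((1 - 2 * w) / (1 - 2 * u)) / p\<^sup>2 * Beta a b"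
  proof -
    have "Beta (a - 1) b = (a - 2) / (a - 2 + b) * Beta (a - 2) b"
      using Beta_real_plus1[of "a - 2" b] a b by simp
    moreover have "(a - 2) / (a - 2 + b) = (1 - 2 * u) / (1 - 2 * w) * p"
    proof -
      have "1 - 2 * u = (a - 2) / a" "1 - 2 * w = (a - 2 + b) / (a + b)"
        using a0 b unfolding u_def w_def by (simp_all add: field_simps)
      then show ?thesis using a b by (simp add: p_def)
    qed
    ultimately have e: "Beta (a - 1) b = (1 - 2 * u) / (1 - 2 * w) * p * Beta (a - 2) b" by (simp only:)
    have "Beta (a - 2) b = (1 - 2 * w) / (1 - 2 * u) / p * Beta (a - 1) b"
      unfolding e using uw p by simp
    then show ?thesis by (simp add: n1 power2_eq_square mult_ac)
  qed
  define m where "m k = (if k = 1 then 1 else if k = 2 then (1 + u) / (1 + w) else if k = - 1 then (1 - w) / (1 - u)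
     else ((1 - w) / (1 - u)) * ((1 - 2 * w) / (1 - 2 * u)))" for k :: real
  have expY: "AE x in B. exp (k * Y x) = x powr k * p powr (- k)" for k
    using AE_beta_distribution[of a b, folded B_def]
    by eventually_elim (use p in \<open>simp add: Y_def powr_def ln_div exp_add[symmetric] algebra_simps\<close>)
  have E: "integrable B (\<lambda>x. exp (k * Y x)) \<and> (\<integral>x. exp (k * Y x) \<partial>B) = m k" if k: "k \<in> {1, 2, -1, -2}" for k
  proof -
    have ak: "a + k > 0" using k a by auto
    have "integrable B (\<lambda>x. x powr k * p powr (- k))"
      using beta_powr_moment(1)[OF a0 b ak] by (simp add: B_def)
    then have 1: "integrable B (\<lambda>x. exp (k * Y x))"
      using expY[of k] by (subst integrable_cong_AE) auto
    have "(\<integral>x. exp (k * Y x) \<partial>B) = (\<integral>x. x powr k * p powr (- k) \<partial>B)"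
      using expY[of k] by (intro integral_cong_AE) auto
    also have "\<dots> = Beta (a + k) b / Beta a b * p powr (- k)"
      using beta_powr_moment(2)[OF a0 b ak] by (simp add: B_def)
    also have "\<dots> = m k"
    proof -
      have p1: "p powr (- 1) = inverse p" "p powr (- 2) = inverse (p\<^sup>2)" "p powr 1 = p" "p powr 2 = p\<^sup>2"
        using p powr_numeral[of p "num.Bit0 num.One"] by (simp_all add: powr_minus)
      have "Beta (a + k) b = m k * p powr k * Beta a b"
        using k m1 m2 n1 n2 p1 by (auto simp: m_def divide_inverse mult_ac)
      then have "Beta (a + k) b / Beta a b * p powr (- k) = m k * (p powr k * p powr (- k))"
        using BB by simp
      also have "p powr k * p powr (- k) = 1" using p by (simp add: powr_add[symmetric])
      finally show ?thesis by simp
    qed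
    finally show ?thesis using 1 by simp
  qed
  have i: "integrable B (\<lambda>x. exp (Y x))" "integrable B (\<lambda>x. exp (- Y x))"
      "integrable B (\<lambda>x. exp (2 * Y x))" "integrable B (\<lambda>x. exp (- (2 * Y x)))"
    using E[of 1] E[of "-1"] E[of 2] E[of "-2"] by simp_all
  have ev: "(\<integral>x. exp (Y x) \<partial>B) = 1" "(\<integral>x. exp (- Y x) \<partial>B) = (1 - w) / (1 - u)"
      "(\<integral>x. exp (2 * Y x) \<partial>B) = (1 + u) / (1 + w)"
      "(\<integral>x. exp (- (2 * Y x)) \<partial>B) = ((1 - w) / (1 - u)) * ((1 - 2 * w) / (1 - 2 * u))"
    using E[of 1] E[of "-1"] E[of 2] E[of "-2"] by (simp_all add: m_def)
  define q where "q x = exp (Y x) + exp (- Y x) - 2" for x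
  have q2: "(q x)\<^sup>2 = exp (2 * Y x) + exp (- (2 * Y x)) + 6 - 4 * exp (Y x) - 4 * exp (- Y x)" for x
  proof -
    have e: "exp (2 * Y x) = exp (Y x) * exp (Y x)" "exp (- (2 * Y x)) = exp (- Y x) * exp (- Y x)" "exp (Y x) * exp (- Y x) = 1"
      by (simp_all add: exp_add[symmetric])
    have "(q x)\<^sup>2 = exp (Y x) * exp (Y x) + exp (- Y x) * exp (- Y x) + 4 + 2 * (exp (Y x) * exp (- Y x)) - 4 * exp (Y x) - 4 * exp (- Y x)"
      by (simp add: q_def power2_eq_square algebra_simps)
    then show ?thesis unfolding e by simp
  qed
  have iq: "integrable B q" and Eq: "(\<integral>x. q x \<partial>B) = d / (1 - u)"
  proof -
    show "integrable B q" unfolding q_def using i by simp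
    have "(\<integral>x. q x \<partial>B) = (\<integral>x. exp (Y x) \<partial>B) + (\<integral>x. exp (- Y x) \<partial>B) - 2"
      unfolding q_def using i prob_space by simp
    also have "\<dots> = 1 + (1 - w) / (1 - u) - 2" using ev by simp
    also have "\<dots> = d / (1 - u)" using uw by (simp add: d_def field_simps)
    finally show "(\<integral>x. q x \<partial>B) = d / (1 - u)" .
  qed
  have iq2: "integrable B (\<lambda>x. (q x)\<^sup>2)" and Eq2: "(\<integral>x. (q x)\<^sup>2 \<partial>B) \<le> 11 * u\<^sup>2"
  proof -
    show "integrable B (\<lambda>x. (q x)\<^sup>2)" unfolding q2 using i by simp
    have "(\<integral>x. (q x)\<^sup>2 \<partial>B) = (\<integral>x. exp (2 * Y x) \<partial>B) + (\<integral>x. exp (- (2 * Y x)) \<partial>B) + 6 - 4 * (\<integral>x. exp (Y x) \<partial>B) - 4 * (\<integral>x. exp (- Y x) \<partial>B)"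
      unfolding q2 using i prob_space by simp
    also have "\<dots> = (1 + u) / (1 + w) + ((1 - w) / (1 - u)) * ((1 - 2 * w) / (1 - 2 * u)) + 2 - 4 * ((1 - w) / (1 - u))"
      using ev by simp
    also have "\<dots> = d * (1 / (1 + w) - 3 / (1 - u) + 2 / (1 - 2 * u)) + 2 * d\<^sup>2 / ((1 - u) * (1 - 2 * u))"
    proof -
      have "(1 + u) / (1 + w) = 1 + d * (1 / (1 + w))" "(1 - w) / (1 - u) = 1 + d * (1 / (1 - u))"
        "(1 - 2 * w) / (1 - 2 * u) = 1 + d * (2 / (1 - 2 * u))"
        using uw by (simp_all add: d_def field_simps)
      note e = this
      define r1 r2 r3 where "r1 = 1 / (1 + w)" and "r2 = 1 / (1 - u)" and "r3 = 2 / (1 - 2 * u)"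
      have r: "3 / (1 - u) = 3 * r2" "2 * d\<^sup>2 / ((1 - u) * (1 - 2 * u)) = d\<^sup>2 * (r2 * r3)"
        by (simp_all add: r2_def r3_def)
      show ?thesis unfolding e r r1_def[symmetric] r2_def[symmetric] r3_def[symmetric]
        by (simp add: algebra_simps power2_eq_square)
    qed
    also have "\<dots> \<le> u * (5 * u) + 6 * u\<^sup>2"
    proof (rule add_mono)
      have "1 / (1 + w) \<le> 1" using uw by simp
      moreover have "3 / (1 - u) \<ge> 3 + 3 * u" using uw by (simp add: field_simps)
      moreover have "2 / (1 - 2 * u) \<le> 2 + 8 * u"
      proof -
        have "0 \<le> u * (1 - 4 * u)" using uw by (intro mult_nonneg_nonneg) auto
        then have "2 \<le> (2 + 8 * u) * (1 - 2 * u)" by (simp add: algebra_simps)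
        then show ?thesis using uw by (simp add: pos_divide_le_eq)
      qed
      ultimately have "1 / (1 + w) - 3 / (1 - u) + 2 / (1 - 2 * u) \<le> 5 * u" by linarith
      then have "d * (1 / (1 + w) - 3 / (1 - u) + 2 / (1 - 2 * u)) \<le> d * (5 * u)" using d by (intro mult_left_mono) auto
      also have "\<dots> \<le> u * (5 * u)" using d uw by (intro mult_right_mono) auto
      finally show "d * (1 / (1 + w) - 3 / (1 - u) + 2 / (1 - 2 * u)) \<le> u * (5 * u)" .
      have "1 / 3 \<le> (1 - u) * (1 - 2 * u)"
      proof -
        have "(3 / 4) * (1 / 2) \<le> (1 - u) * (1 - 2 * u)" using uw by (intro mult_mono) auto
        then show ?thesis by simp
      qed
      then have "2 * d\<^sup>2 / ((1 - u) * (1 - 2 * u)) \<le> 2 * d\<^sup>2 / (1 / 3)"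
        by (intro divide_left_mono) auto
      also have "\<dots> \<le> 6 * u\<^sup>2" using d power_mono[of d u 2] by simp
      finally show "2 * d\<^sup>2 / ((1 - u) * (1 - 2 * u)) \<le> 6 * u\<^sup>2" .
    qed
    also have "\<dots> = 11 * u\<^sup>2" by (simp add: power2_eq_square)
    finally show "(\<integral>x. (q x)\<^sup>2 \<partial>B) \<le> 11 * u\<^sup>2" .
  qed
  define h where "h = a powr (- 3 / 2)"
  \<comment> \<open>The typical size of \<open>q\<close> is \<open>1 / a\<close>, so \<open>l = sqrt a\<close> balances \<open>l * q\<^sup>2\<close> and \<open>q / l\<close>.\<close>
  define l where "l = sqrt a"
  have l: "l > 0" using a0 by (simp add: l_def)
  have h0: "h > 0" using a0 by (simp add: h_def)
  have hu: "l * u\<^sup>2 = h" "u / l = h"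
  proof -
    have "u / l = a powr (- 1) * a powr (- (1 / 2))"
      using a0 by (simp add: u_def l_def powr_minus powr_half_sqrt field_simps)
    also have "\<dots> = h" by (simp only: powr_add[symmetric] h_def) simp
    finally show "u / l = h" .
    moreover have "l * u\<^sup>2 = u / l"
      using a0 by (simp add: u_def l_def power2_eq_square field_simps)
    ultimately show "l * u\<^sup>2 = h" by simp
  qed
  have u2h: "u\<^sup>2 \<le> h"
  proof -
    have "1 \<le> l" using a by (simp add: l_def)
    then have "1 * u\<^sup>2 \<le> l * u\<^sup>2" by (intro mult_right_mono) auto
    then show ?thesis using hu by simp
  qed
  define c where "c x = l * (q x)\<^sup>2 + q x / l" for x
  have ic: "integrable B c" unfolding c_def using iq iq2 by simp
  have Eqd: "d / (1 - u) \<le> (4 / 3) * d"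
    using uw d by (simp add: field_simps)
  have Ec: "(\<integral>x. c x \<partial>B) \<le> 13 * h"
  proof -
    have "(\<integral>x. c x \<partial>B) = l * (\<integral>x. (q x)\<^sup>2 \<partial>B) + (\<integral>x. q x \<partial>B) / l"
      unfolding c_def using iq iq2 by simp
    also have "\<dots> \<le> l * (11 * u\<^sup>2) + ((4 / 3) * u) / l"
    proof (intro add_mono mult_left_mono divide_right_mono Eq2)
      show "(\<integral>x. q x \<partial>B) \<le> 4 / 3 * u" unfolding Eq using Eqd d by linarith
    qed (use l in auto)
    also have "\<dots> = 11 * (l * u\<^sup>2) + 4 / 3 * (u / l)" by simp
    also have "\<dots> \<le> 13 * h" unfolding hu using h0 by simp
    finally show ?thesis .
  qed
  note pb = exp_moment_bounds[OF l, of "Y x" for x, folded q_def, folded c_def]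
  have iY3: "integrable B (\<lambda>x. \<bar>Y x\<bar> ^ 3)"
  proof (rule Bochner_Integration.integrable_bound[OF ic])
    show "AE x in B. norm (\<bar>Y x\<bar> ^ 3) \<le> norm (c x)"
    proof (rule AE_I2)
      fix x
      have "0 \<le> \<bar>Y x\<bar> ^ 3" by simp
      then show "norm (\<bar>Y x\<bar> ^ 3) \<le> norm (c x)"
        using pb(3)[of x] unfolding real_norm_def by linarith
    qed
  qed measurable
  have iY2: "integrable B (\<lambda>x. (Y x)\<^sup>2)"
  proof (rule Bochner_Integration.integrable_bound[OF iq])
    show "AE x in B. norm ((Y x)\<^sup>2) \<le> norm (q x)"
    proof (rule AE_I2)
      fix x
      have "0 \<le> (Y x)\<^sup>2" by simp
      then show "norm ((Y x)\<^sup>2) \<le> norm (q x)"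
        using pb(1)[of x] unfolding real_norm_def by linarith
    qed
  qed measurable
  have iY: "integrable B Y"
    by (rule square_integrable_imp_integrable[OF _ iY2]) measurable
  have EY3: "(\<integral>x. \<bar>Y x\<bar> ^ 3 \<partial>B) \<le> 7 * h"
  proof -
    have "(\<integral>x. \<bar>Y x\<bar> ^ 3 \<partial>B) \<le> (\<integral>x. c x / 2 \<partial>B)"
      using iY3 ic pb(3) by (intro integral_mono) auto
    also have "\<dots> \<le> 7 * h" using Ec h0 by simp
    finally show ?thesis .
  qed
  have EY2: "\<bar>(\<integral>x. (Y x)\<^sup>2 \<partial>B) - d\<bar> \<le> 3 * h"
  proof -
    have "\<bar>\<integral>x. q x - (Y x)\<^sup>2 \<partial>B\<bar> \<le> (\<integral>x. \<bar>q x - (Y x)\<^sup>2\<bar> \<partial>B)" by (rule integral_abs_bound)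
    also have "\<dots> \<le> (\<integral>x. (q x)\<^sup>2 / 12 \<partial>B)"
      using iY2 iq iq2 pb(1,2) by (intro integral_mono) auto
    also have "\<dots> \<le> h" using Eq2 u2h h0 by simp
    finally have 1: "\<bar>d / (1 - u) - (\<integral>x. (Y x)\<^sup>2 \<partial>B)\<bar> \<le> h" using iY2 iq Eq by simp
    have "d / (1 - u) - d = (d / (1 - u)) * u" using uw by (simp add: field_simps)
    also have "\<dots> \<le> (4 / 3 * u) * u" using Eqd d uw by (intro mult_right_mono) auto
    also have "\<dots> = 4 / 3 * u\<^sup>2" by (simp add: power2_eq_square)
    finally have 2: "d / (1 - u) - d \<le> 2 * h" using u2h h0 by linarith
    have 3: "0 \<le> d / (1 - u) - d" using uw d by (simp add: field_simps)
    show ?thesis using 1 2 3 by linarith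
  qed
  have EY: "\<bar>(\<integral>x. Y x \<partial>B) + d / 2\<bar> \<le> 2 * h"
  proof -
    have "\<bar>\<integral>x. (exp (Y x) - exp (- Y x)) / 2 - Y x \<partial>B\<bar> \<le> (\<integral>x. \<bar>(exp (Y x) - exp (- Y x)) / 2 - Y x\<bar> \<partial>B)"
      by (rule integral_abs_bound)
    also have "\<dots> \<le> (\<integral>x. c x / 12 \<partial>B)"
      using iY i ic pb(4) by (intro integral_mono) auto
    also have "\<dots> \<le> 13 * h / 12" using Ec by simp
    finally have 1: "\<bar>(1 - (1 - w) / (1 - u)) / 2 - (\<integral>x. Y x \<partial>B)\<bar> \<le> 13 * h / 12"
      using iY i ev by simp
    have "(1 - (1 - w) / (1 - u)) / 2 = - (d / (1 - u)) / 2" using uw by (simp add: d_def field_simps)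
    with 1 have "\<bar>- (d / (1 - u)) / 2 - (\<integral>x. Y x \<partial>B)\<bar> \<le> 13 * h / 12" by (simp only:)
    moreover have "- (d / (1 - u)) / 2 - (\<integral>x. Y x \<partial>B) = - (d / (1 - u) / 2 + (\<integral>x. Y x \<partial>B))" by simp
    ultimately have 1: "\<bar>d / (1 - u) / 2 + (\<integral>x. Y x \<partial>B)\<bar> \<le> 13 * h / 12" by (simp only: abs_minus_cancel)
    have "d / (1 - u) - d = (d / (1 - u)) * u" using uw by (simp add: field_simps)
    also have "\<dots> \<le> (4 / 3 * u) * u" using Eqd d uw by (intro mult_right_mono) auto
    also have "\<dots> = 4 / 3 * u\<^sup>2" by (simp add: power2_eq_square)
    finally have 2: "d / (1 - u) - d \<le> 4 / 3 * h" using u2h by linarith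
    have 3: "0 \<le> d / (1 - u) - d" using uw d by (simp add: field_simps)
    have "\<bar>e + d / 2\<bar> \<le> 2 * h" if "\<bar>r / 2 + e\<bar> \<le> 13 * h / 12" "r - d \<le> 4 / 3 * h" "0 \<le> r - d" for r e
      using that h0 by linarith
    from this[OF 1 2 3] show ?thesis .
  qed
  define Z where "Z x = Y x + d / 2" for x
  have iZ: "integrable B Z" "integrable B (\<lambda>x. (Z x)\<^sup>2)"
    unfolding Z_def power2_sum using iY iY2 by auto
  have Z3: "\<bar>Z x\<bar> ^ 3 \<le> 4 * \<bar>Y x\<bar> ^ 3 + d ^ 3 / 2" for x
  proof -
    have conv: "(r + t) ^ 3 \<le> 4 * r ^ 3 + 4 * t ^ 3" if "0 \<le> r" "0 \<le> t" for r t :: real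
    proof -
      have "0 \<le> 3 * (r + t) * (r - t)\<^sup>2" using that by simp
      then show ?thesis by (simp add: power2_eq_square power3_eq_cube algebra_simps)
    qed
    have "\<bar>Z x\<bar> ^ 3 \<le> (\<bar>Y x\<bar> + d / 2) ^ 3"
      unfolding Z_def using d by (intro power_mono order_trans[OF abs_triangle_ineq]) auto
    also have "\<dots> \<le> 4 * \<bar>Y x\<bar> ^ 3 + 4 * (d / 2) ^ 3" using d by (intro conv) auto
    finally show ?thesis by (simp add: power_divide)
  qed
  have iZ3: "integrable B (\<lambda>x. \<bar>Z x\<bar> ^ 3)"
  proof (rule Bochner_Integration.integrable_bound)
    show "integrable B (\<lambda>x. 4 * \<bar>Y x\<bar> ^ 3 + d ^ 3 / 2)" using iY3 by simp
    show "(\<lambda>x. \<bar>Z x\<bar> ^ 3) \<in> borel_measurable B" unfolding Z_def by measurable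
    show "AE x in B. norm (\<bar>Z x\<bar> ^ 3) \<le> norm (4 * \<bar>Y x\<bar> ^ 3 + d ^ 3 / 2)"
      using Z3 d by (intro AE_I2) (auto simp: abs_of_nonneg)
  qed
  have EZ3: "(\<integral>x. \<bar>Z x\<bar> ^ 3 \<partial>B) \<le> 29 * h"
  proof -
    have "(\<integral>x. \<bar>Z x\<bar> ^ 3 \<partial>B) \<le> (\<integral>x. 4 * \<bar>Y x\<bar> ^ 3 + d ^ 3 / 2 \<partial>B)"
      using iZ3 iY3 Z3 by (intro integral_mono) auto
    also have "\<dots> = 4 * (\<integral>x. \<bar>Y x\<bar> ^ 3 \<partial>B) + d ^ 3 / 2" using iY3 prob_space by simp
    also have "d ^ 3 \<le> u ^ 3" using d by (intro power_mono) auto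
    also have "u ^ 3 \<le> u\<^sup>2" using uw by (intro power_decreasing) auto
    finally show ?thesis using EY3 u2h h0 by simp
  qed
  have EZ: "\<bar>\<integral>x. Z x \<partial>B\<bar> \<le> 2 * h" unfolding Z_def using iY prob_space EY by simp
  have d2: "d\<^sup>2 \<le> h"
  proof -
    have "d\<^sup>2 \<le> u\<^sup>2" using d by (intro power_mono) auto
    then show ?thesis using u2h by linarith
  qed
  have EZ2: "\<bar>(\<integral>x. (Z x)\<^sup>2 \<partial>B) - d\<bar> \<le> 5 * h"
  proof -
    have "(\<integral>x. (Z x)\<^sup>2 \<partial>B) = (\<integral>x. (Y x)\<^sup>2 + d * Y x + d\<^sup>2 / 4 \<partial>B)"
      unfolding Z_def by (intro Bochner_Integration.integral_cong) (auto simp: power2_eq_square algebra_simps)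
    also have "\<dots> = (\<integral>x. (Y x)\<^sup>2 \<partial>B) + d * ((\<integral>x. Y x \<partial>B) + d / 2) - d\<^sup>2 / 4"
      using iY iY2 prob_space by (simp add: power2_eq_square algebra_simps)
    finally have eq: "(\<integral>x. (Z x)\<^sup>2 \<partial>B) - d = ((\<integral>x. (Y x)\<^sup>2 \<partial>B) - d) + d * ((\<integral>x. Y x \<partial>B) + d / 2) - d\<^sup>2 / 4" by simp
    have "\<bar>d * ((\<integral>x. Y x \<partial>B) + d / 2)\<bar> \<le> (1 / 4) * (2 * h)"
      unfolding abs_mult using d uw EY by (intro mult_mono) auto
    moreover have "0 \<le> d\<^sup>2" by simp
    ultimately show ?thesis unfolding eq using EY2 d2 h0 by linarith
  qed
  have XZ: "AE x in B. X x = Z x" using XY by (simp add: Z_def)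
  have [measurable]: "X \<in> borel_measurable B" "Z \<in> borel_measurable B" unfolding X_def Z_def by measurable
  show "integrable B X" using XZ iZ(1) by (subst integrable_cong_AE[of _ _ Z]) auto
  have XZ2: "AE x in B. (X x)\<^sup>2 = (Z x)\<^sup>2" and XZ3: "AE x in B. \<bar>X x\<bar> ^ 3 = \<bar>Z x\<bar> ^ 3"
    using XZ by (eventually_elim, simp)+
  show "integrable B (\<lambda>x. (X x)\<^sup>2)" using XZ2 iZ(2) by (subst integrable_cong_AE[of _ _ "\<lambda>x. (Z x)\<^sup>2"]) auto
  show "integrable B (\<lambda>x. \<bar>X x\<bar> ^ 3)" using XZ3 iZ3 by (subst integrable_cong_AE[of _ _ "\<lambda>x. \<bar>Z x\<bar> ^ 3"]) auto
  have "(\<integral>x. X x \<partial>B) = (\<integral>x. Z x \<partial>B)" "(\<integral>x. (X x)\<^sup>2 \<partial>B) = (\<integral>x. (Z x)\<^sup>2 \<partial>B)" "(\<integral>x. \<bar>X x\<bar> ^ 3 \<partial>B) = (\<integral>x. \<bar>Z x\<bar> ^ 3 \<partial>B)"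
    using XZ XZ2 XZ3 by (auto intro!: integral_cong_AE)
  then show "\<bar>\<integral>x. X x \<partial>B\<bar> + \<bar>(\<integral>x. (X x)\<^sup>2 \<partial>B) - s\<bar> + (\<integral>x. \<bar>X x\<bar> ^ 3 \<partial>B) + s\<^sup>2 \<le> 40 * a powr (- 3 / 2)"
    using EZ EZ2 EZ3 d2 h0 unfolding d(3) h_def by linarith
qed

text \<open>Logarithmic convexity of the Gamma function between \<open>c - s\<close> and \<open>c - s + 1\<close>.\<close>

lemma Gamma_ratio_le_powr:
  fixes c s :: real
  assumes s: "0 < s" "s \<le> 1" and c: "s < c"
  shows "Gamma c \<le> Gamma (c - s) * c powr s"
proof -
  let ?x = "c - s"
  have x: "?x > 0" using c by simp
  have "(ln \<circ> Gamma) ((1 - s) *\<^sub>R ?x + s *\<^sub>R (?x + 1)) \<le> (1 - s) * (ln \<circ> Gamma) ?x + s * (ln \<circ> Gamma) (?x + 1)"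
    using x s by (intro convex_onD[OF log_convex_Gamma_real]) auto
  moreover have "(1 - s) *\<^sub>R ?x + s *\<^sub>R (?x + 1) = c" by (simp add: algebra_simps)
  moreover have "Gamma (?x + 1) = ?x * Gamma ?x"
    using x by (intro Gamma_plus1) (auto elim!: nonpos_Ints_cases)
  ultimately have "ln (Gamma c) \<le> (1 - s) * ln (Gamma ?x) + s * (ln ?x + ln (Gamma ?x))"
    using x Gamma_real_pos[OF x] by (simp add: ln_mult)
  also have "\<dots> = ln (Gamma ?x) + s * ln ?x" by (simp add: algebra_simps)
  also have "\<dots> \<le> ln (Gamma ?x) + s * ln c" using s x by (intro add_left_mono mult_left_mono) auto
  also have "\<dots> = ln (Gamma ?x * c powr s)"
    using s c less_imp_neq[OF Gamma_real_pos[OF x], symmetric] by (simp add: ln_mult ln_powr)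
  finally show ?thesis
    using x s c Gamma_real_pos[of c] Gamma_real_pos[OF x] by (subst (asm) ln_le_cancel_iff) auto
qed

text \<open>For small \<open>a\<close> only \<open>E \<bar>Y\<bar> \<le> E (exp Y) + E (exp (- s * Y)) / s\<close> is used, with \<open>s < a\<close> so that the last
  expectation is finite. By \<open>Gamma_ratio_le_powr\<close> it is bounded independently of \<open>b\<close>, which
  matters because \<open>b\<close> grows with \<open>n\<close> in the ensembles.\<close>

lemma beta_log_abs_moment:
  fixes a :: real
  assumes a: "a > 0"
  shows "\<exists>C\<ge>0. \<forall>b>0. integrable (beta_distribution a b) (\<lambda>x. ln x - log_shift a b) \<and>
    (\<integral>x. \<bar>ln x - log_shift a b\<bar> \<partial>beta_distribution a b) + (1 / a - 1 / (a + b)) \<le> C"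
proof -
  define s where "s = min (a / 2) 1"
  have s: "0 < s" "s \<le> 1" "s < a" using a by (auto simp: s_def)
  define C where "C = 1 + (1 / s) * (a powr s * Gamma (a - s) / Gamma a) + 2 / a"
  have "integrable (beta_distribution a b) (\<lambda>x. ln x - log_shift a b) \<and>
    (\<integral>x. \<bar>ln x - log_shift a b\<bar> \<partial>beta_distribution a b) + (1 / a - 1 / (a + b)) \<le> C" if b: "b > 0" for b
  proof -
    let ?B = "beta_distribution a b"
    interpret prob_space ?B by (rule prob_space_beta_distribution[OF a b])
    define p where "p = a / (a + b)"
    have p: "p > 0" using a b by (simp add: p_def)
    define d where "d = 1 / a - 1 / (a + b)"
    have d: "0 \<le> d" "d \<le> 1 / a" using a b by (auto simp: d_def frac_le)
    have BB: "Beta a b > 0" by (rule Beta_real_pos[OF a b])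
    define h where "h x = x powr 1 * (1 / p) + (1 / s) * (p powr s * x powr (- s)) + d / 2" for x
    have i1: "integrable ?B (\<lambda>x. x powr 1)" "(\<integral>x. x powr 1 \<partial>?B) = p"
      using beta_powr_moment[OF a b, of 1] a Beta_real_plus1[OF a b] BB by (auto simp: p_def)
    have i2: "integrable ?B (\<lambda>x. x powr (- s))" "(\<integral>x. x powr (- s) \<partial>?B) = Beta (a - s) b / Beta a b"
      using beta_powr_moment[OF a b, of "- s"] s by auto
    have ih: "integrable ?B h" unfolding h_def using i1 i2 by simp
    have Eh: "(\<integral>x. h x \<partial>?B) = 1 + (1 / s) * (p powr s * (Beta (a - s) b / Beta a b)) + d / 2"
      unfolding h_def using i1 i2 p prob_space by simp
    have G: "p powr s * (Beta (a - s) b / Beta a b) \<le> a powr s * Gamma (a - s) / Gamma a"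
    proof -
      have pos: "Gamma (a + b) > 0" "Gamma (a + b - s) > 0" "Gamma a > 0" "Gamma b > 0" "Gamma (a - s) > 0"
        using a b s by (auto intro!: Gamma_real_pos)
      have "p powr s * (Beta (a - s) b / Beta a b)
         = (a powr s * Gamma (a - s) / Gamma a) * (Gamma (a + b) / (Gamma (a + b - s) * (a + b) powr s))"
        using a b s pos[THEN less_imp_neq, symmetric] by (simp add: p_def powr_divide Beta_def field_simps)
      also have "\<dots> \<le> (a powr s * Gamma (a - s) / Gamma a) * 1"
      proof (rule mult_left_mono)
        have "Gamma (a + b) \<le> Gamma (a + b - s) * (a + b) powr s"
          using a b s by (intro Gamma_ratio_le_powr) auto
        then show "Gamma (a + b) / (Gamma (a + b - s) * (a + b) powr s) \<le> 1"
          using pos a b by (simp add: divide_le_eq)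
      qed (use pos in auto)
      finally show ?thesis by simp
    qed
    have bound: "AE x in ?B. \<bar>ln x - log_shift a b\<bar> \<le> h x"
      using AE_beta_distribution[of a b]
    proof eventually_elim
      case (elim x)
      define Y where "Y = ln (x / p)"
      have X: "ln x - log_shift a b = Y + d / 2"
        using elim p by (simp add: Y_def log_shift_def ln_div p_def[symmetric] d_def)
      have eY: "exp Y = x powr 1 * (1 / p)" using elim p by (simp add: Y_def)
      have esY: "exp (- (s * Y)) = p powr s * x powr (- s)"
        using elim p by (simp add: Y_def powr_def ln_div exp_add[symmetric] algebra_simps)
      have "\<bar>Y\<bar> \<le> exp Y + (1 / s) * exp (- (s * Y))"
      proof (cases "Y \<ge> 0")
        case True
        have "Y \<le> exp Y" using exp_ge_add_one_self[of Y] by linarith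
        moreover have "0 \<le> (1 / s) * exp (- (s * Y))" using s by simp
        ultimately show ?thesis using True by linarith
      next
        case False
        have "- (s * Y) \<le> exp (- (s * Y))" using exp_ge_add_one_self[of "- (s * Y)"] by linarith
        then have "(1 / s) * (- (s * Y)) \<le> (1 / s) * exp (- (s * Y))" using s by (intro mult_left_mono) auto
        then have "- Y \<le> (1 / s) * exp (- (s * Y))" using s by simp
        moreover have "0 \<le> exp Y" by simp
        ultimately show ?thesis using False by linarith
      qed
      then show ?case unfolding X h_def eY[symmetric] esY[symmetric] using d by linarith
    qed
    have int: "integrable ?B (\<lambda>x. ln x - log_shift a b)"
    proof (rule Bochner_Integration.integrable_bound[OF ih])
      show "AE x in ?B. norm (ln x - log_shift a b) \<le> norm (h x)"
        using bound by eventually_elim auto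
    qed measurable
    have "(\<integral>x. \<bar>ln x - log_shift a b\<bar> \<partial>?B) \<le> (\<integral>x. h x \<partial>?B)"
      using int ih bound by (intro integral_mono_AE) auto
    also have "\<dots> \<le> 1 + (1 / s) * (a powr s * Gamma (a - s) / Gamma a) + d / 2"
      unfolding Eh using G s by (intro add_mono mult_left_mono) auto
    finally have "(\<integral>x. \<bar>ln x - log_shift a b\<bar> \<partial>?B) + d \<le> C"
      unfolding C_def using d by (simp add: field_simps)
    then show ?thesis using int by (simp add: d_def)
  qed
  moreover have "C \<ge> 0"
    using a s Gamma_real_pos[of a] Gamma_real_pos[of "a - s"] by (simp add: C_def)
  ultimately show ?thesis by blast
qed

text \<open>The error made by exchanging the \<open>k\<close>-th centered logarithm for a Gaussian of variance
  \<open>1 / (g * k) - 1 / (g * k + b)\<close>, at the point \<open>y\<close> and at width \<open>t\<close>.\<close>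

definition swap_error :: "real \<Rightarrow> nat \<Rightarrow> real \<Rightarrow> real \<Rightarrow> real \<Rightarrow> real" where
  "swap_error g k b y t =
     \<bar>(\<integral>x. Phi ((y - (ln x - log_shift (g * real k) b)) / t) \<partial>beta_distribution (g * real k) b)
      - Phi (y / sqrt (t\<^sup>2 + (1 / (g * real k) - 1 / (g * real k + b))))\<bar>"

text \<open>For \<open>g * k \<ge> 4\<close> this is the Lindeberg step with the moments above; the remaining \<open>k\<close> are finitely many and
  are absorbed into \<open>K\<close> by the crude step.\<close>

lemma beta_step:
  fixes g :: real
  assumes g: "g > 0"
  shows "\<exists>K\<ge>0. \<forall>k\<ge>1. \<forall>b>0. \<forall>y. \<forall>t\<ge>1.
    swap_error g k b y t \<le> K * real k powr (- 3 / 2) / t"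
proof -
  have "\<forall>k. \<exists>C\<ge>0. k \<ge> 1 \<longrightarrow> (\<forall>b>0. integrable (beta_distribution (g * real k) b) (\<lambda>x. ln x - log_shift (g * real k) b) \<and>
    (\<integral>x. \<bar>ln x - log_shift (g * real k) b\<bar> \<partial>beta_distribution (g * real k) b) + (1 / (g * real k) - 1 / (g * real k + b)) \<le> C)"
  proof
    fix k :: nat
    show "\<exists>C\<ge>0. k \<ge> 1 \<longrightarrow> (\<forall>b>0. integrable (beta_distribution (g * real k) b) (\<lambda>x. ln x - log_shift (g * real k) b) \<and>
    (\<integral>x. \<bar>ln x - log_shift (g * real k) b\<bar> \<partial>beta_distribution (g * real k) b) + (1 / (g * real k) - 1 / (g * real k + b)) \<le> C)"
      using beta_log_abs_moment[of "g * real k"] g by (cases "k \<ge> 1") auto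
  qed
  then obtain C where C: "\<And>k. C k \<ge> 0"
    "\<And>k b. k \<ge> 1 \<Longrightarrow> b > 0 \<Longrightarrow> integrable (beta_distribution (g * real k) b) (\<lambda>x. ln x - log_shift (g * real k) b) \<and>
    (\<integral>x. \<bar>ln x - log_shift (g * real k) b\<bar> \<partial>beta_distribution (g * real k) b) + (1 / (g * real k) - 1 / (g * real k + b)) \<le> C k"
    by metis
  define N where "N = nat \<lceil>4 / g\<rceil>"
  define K where "K = 40 * g powr (- 3 / 2) + (\<Sum>k\<le>N. C k * real k powr (3 / 2))"
  have K0: "K \<ge> 0" unfolding K_def using C(1) by (intro add_nonneg_nonneg sum_nonneg) auto
  have "swap_error g k b y t \<le> K * real k powr (- 3 / 2) / t"
    if k: "k \<ge> 1" and b: "b > 0" and t: "t \<ge> 1" for k :: nat and b y t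
  proof -
    have gk: "g * real k > 0" using g k by simp
    have s0: "0 \<le> 1 / (g * real k) - 1 / (g * real k + b)" using gk b by (simp add: frac_le)
    have pr: "prob_space (beta_distribution (g * real k) b)"
      using gk b by (rule prob_space_beta_distribution)
    have kk: "real k powr (3 / 2) * real k powr (- 3 / 2) = 1"
      using k by (simp add: powr_add[symmetric])
    show ?thesis
    proof (cases "g * real k \<ge> 4")
      case True
      note m = beta_log_moments[OF True b]
      have "swap_error g k b y t \<le> (40 * (g * real k) powr (- 3 / 2)) / t"
        unfolding swap_error_def using t by (intro order_trans[OF lindeberg_step[OF pr _ t s0 m(3,2,1)] divide_right_mono[OF m(4)]]) auto
      also have "(40 * (g * real k) powr (- 3 / 2)) = (40 * g powr (- 3 / 2)) * real k powr (- 3 / 2)"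
        using g k by (simp add: powr_mult)
      also have "\<dots> / t \<le> K * real k powr (- 3 / 2) / t"
        using t C(1) by (intro divide_right_mono mult_right_mono) (auto simp: K_def intro!: sum_nonneg)
      finally show ?thesis .
    next
      case False
      then have "real k < 4 / g" using g by (simp add: field_simps)
      then have kN: "k \<le> N" unfolding N_def by linarith
      note c = C(2)[OF k b]
      have "swap_error g k b y t \<le> C k / t"
        unfolding swap_error_def using t c by (intro order_trans[OF lindeberg_step_crude[OF pr t s0] divide_right_mono]) auto
      also have "C k = C k * real k powr (3 / 2) * real k powr (- 3 / 2)" using kk by (simp add: mult.assoc)
      also have "\<dots> / t \<le> K * real k powr (- 3 / 2) / t"
      proof -
        have "C k * real k powr (3 / 2) \<le> (\<Sum>k\<le>N. C k * real k powr (3 / 2))"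
          using kN C(1) by (intro member_le_sum) auto
        also have "\<dots> \<le> K" unfolding K_def by simp
        finally show ?thesis using t by (intro divide_right_mono mult_right_mono) auto
      qed
      finally show ?thesis .
    qed
  qed
  then show ?thesis using K0 by blast
qed

section \<open>Normal approximation of products of beta variables\<close>

definition beta_var :: "real \<Rightarrow> (nat \<Rightarrow> real) \<Rightarrow> nat \<Rightarrow> real" where
  "beta_var g b m = (\<Sum>k\<in>{1..m}. 1 / (g * real k) - 1 / (g * real k + b k))"

definition beta_center :: "real \<Rightarrow> (nat \<Rightarrow> real) \<Rightarrow> nat \<Rightarrow> real" where
  "beta_center g b m = (\<Sum>k\<in>{1..m}. log_shift (g * real k) (b k))"

text \<open>The true growth is logarithmic, but any power of \<open>m\<close> below \<open>1\<close> keeps the weights in \<open>beta_prod_clt\<close>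
  summable, and \<open>1 / k\<close> is at most twice the increment of the square root.\<close>

lemma beta_var_le_sqrt:
  assumes g: "g > 0" and b: "\<And>k. k \<in> {1..m} \<Longrightarrow> b k > 0"
  shows "0 \<le> beta_var g b m" "beta_var g b m \<le> 2 / g * sqrt (real m)"
proof -
  show "0 \<le> beta_var g b m"
    unfolding beta_var_def using g b
    by (intro sum_nonneg) (auto simp: frac_le less_imp_le)
  have "beta_var g b m \<le> (\<Sum>k\<in>{1..m}. 1 / (g * real k))"
    unfolding beta_var_def using g b by (intro sum_mono) (auto simp: less_imp_le)
  also have "\<dots> = 1 / g * (\<Sum>k\<in>{1..m}. 1 / real k)" by (simp add: sum_distrib_left)
  also have "\<dots> \<le> 1 / g * (2 * sqrt (real m))"
  proof (rule mult_left_mono)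
  show "(\<Sum>k\<in>{1..m}. 1 / real k) \<le> 2 * sqrt (real m)"
  proof (induction m)
    case (Suc m)
    have "1 / real (Suc m) \<le> 2 * (sqrt (real (Suc m)) - sqrt (real m))"
    proof -
      let ?r = "sqrt (real (Suc m))" and ?q = "sqrt (real m)"
      have r: "?r\<^sup>2 = real m + 1" "?q\<^sup>2 = real m" "?q \<le> ?r" "0 < ?r" "0 \<le> ?q" "1 \<le> ?r" by auto
      have "(?r - ?q) * (?r + ?q) = 1" using r by (simp add: power2_eq_square algebra_simps)
      moreover have "?r + ?q \<noteq> 0" using r by linarith
      ultimately have A: "?r - ?q = 1 / (?r + ?q)" by (simp only: nonzero_eq_divide_eq simp_thms)
      have le: "1 / (2 * ?r\<^sup>2) \<le> 1 / (?r + ?q)"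
      proof (rule divide_left_mono)
        have "?r * 1 \<le> ?r * ?r" using r by (intro mult_left_mono) auto
        then have "?r \<le> ?r\<^sup>2" by (simp only: power2_eq_square mult_1_right)
        then show "?r + ?q \<le> 2 * ?r\<^sup>2" using r(3) by linarith
      qed (use r in \<open>auto intro!: mult_pos_pos add_pos_nonneg\<close>)
      have "1 / real (Suc m) = 2 * (1 / (2 * ?r\<^sup>2))" unfolding r(1) by (simp add: field_simps)
      also have "\<dots> \<le> 2 * (1 / (?r + ?q))" by (rule mult_left_mono[OF le]) simp
      finally show ?thesis unfolding A .
    qed
    then show ?case using Suc by simp
  qed simp
  qed (use g in simp)
  finally show "beta_var g b m \<le> 2 / g * sqrt (real m)" using g by simp
qed

text \<open>After \<open>k\<close> factors have been restored, the remaining variance \<open>1 + beta_var g b m - beta_var g b k\<close> is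
  Gaussian and hidden in the width \<open>t k\<close>. Passing from \<open>k\<close> to \<open>k + 1\<close> exchanges a Gaussian for one beta
  factor, at the cost of one \<open>swap_error\<close> at width \<open>t (k + 1)\<close>.\<close>

lemma lindeberg_sum:
  assumes g: "g > 0" and b: "\<And>k. k \<in> {1..m} \<Longrightarrow> b k > 0" and K: "K \<ge> 0"
    and step: "\<And>k b y t. k \<ge> 1 \<Longrightarrow> b > 0 \<Longrightarrow> t \<ge> 1 \<Longrightarrow>
    swap_error g k b y t \<le> K * real k powr (- 3 / 2) / t"
  defines "t \<equiv> \<lambda>k. sqrt (1 + beta_var g b m - beta_var g b k)"
  assumes k: "k \<le> m"
  shows "\<bar>(\<integral>z. Phi ((x - (ln z - beta_center g b k)) / t k) \<partial>beta_prod (\<lambda>k. g * real k) b k) - Phi (x / t 0)\<bar>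
    \<le> (\<Sum>j\<in>{1..k}. K * real j powr (- 3 / 2) / t j)"
  using k
proof (induction k)
  case 0
  show ?case by (simp add: integral_return beta_center_def)
next
  case (Suc k)
  let ?P = "beta_prod (\<lambda>k. g * real k) b k"
  let ?B = "beta_distribution (g * real (Suc k)) (b (Suc k))"
  have bS: "b (Suc k) > 0" using b[of "Suc k"] Suc.prems by simp
  have gS: "g * real (Suc k) > 0" using g by simp
  have par: "g * real j > 0 \<and> b j > 0" if "j \<in> {1..Suc k}" for j
    using that g b[of j] Suc.prems by auto
  interpret P: prob_space ?P by (rule prob_space_beta_prod) (use par in auto)
  interpret B: prob_space ?B by (rule prob_space_beta_distribution[OF gS bS])
  define s where "s = 1 / (g * real (Suc k)) - 1 / (g * real (Suc k) + b (Suc k))"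
  have vmono: "beta_var g b (Suc k) \<le> beta_var g b m"
    unfolding beta_var_def using g b Suc.prems by (intro sum_mono2) (auto simp: frac_le less_imp_le)
  have vS: "beta_var g b (Suc k) = beta_var g b k + s" by (simp add: beta_var_def s_def)
  have tS: "1 \<le> t (Suc k)" using vmono by (simp add: t_def)
  have t2: "(t (Suc k))\<^sup>2 = 1 + beta_var g b m - beta_var g b (Suc k)" using vmono by (simp add: t_def)
  have tk: "t k = sqrt ((t (Suc k))\<^sup>2 + s)"
    unfolding t2 vS by (simp add: t_def)
  define F where "F z = Phi ((x - (ln z - beta_center g b (Suc k))) / t (Suc k))" for z
  have [measurable]: "F \<in> borel_measurable borel" unfolding F_def by measurable
  have F1: "\<bar>F z\<bar> \<le> 1" for z using Phi_bounds by (simp add: F_def)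
  define G where "G z = Phi ((x - (ln z - beta_center g b k)) / t k)" for z
  have [measurable]: "G \<in> borel_measurable borel" unfolding G_def by measurable
  define H where "H z = (\<integral>y. F (z * y) \<partial>?B)" for z
  have [measurable]: "H \<in> borel_measurable borel"
    unfolding H_def by measurable
  have H1: "\<bar>H z\<bar> \<le> 1" for z
  proof -
    have "\<bar>H z\<bar> \<le> (\<integral>y. \<bar>F (z * y)\<bar> \<partial>?B)" unfolding H_def by (rule integral_abs_bound)
    also have "\<dots> \<le> (\<integral>y. 1 \<partial>?B)"
      using F1 by (intro integral_mono B.integrable_const_bound[where B = 1]) auto
    finally show ?thesis using B.prob_space by simp
  qed
  have err: "\<bar>H z - G z\<bar> \<le> K * real (Suc k) powr (- 3 / 2) / t (Suc k)" if z: "z > 0" for z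
  proof -
    have "H z = (\<integral>y. Phi (((x - (ln z - beta_center g b k)) - (ln y - log_shift (g * real (Suc k)) (b (Suc k)))) / t (Suc k)) \<partial>?B)"
      unfolding H_def
    proof (rule integral_cong_AE)
      show "AE y in ?B. F (z * y) = Phi (((x - (ln z - beta_center g b k)) - (ln y - log_shift (g * real (Suc k)) (b (Suc k)))) / t (Suc k))"
        using AE_beta_distribution
      proof eventually_elim
        case (elim y)
        then show ?case using z by (simp add: F_def ln_mult beta_center_def algebra_simps)
      qed
    qed measurable
    then show ?thesis
      using step[of "Suc k" "b (Suc k)" "t (Suc k)" "x - (ln z - beta_center g b k)"] bS tS
      unfolding G_def tk s_def swap_error_def by simp
  qed
  have iH: "integrable ?P H" using H1 by (intro P.integrable_const_bound[where B = 1]) auto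
  have iG: "integrable ?P G" using Phi_bounds by (intro P.integrable_const_bound[where B = 1]) (auto simp: G_def)
  have "\<bar>\<integral>z. H z - G z \<partial>?P\<bar> \<le> (\<integral>z. \<bar>H z - G z\<bar> \<partial>?P)" by (rule integral_abs_bound)
  also have "\<dots> \<le> (\<integral>z. K * real (Suc k) powr (- 3 / 2) / t (Suc k) \<partial>?P)"
  proof (rule integral_mono_AE)
    have "AE z in ?P. 0 < z \<and> z \<le> 1" by (rule AE_beta_prod) (use par in auto)
    then show "AE z in ?P. \<bar>H z - G z\<bar> \<le> K * real (Suc k) powr (- 3 / 2) / t (Suc k)"
      by eventually_elim (use err in auto)
  qed (use iH iG in auto)
  finally have "\<bar>(\<integral>z. H z \<partial>?P) - (\<integral>z. G z \<partial>?P)\<bar> \<le> K * real (Suc k) powr (- 3 / 2) / t (Suc k)"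
    using iH iG P.prob_space by simp
  moreover have "(\<integral>z. F z \<partial>beta_prod (\<lambda>k. g * real k) b (Suc k)) = (\<integral>z. H z \<partial>?P)"
    unfolding H_def using F1 by (intro integral_beta_prod_Suc[where C = 1] par) auto
  moreover have "\<bar>(\<integral>z. G z \<partial>?P) - Phi (x / t 0)\<bar> \<le> (\<Sum>j\<in>{1..k}. K * real j powr (- 3 / 2) / t j)"
    using Suc by (simp add: G_def)
  ultimately show ?case unfolding F_def by simp
qed

text \<open>With \<open>v = beta_var g b\<close> one has \<open>1 + v m \<le> (1 + v m - v j) * (1 + v j)\<close>, that is
  \<open>1 / t j \<le> sqrt (1 + v j) / t 0\<close>. As \<open>v j\<close> grows at most like \<open>sqrt j\<close>, the \<open>j\<close>-th exchange contributes at most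
  a multiple of \<open>j powr (- 3 / 2 + 1 / 4) / t 0\<close>, which is summable. Smoothing at width \<open>1\<close> then
  costs another multiple of \<open>1 / t 0\<close>.\<close>

theorem beta_prod_clt:
  assumes g: "g > 0"
  shows "\<exists>C\<ge>0. \<forall>m b x. (\<forall>k\<in>{1..m}. b k > 0) \<longrightarrow>
    \<bar>measure (beta_prod (\<lambda>k. g * real k) b m) {z. ln z - beta_center g b m \<le> x}
      - Phi (x / sqrt (1 + beta_var g b m))\<bar> \<le> C / sqrt (1 + beta_var g b m)"
proof -
  obtain K where K: "K \<ge> 0" and step: "\<And>k b y t. k \<ge> 1 \<Longrightarrow> b > 0 \<Longrightarrow> t \<ge> 1 \<Longrightarrow>
    swap_error g k b y t \<le> K * real k powr (- 3 / 2) / t"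
    using beta_step[OF g] by blast
  have summ: "summable (\<lambda>j. real j powr (- 5 / 4))" by (simp add: summable_real_powr_iff)
  define Z where "Z = (\<Sum>j. real j powr (- 5 / 4))"
  define C where "C = 2 * (K * sqrt (1 + 2 / g) * Z) + 8"
  have Z0: "Z \<ge> 0" unfolding Z_def by (rule suminf_nonneg[OF summ]) auto
  have C0: "C \<ge> 0" using K Z0 g by (simp add: C_def)
  have "\<bar>measure (beta_prod (\<lambda>k. g * real k) b m) {z. ln z - beta_center g b m \<le> x}
      - Phi (x / sqrt (1 + beta_var g b m))\<bar> \<le> C / sqrt (1 + beta_var g b m)"
    if b: "\<And>k. k \<in> {1..m} \<Longrightarrow> b k > 0" for m b x
  proof -
    let ?P = "beta_prod (\<lambda>k. g * real k) b m"
    define t where "t k = sqrt (1 + beta_var g b m - beta_var g b k)" for k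
    interpret P: prob_space ?P by (rule prob_space_beta_prod) (use g b in auto)
    have bv0: "beta_var g b 0 = 0" by (simp add: beta_var_def)
    have vm0: "0 \<le> beta_var g b m" using beta_var_le_sqrt(1)[OF g b] .
    have t0: "t 0 = sqrt (1 + beta_var g b m)" "1 \<le> t 0" using vm0 by (auto simp: t_def bv0)
    have tm: "t m = 1" by (simp add: t_def)
    have tj: "K * real j powr (- 3 / 2) / t j \<le> K * sqrt (1 + 2 / g) / t 0 * real j powr (- 5 / 4)" if j: "j \<in> {1..m}" for j
    proof -
      have bj: "\<And>k. k \<in> {1..j} \<Longrightarrow> b k > 0" using b j by auto
      have vj: "0 \<le> beta_var g b j" "beta_var g b j \<le> 2 / g * sqrt (real j)"
        using beta_var_le_sqrt[OF g bj, of j] by auto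
      have vmono: "beta_var g b j \<le> beta_var g b m"
        unfolding beta_var_def using g b j by (intro sum_mono2) (auto simp: frac_le less_imp_le)
      have tj1: "1 \<le> t j" using vmono by (simp add: t_def)
      have "1 + beta_var g b m \<le> (1 + beta_var g b m - beta_var g b j) * (1 + beta_var g b j)"
        using vj vmono mult_nonneg_nonneg[of "beta_var g b m - beta_var g b j" "beta_var g b j"] by (simp add: algebra_simps)
      also have "\<dots> \<le> (1 + beta_var g b m - beta_var g b j) * ((1 + 2 / g) * sqrt (real j))"
      proof (rule mult_left_mono)
        have "1 \<le> sqrt (real j)" using j by simp
        then show "1 + beta_var g b j \<le> (1 + 2 / g) * sqrt (real j)"
          using vj(2) unfolding distrib_right by linarith
      qed (use vmono in simp)
      finally have "t 0 \<le> sqrt ((1 + beta_var g b m - beta_var g b j) * ((1 + 2 / g) * sqrt (real j)))"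
        unfolding t0 by (rule real_sqrt_le_mono)
      also have "\<dots> = t j * (sqrt (1 + 2 / g) * real j powr (1 / 4))"
      proof -
        have "sqrt (sqrt (real j)) = real j powr (1 / 4)"
          using j by (simp add: powr_half_sqrt[symmetric] powr_powr)
        then show ?thesis by (simp add: t_def real_sqrt_mult)
      qed
      finally have le: "1 / t j \<le> sqrt (1 + 2 / g) * real j powr (1 / 4) / t 0"
        using tj1 t0 by (simp add: field_simps)
      have "K * real j powr (- 3 / 2) / t j = K * real j powr (- 3 / 2) * (1 / t j)" by simp
      also have "\<dots> \<le> K * real j powr (- 3 / 2) * (sqrt (1 + 2 / g) * real j powr (1 / 4) / t 0)"
        using K by (intro mult_left_mono le) auto
      also have "\<dots> = K * sqrt (1 + 2 / g) / t 0 * (real j powr (- 3 / 2) * real j powr (1 / 4))" by simp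
      also have "real j powr (- 3 / 2) * real j powr (1 / 4) = real j powr (- 5 / 4)"
        by (simp add: powr_add[symmetric])
      finally show ?thesis .
    qed
    have sm: "\<bar>(\<integral>z. Phi (x - (ln z - beta_center g b m)) \<partial>?P) - Phi (x / t 0)\<bar> \<le> K * sqrt (1 + 2 / g) * Z / t 0" for x
    proof -
      have "\<bar>(\<integral>z. Phi ((x - (ln z - beta_center g b m)) / t m) \<partial>?P) - Phi (x / t 0)\<bar>
        \<le> (\<Sum>j\<in>{1..m}. K * real j powr (- 3 / 2) / t j)"
        unfolding t_def by (rule lindeberg_sum[OF g b K step]) auto
      also have "\<dots> \<le> (\<Sum>j\<in>{1..m}. K * sqrt (1 + 2 / g) / t 0 * real j powr (- 5 / 4))"
        by (rule sum_mono) (rule tj)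
      also have "\<dots> = K * sqrt (1 + 2 / g) / t 0 * (\<Sum>j\<in>{1..m}. real j powr (- 5 / 4))" by (simp add: sum_distrib_left)
      also have "\<dots> \<le> K * sqrt (1 + 2 / g) / t 0 * Z"
        unfolding Z_def using K g t0 by (intro mult_left_mono sum_le_suminf[OF summ]) auto
      finally show ?thesis by (simp add: tm)
    qed
    define M where "M = distr ?P borel (\<lambda>z. ln z - beta_center g b m)"
    have "\<bar>cdf M x - Phi (x / t 0)\<bar> \<le> 2 * (K * sqrt (1 + 2 / g) * Z / t 0) + 8 * (1 / t 0)"
    proof (rule gaussian_smoothing)
      show "real_distribution M" unfolding M_def by (rule P.real_distribution_distr) simp
      show "0 \<le> Phi (x / t 0) \<and> Phi (x / t 0) \<le> 1" for x using Phi_bounds by simp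
      show "\<bar>Phi (x / t 0) - Phi (y / t 0)\<bar> \<le> 1 / t 0 * \<bar>x - y\<bar>" for x y
      proof -
        have "\<bar>x / t 0 - y / t 0\<bar> = 1 / t 0 * \<bar>x - y\<bar>" using t0(2) by (simp add: diff_divide_distrib[symmetric])
        then show ?thesis using Phi_lipschitz[of "x / t 0" "y / t 0"] by simp
      qed
      show "\<bar>(\<integral>y. Phi (x - y) \<partial>M) - Phi (x / t 0)\<bar> \<le> K * sqrt (1 + 2 / g) * Z / t 0" for x
        using sm[of x] unfolding M_def by (subst integral_distr) auto
    qed (use t0 in auto)
    also have "\<dots> = C / t 0" by (simp add: C_def add_divide_distrib)
    also have "cdf M x = measure ?P {z. ln z - beta_center g b m \<le> x}"
      unfolding M_def cdf_def by (subst measure_distr) (auto simp: vimage_def)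
    finally show ?thesis unfolding t0 .
  qed
  then show ?thesis using C0 by blast
qed

text \<open>The centering \<open>u\<close> and the variance \<open>ln n / g\<close> of the statement agree with those of the product up to
  bounded errors.\<close>

definition kolmogorov_regime :: "real \<Rightarrow> real \<Rightarrow> nat \<Rightarrow> nat \<Rightarrow> (nat \<Rightarrow> real) \<Rightarrow> real \<Rightarrow> bool" where
  "kolmogorov_regime g E n m b u \<longleftrightarrow> n \<ge> 2 \<and> (\<forall>k\<in>{1..m}. b k > 0) \<and>
     \<bar>beta_var g b m - ln (real n) / g\<bar> \<le> E \<and> \<bar>u - beta_center g b m\<bar> \<le> E"

text \<open>Passing from the width \<open>sqrt (1 + beta_var g b m)\<close> and centering \<open>beta_center g b m\<close> to
  \<open>t = sqrt (ln n / g)\<close> and \<open>u\<close> costs \<open>O(1 / t)\<close>, by the Lipschitz property of \<open>Phi\<close> for the centering and by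
  \<open>Phi_scale\<close> for the width. If \<open>t\<close> is not large compared with \<open>E\<close>, the claim holds since
  probabilities differ by at most \<open>1\<close>.\<close>

theorem beta_prod_kolmogorov:
  assumes g: "g > 0" and E: "E \<ge> 0"
  shows "\<exists>K\<ge>0. \<forall>n m b u x. kolmogorov_regime g E n m b u \<longrightarrow>
    \<bar>measure (beta_prod (\<lambda>k. g * real k) b m) {z. (ln z - u) * sqrt (g / ln (real n)) \<le> x} - Phi x\<bar>
      \<le> K * sqrt (g / ln (real n))"
proof -
  obtain C where C: "C \<ge> 0" and clt: "\<And>m b x. (\<And>k. k \<in> {1..m} \<Longrightarrow> b k > 0) \<Longrightarrow>
    \<bar>measure (beta_prod (\<lambda>k. g * real k) b m) {z. ln z - beta_center g b m \<le> x}
      - Phi (x / sqrt (1 + beta_var g b m))\<bar> \<le> C / sqrt (1 + beta_var g b m)"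
    using beta_prod_clt[OF g] by blast
  define t2 where "t2 = sqrt (ln 2 / g)"
  have t2: "t2 > 0" using g by (simp add: t2_def)
  define K where "K = 2 * C + 2 * E + (E + 1) / t2 + sqrt (2 * (E + 1))"
  have K0: "K \<ge> 0" using C E t2 by (simp add: K_def)
  have "\<bar>measure (beta_prod (\<lambda>k. g * real k) b m) {z. (ln z - u) * sqrt (g / ln (real n)) \<le> x} - Phi x\<bar>
      \<le> K * sqrt (g / ln (real n))"
    if regime: "kolmogorov_regime g E n m b u" for n m b u x
  proof -
    have n: "n \<ge> 2" and b: "\<And>k. k \<in> {1..m} \<Longrightarrow> b k > 0" and v: "\<bar>beta_var g b m - ln (real n) / g\<bar> \<le> E"
      and u: "\<bar>u - beta_center g b m\<bar> \<le> E"
      using regime by (auto simp: kolmogorov_regime_def)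
    let ?P = "beta_prod (\<lambda>k. g * real k) b m"
    interpret P: prob_space ?P by (rule prob_space_beta_prod) (use g b in auto)
    define t where "t = sqrt (ln (real n) / g)"
    have lnn: "ln (real n) \<ge> ln 2" using n by simp
    have ln0: "ln (real n) > 0" using n by simp
    have t: "t \<ge> t2" "t > 0" using lnn ln0 g by (auto simp: t_def t2_def divide_right_mono)
    have tt: "t\<^sup>2 = ln (real n) / g" using ln0 g by (simp add: t_def)
    have r: "sqrt (g / ln (real n)) = 1 / t" by (simp add: t_def real_sqrt_divide)
    define V where "V = 1 + beta_var g b m"
    have V0: "V \<ge> 1" using beta_var_le_sqrt(1)[OF g b] by (simp add: V_def)
    have Vt: "\<bar>V - t\<^sup>2\<bar> \<le> E + 1" using v unfolding tt V_def by linarith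
    show ?thesis
    proof (cases "t\<^sup>2 < 2 * (E + 1)")
      case True
      then have "t \<le> sqrt (2 * (E + 1))" using real_le_rsqrt less_imp_le by blast
      also have "\<dots> \<le> K" using C E t2 by (simp add: K_def)
      finally have "1 \<le> K * (1 / t)" using t by (simp add: field_simps)
      moreover have "\<bar>measure ?P {z. (ln z - u) * sqrt (g / ln (real n)) \<le> x} - Phi x\<bar> \<le> 1"
        using Phi_bounds[of x] P.prob_le_1 measure_nonneg[of ?P] by (simp add: abs_le_iff add_increasing2 diff_le_eq)
      ultimately show ?thesis unfolding r by (rule order_trans[rotated])
    next
      case False
      define d where "d = u - beta_center g b m"
      have "t\<^sup>2 - V \<le> E + 1" using Vt by (simp add: abs_le_iff)
      then have V2: "V \<ge> t\<^sup>2 / 2" using False by (simp add: field_simps)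
      have sV: "sqrt V > 0" "t / 2 \<le> sqrt V"
      proof -
        show "sqrt V > 0" using V0 by simp
        have "(t / 2)\<^sup>2 \<le> V" using V2 V0 by (simp add: power_divide)
        then show "t / 2 \<le> sqrt V" by (rule real_le_rsqrt)
      qed
      have i: "1 / sqrt V \<le> 2 / t" using sV t by (simp add: field_simps)
      have "{z. (ln z - u) * sqrt (g / ln (real n)) \<le> x} = {z. ln z - beta_center g b m \<le> x * t + d}"
        unfolding r d_def using t by (auto simp: field_simps)
      then have 1: "\<bar>measure ?P {z. (ln z - u) * sqrt (g / ln (real n)) \<le> x} - Phi ((x * t + d) / sqrt V)\<bar> \<le> C / sqrt V"
        using clt[of m b "x * t + d"] b by (simp add: V_def)
      have "C / sqrt V \<le> 2 * C / t" using mult_left_mono[OF i C] by (simp add: mult_ac)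
      with 1 have 1: "\<bar>measure ?P {z. (ln z - u) * sqrt (g / ln (real n)) \<le> x} - Phi ((x * t + d) / sqrt V)\<bar> \<le> 2 * C / t"
        by linarith
      have 2: "\<bar>Phi ((x * t + d) / sqrt V) - Phi ((t / sqrt V) * x)\<bar> \<le> 2 * E / t"
      proof -
        have "\<bar>Phi ((x * t + d) / sqrt V) - Phi ((t / sqrt V) * x)\<bar> \<le> \<bar>(x * t + d) / sqrt V - (t / sqrt V) * x\<bar>"
          by (rule Phi_lipschitz)
        also have "(x * t + d) / sqrt V - (t / sqrt V) * x = d * (1 / sqrt V)"
          by (simp add: add_divide_distrib mult.commute)
        also have "\<bar>d * (1 / sqrt V)\<bar> = \<bar>d\<bar> * (1 / sqrt V)" using sV by (simp add: abs_mult)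
        also have "\<dots> \<le> E * (2 / t)"
          using i u sV t E by (intro mult_mono) (auto simp: d_def)
        also have "\<dots> = 2 * E / t" by simp
        finally show ?thesis .
      qed
      have 3: "\<bar>Phi ((t / sqrt V) * x) - Phi x\<bar> \<le> ((E + 1) / t2) / t"
      proof -
        have q: "\<bar>ln (t\<^sup>2 / V)\<bar> \<le> 2 * (E + 1) / t\<^sup>2"
        proof -
          have tp: "t\<^sup>2 > 0" using t by simp
          have h: "\<bar>V - t\<^sup>2\<bar> / w \<le> 2 * (E + 1) / t\<^sup>2" if "t\<^sup>2 / 2 \<le> w" for w
          proof -
            have "\<bar>V - t\<^sup>2\<bar> / w \<le> (E + 1) / (t\<^sup>2 / 2)"
              using that tp Vt E by (intro frac_le) auto
            also have "\<dots> = 2 * (E + 1) / t\<^sup>2" by simp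
            finally show ?thesis .
          qed
          have "ln (t\<^sup>2 / V) \<le> t\<^sup>2 / V - 1" using tp V0 by (intro ln_le_minus_one) auto
          also have "\<dots> = (t\<^sup>2 - V) / V" using V0 by (simp add: field_simps)
          also have "\<dots> \<le> \<bar>V - t\<^sup>2\<bar> / V" using V0 by (intro divide_right_mono) auto
          finally have a: "ln (t\<^sup>2 / V) \<le> 2 * (E + 1) / t\<^sup>2" using h[OF V2] by linarith
          have "- ln (t\<^sup>2 / V) = ln (V / t\<^sup>2)" using tp V0 by (simp add: ln_div)
          also have "\<dots> \<le> V / t\<^sup>2 - 1" using tp V0 by (intro ln_le_minus_one) auto
          also have "\<dots> = (V - t\<^sup>2) / t\<^sup>2" using tp by (simp add: field_simps)
          also have "\<dots> \<le> \<bar>V - t\<^sup>2\<bar> / t\<^sup>2" using tp by (intro divide_right_mono) auto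
          finally have "- ln (t\<^sup>2 / V) \<le> 2 * (E + 1) / t\<^sup>2" using h[of "t\<^sup>2"] tp by linarith
          with a show ?thesis by (simp add: abs_le_iff)
        qed
        have "\<bar>Phi ((t / sqrt V) * x) - Phi x\<bar> \<le> \<bar>ln (t / sqrt V)\<bar>"
          using t sV by (intro Phi_scale) auto
        also have "ln (t / sqrt V) = ln (t\<^sup>2 / V) / 2"
          using t V0 sV by (simp add: ln_div ln_sqrt ln_realpow diff_divide_distrib)
        also have "\<bar>ln (t\<^sup>2 / V) / 2\<bar> = \<bar>ln (t\<^sup>2 / V)\<bar> / 2" by simp
        also have "\<dots> \<le> (2 * (E + 1) / t\<^sup>2) / 2" by (rule divide_right_mono[OF q]) simp
        also have "\<dots> = (E + 1) / t\<^sup>2"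
        proof -
          have "2 * c / w / 2 = c / w" for c w :: real by simp
          then show ?thesis .
        qed
        also have "\<dots> = (E + 1) / t / t" by (simp add: power2_eq_square)
        also have "\<dots> \<le> (E + 1) / t2 / t"
          using t t2 E by (intro divide_right_mono divide_left_mono) auto
        finally show ?thesis .
      qed
      have "2 * C / t + 2 * E / t + ((E + 1) / t2) / t \<le> K * (1 / t)"
      proof -
        have "K * (1 / t) = 2 * C / t + 2 * E / t + (E + 1) / t2 / t + sqrt (2 * (E + 1)) / t"
          unfolding K_def by (simp only: add_divide_distrib times_divide_eq_right mult_1_right)
        moreover have "0 \<le> sqrt (2 * (E + 1)) / t" using t E by simp
        ultimately show ?thesis by linarith
      qed
      then show ?thesis using 1 2 3 unfolding r by linarith
    qed
  qed
  then show ?thesis using K0 by blast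
qed

section \<open>Gram and Jacobi ensembles\<close>

text \<open>The error decreases in \<open>k\<close>, and by the trapezoidal bounds for \<open>ln (k + 1) - ln k\<close> the steps are at most
  \<open>(1 / k - 1 / (k + 1)) / 4\<close>, which telescopes.\<close>

lemma stirling_bounded:
  assumes "k \<ge> 1"
  shows "\<bar>ln (fact k) - (real k * ln (real k) - real k + ln (real k) / 2)\<bar> \<le> 1"
proof -
  define d where "d k = ln (fact k) - (real k * ln (real k) - real k + ln (real k) / 2)" for k :: nat
  have step: "d k - (1 / real k - 1 / real (Suc k)) / 4 \<le> d (Suc k) \<and> d (Suc k) \<le> d k" if k: "k \<ge> 1" for k
  proof -
    define x where "x = real k"
    have x: "x \<ge> 1" using k by (simp add: x_def)
    have f: "ln (fact (Suc k)) = ln (x + 1) + ln (fact k)"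
      by (simp add: x_def ln_mult add.commute)
    have diff: "d k - d (Suc k) = (x + 1 / 2) * (ln (x + 1) - ln x) - 1"
      unfolding d_def f using x_def by (simp add: algebra_simps add_divide_distrib)
    have up: "ln (x + 1) - ln x \<le> 1 * (inverse x + inverse (x + 1)) / 2"
      using x by (intro ln_inverse_approx_le) auto
    have lo: "2 * 1 / (2 * x + 1) \<le> ln (x + 1) - ln x"
      using ln_inverse_approx_ge[of x "x + 1"] x by (simp add: field_simps)
    define y where "y = (x + 1 / 2) * (ln (x + 1) - ln x)"
    have "(x + 1 / 2) * (2 * 1 / (2 * x + 1)) \<le> y"
      unfolding y_def using x by (intro mult_left_mono lo) auto
    moreover have "(x + 1 / 2) * (2 * 1 / (2 * x + 1)) = 1" using x by (simp add: field_simps)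
    ultimately have y1: "1 \<le> y" by (simp only:)
    have "y \<le> (x + 1 / 2) * (1 * (inverse x + inverse (x + 1)) / 2)"
      unfolding y_def using x by (intro mult_left_mono up) auto
    also have "\<dots> = 1 + (1 / x - 1 / (x + 1)) / 4"
      using x by (simp add: divide_simps) (simp add: algebra_simps)
    finally have y2: "y \<le> 1 + (1 / x - 1 / (x + 1)) / 4" .
    have S: "real (Suc k) = x + 1" by (simp add: x_def)
    show ?thesis using diff y1 y2 unfolding y_def[symmetric] S x_def[symmetric] by linarith
  qed
  have "d k \<le> 1 \<and> 1 - (1 - 1 / real k) / 4 \<le> d k"
    using assms
  proof (induction k rule: dec_induct)
    case base
    then show ?case by (simp add: d_def)
  next
    case (step j)
    have "d j - (1 / real j - 1 / real (Suc j)) / 4 \<le> d (Suc j)" "d (Suc j) \<le> d j"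
      using \<open>\<And>k. 1 \<le> k \<Longrightarrow> _\<close>[of j] step.hyps by auto
    then show ?case using step.IH by argo
  qed
  moreover have "1 / real k \<ge> 0" by simp
  ultimately show ?thesis unfolding d_def[symmetric] by argo
qed

lemma harmonic_bounds:
  assumes "m \<ge> 1"
  shows "ln (real m) \<le> (\<Sum>k\<in>{1..m}. 1 / real k)" "(\<Sum>k\<in>{1..m}. 1 / real k) \<le> 1 + ln (real m)"
proof -
  have "ln (real m + 1) \<le> (\<Sum>k\<in>{1..m}. 1 / real k) \<and> (\<Sum>k\<in>{1..m}. 1 / real k) \<le> 1 + ln (real m)"
    using assms
  proof (induction m rule: dec_induct)
    case base
    then show ?case using ln_2_less_1 by simp
  next
    case (step j)
    define x where "x = real j"
    have x: "x \<ge> 1" using step by (simp add: x_def)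
    have lo: "2 * 1 / (2 * x + 1) \<le> ln (x + 1) - ln x"
      using ln_inverse_approx_ge[of x "x + 1"] x by (simp add: field_simps)
    have "1 / (x + 1) \<le> 2 * 1 / (2 * x + 1)" using x by (simp add: field_simps)
    with lo have 1: "1 / (x + 1) \<le> ln (x + 1) - ln x" by linarith
    have 2: "ln ((x + 1) + 1) - ln (x + 1) < 1 / (x + 1)"
      using x by (intro ln_diff_le_inverse) auto
    have 3: "(\<Sum>k\<in>{1..Suc j}. 1 / real k) = (\<Sum>k\<in>{1..j}. 1 / real k) + 1 / (x + 1)" by (simp add: x_def add.commute)
    have 4: "real (Suc j) = x + 1" by (simp add: x_def)
    show ?case using step.IH 1 2 unfolding 3 4 x_def[symmetric] by linarith
  qed
  moreover have "ln (real m) \<le> ln (real m + 1)" using assms by simp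
  ultimately show "ln (real m) \<le> (\<Sum>k\<in>{1..m}. 1 / real k)" "(\<Sum>k\<in>{1..m}. 1 / real k) \<le> 1 + ln (real m)"
    by linarith+
qed

lemma beta_center_eq:
  assumes g: "g > 0" and b: "\<And>k. k \<in> {1..m} \<Longrightarrow> b k > 0"
  shows "beta_center g b m = (\<Sum>k\<in>{1..m}. ln (g * real k) - ln (g * real k + b k)) - beta_var g b m / 2"
proof -
  have "beta_center g b m = (\<Sum>k\<in>{1..m}. (ln (g * real k) - ln (g * real k + b k)) - (1 / (g * real k) - 1 / (g * real k + b k)) / 2)"
    unfolding beta_center_def log_shift_def
  proof (rule sum.cong)
    fix k assume k: "k \<in> {1..m}"
    show "ln (g * real k / (g * real k + b k)) - (1 / (g * real k) - 1 / (g * real k + b k)) / 2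
      = ln (g * real k) - ln (g * real k + b k) - (1 / (g * real k) - 1 / (g * real k + b k)) / 2"
    proof -
      have "g * real k > 0" using g k by simp
      moreover have "g * real k + b k > 0" using \<open>g * real k > 0\<close> b[OF k] by linarith
      ultimately show ?thesis by (subst ln_div) auto
    qed
  qed simp
  then show ?thesis by (simp add: sum_subtractf sum_divide_distrib[symmetric] beta_var_def)
qed

text \<open>The hypothesis makes the subtracted sum of \<open>1 / (g * k + b k)\<close> at most \<open>1 / g\<close>; it holds in all three
  ensembles.\<close>

lemma beta_var_harmonic:
  assumes g: "g > 0" and m: "m \<ge> 1" and b: "\<And>k. k \<in> {1..m} \<Longrightarrow> g * real m \<le> g * real k + b k"
  shows "\<bar>beta_var g b m - ln (real m) / g\<bar> \<le> 1 / g"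
proof -
  have s: "beta_var g b m = (\<Sum>k\<in>{1..m}. 1 / real k) / g - (\<Sum>k\<in>{1..m}. 1 / (g * real k + b k))"
    unfolding beta_var_def by (simp add: sum_subtractf sum_divide_distrib mult.commute)
  have p: "g * real m > 0" using g m by simp
  have 1: "0 \<le> (\<Sum>k\<in>{1..m}. 1 / (g * real k + b k))"
    using b p by (intro sum_nonneg) (smt (verit) divide_nonneg_nonneg)
  have "(\<Sum>k\<in>{1..m}. 1 / (g * real k + b k)) \<le> (\<Sum>k\<in>{1..m}. 1 / (g * real m))"
  proof (intro sum_mono divide_left_mono mult_pos_pos p b)
    fix k assume "k \<in> {1..m}"
    then show "0 < g * real k + b k" using b p by (meson order_less_le_trans)
  qed (use g m in auto)
  also have "\<dots> = 1 / g" using m by simp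
  finally have 2: "(\<Sum>k\<in>{1..m}. 1 / (g * real k + b k)) \<le> 1 / g" .
  have "ln (real m) \<le> (\<Sum>k\<in>{1..m}. 1 / real k)" "(\<Sum>k\<in>{1..m}. 1 / real k) \<le> 1 + ln (real m)"
    using harmonic_bounds[OF m] by auto
  then have "ln (real m) / g \<le> (\<Sum>k\<in>{1..m}. 1 / real k) / g" "(\<Sum>k\<in>{1..m}. 1 / real k) / g \<le> 1 / g + ln (real m) / g"
    using g by (simp_all add: divide_right_mono add_divide_distrib[symmetric])
  then show ?thesis unfolding s using 1 2 by linarith
qed

lemma cdf_rescaled:
  assumes "sets D = sets borel"
  shows "cdf (rescaled_log_law (2 * g) n u D) x = measure D {w. (ln w - u) * sqrt (g / ln (real n)) \<le> x}"
proof -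
  have [measurable_cong]: "sets D = sets borel" by fact
  have "space D = UNIV" using assms sets_eq_imp_space_eq by fastforce
  then show ?thesis
    unfolding rescaled_log_law_def cdf_def by (subst measure_distr) (auto simp: vimage_def)
qed

lemma sum_ln_upto: "(\<Sum>k\<in>{1..m}. ln (real k)) = ln (fact m)"
  by (induction m) (auto simp: ln_mult)

text \<open>Up to the reversal \<open>k \<mapsto> n + 1 - k\<close> of the factors both sides are products of the same independent
  variables; comparing moments takes care of the different product constructions.\<close>

lemma gram_law:
  assumes g: "g > 0" and n: "n \<ge> 2"
  shows "gram_det (2 * g) n = beta_prod (\<lambda>k. g * real k) (\<lambda>k. g * (real n - real k)) (n - 1)"
proof -
  define N where "N k = (if k \<in> {2..n} then beta_distribution (g * (real n - real k + 1)) (g * (real k - 1)) else beta_distribution 1 1)" for k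
  have N: "prob_space (N k)" for k
    unfolding N_def using g by (auto intro!: prob_space_beta_distribution)
  have Nk: "N k = beta_distribution (g * (real n - real k + 1)) (g * (real k - 1))" if "k \<in> {2..n}" for k
    using that by (simp add: N_def)
  have sN [measurable_cong]: "sets (N k) = sets borel" for k by (simp add: N_def)
  let ?P = "\<Pi>\<^sub>M k\<in>{2..n}. N k"
  interpret product_prob_space N "{2..n}"
    by (rule product_prob_spaceI) (rule N)
  have det: "gram_det (2 * g) n = distr ?P borel (\<lambda>r. \<Prod>k\<in>{2..n}. r k)"
    unfolding gram_det_def by (intro distr_cong PiM_cong) (auto simp: N_def)
  have AEk: "AE r in ?P. 0 < r k \<and> r k < 1" if "k \<in> {2..n}" for k
  proof -
    have "AE y in N k. 0 < y \<and> y < 1" unfolding Nk[OF that] by (rule AE_beta_distribution)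
    then show ?thesis
      by (intro AE_PiM_component[where I = "{2..n}" and M = N and i = k and P = "\<lambda>y. 0 < y \<and> y < 1"] N that)
  qed
  then have AE: "AE r in ?P. \<forall>k\<in>{2..n}. 0 < r k \<and> r k < 1" by (intro AE_finite_allI) auto
  have [measurable]: "(\<lambda>r. \<Prod>k\<in>{2..n}. r k) \<in> borel_measurable ?P" by measurable
  have intk: "integrable (N k) (\<lambda>x. x ^ p)" if "k \<in> {2..n}" for k p
  proof -
    show ?thesis
    proof (rule finite_measure.integrable_const_bound[OF prob_space.axioms(1)[OF N], where B = 1])
      have "AE x in N k. 0 < x \<and> x < 1" unfolding Nk[OF that] by (rule AE_beta_distribution)
      then show "AE x in N k. norm (x ^ p) \<le> 1" by eventually_elim (auto simp: power_le_one)
    qed measurable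
  qed
  have par: "g * real k > 0 \<and> g * (real n - real k) > 0" if "k \<in> {1..n - 1}" for k
    using that g n by auto
  show ?thesis
  proof (rule moments_determine)
    show "real_distribution (gram_det (2 * g) n)" unfolding det by (rule real_distribution_distr) measurable
    interpret W: prob_space "beta_prod (\<lambda>k. g * real k) (\<lambda>k. g * (real n - real k)) (n - 1)"
      by (rule prob_space_beta_prod) (rule par)
    show "real_distribution (beta_prod (\<lambda>k. g * real k) (\<lambda>k. g * (real n - real k)) (n - 1))"
      by unfold_locales auto
    show "AE x in gram_det (2 * g) n. 0 \<le> x \<and> x \<le> 1"
      unfolding det
    proof (subst AE_distr_iff)
      show "AE r in ?P. 0 \<le> (\<Prod>k\<in>{2..n}. r k) \<and> (\<Prod>k\<in>{2..n}. r k) \<le> 1"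
        using AE by eventually_elim (auto intro!: prod_nonneg prod_le_1 simp: less_imp_le)
    qed auto
    have "AE x in beta_prod (\<lambda>k. g * real k) (\<lambda>k. g * (real n - real k)) (n - 1). 0 < x \<and> x \<le> 1"
      by (rule AE_beta_prod) (rule par)
    then show "AE x in beta_prod (\<lambda>k. g * real k) (\<lambda>k. g * (real n - real k)) (n - 1). 0 \<le> x \<and> x \<le> 1"
      by eventually_elim auto
    fix p
    have "(\<integral>x. x ^ p \<partial>gram_det (2 * g) n) = (\<integral>r. (\<Prod>k\<in>{2..n}. r k ^ p) \<partial>?P)"
      unfolding det by (subst integral_distr) (auto simp: prod_power_distrib)
    also have "\<dots> = (\<Prod>k\<in>{2..n}. \<integral>x. x ^ p \<partial>N k)"
      by (rule product_integral_prod) (auto intro: intk)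
    also have "\<dots> = (\<Prod>k\<in>{2..n}. \<integral>x. x ^ p \<partial>beta_distribution (g * (real n - real k + 1)) (g * (real k - 1)))"
      by (intro prod.cong) (auto simp: N_def)
    also have "\<dots> = (\<Prod>k\<in>{1..n - 1}. \<integral>x. x ^ p \<partial>beta_distribution (g * real k) (g * (real n - real k)))"
      by (rule prod.reindex_bij_witness[where i = "\<lambda>k. n + 1 - k" and j = "\<lambda>k. n + 1 - k"])
        (auto simp: of_nat_diff add_diff_eq add.commute)
    also have "\<dots> = (\<integral>x. x ^ p \<partial>beta_prod (\<lambda>k. g * real k) (\<lambda>k. g * (real n - real k)) (n - 1))"
      by (rule beta_prod_moment[symmetric]) (rule par)
    finally show "(\<integral>x. x ^ p \<partial>gram_det (2 * g) n) = (\<integral>x. x ^ p \<partial>beta_prod (\<lambda>k. g * real k) (\<lambda>k. g * (real n - real k)) (n - 1))" .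
  qed
qed

text \<open>The means multiply to \<open>n! / n ^ n\<close>.\<close>

theorem gram_kolmogorov:
  assumes g: "g > 0"
  shows "\<exists>K\<ge>0. \<forall>n\<ge>2. \<forall>x. \<bar>cdf (rescaled_log_law (2 * g) n (mu_G (2 * g) n) (gram_det (2 * g) n)) x - Phi x\<bar>
    \<le> K * sqrt (g / ln (real n))"
proof -
  define E where "E = 2 / g + 2"
  have E: "E \<ge> 0" using g by (simp add: E_def)
  obtain K where K: "K \<ge> 0" and kol: "\<And>n m b u x. kolmogorov_regime g E n m b u \<Longrightarrow>
    \<bar>measure (beta_prod (\<lambda>k. g * real k) b m) {z. (ln z - u) * sqrt (g / ln (real n)) \<le> x} - Phi x\<bar>
      \<le> K * sqrt (g / ln (real n))"
    using beta_prod_kolmogorov[OF g E] by blast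
  have "\<bar>cdf (rescaled_log_law (2 * g) n (mu_G (2 * g) n) (gram_det (2 * g) n)) x - Phi x\<bar>
    \<le> K * sqrt (g / ln (real n))" if n: "n \<ge> 2" for n x
  proof -
    let ?b = "\<lambda>k. g * (real n - real k)"
    have b: "?b k > 0" if "k \<in> {1..n - 1}" for k using that g n by auto
    have v: "\<bar>beta_var g ?b (n - 1) - ln (real n) / g\<bar> \<le> 2 / g"
    proof -
      have "\<bar>beta_var g ?b (n - 1) - ln (real (n - 1)) / g\<bar> \<le> 1 / g"
        using g n by (intro beta_var_harmonic) (auto simp: algebra_simps)
      moreover have "0 \<le> ln (real n) - ln (real (n - 1))" "ln (real n) - ln (real (n - 1)) \<le> 1"
      proof -
        show "0 \<le> ln (real n) - ln (real (n - 1))" using n by simp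
        have "ln (real (n - 1) + 1) - ln (real (n - 1)) < 1 / real (n - 1)"
          using n by (intro ln_diff_le_inverse) auto
        also have "\<dots> \<le> 1" using n by simp
        finally show "ln (real n) - ln (real (n - 1)) \<le> 1" using n by (simp add: of_nat_diff)
      qed
      then have "0 \<le> ln (real n) / g - ln (real (n - 1)) / g" "ln (real n) / g - ln (real (n - 1)) / g \<le> 1 / g"
        using g by (simp_all add: diff_divide_distrib[symmetric] divide_right_mono)
      ultimately show ?thesis by linarith
    qed
    have c: "\<bar>mu_G (2 * g) n - beta_center g ?b (n - 1)\<bar> \<le> E"
    proof -
      have "(\<Sum>k\<in>{1..n - 1}. ln (g * real k) - ln (g * real k + ?b k)) = (\<Sum>k\<in>{1..n - 1}. ln (real k) - ln (real n))"
        using g n by (intro sum.cong) (auto simp: ln_mult algebra_simps)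
      also have "\<dots> = (\<Sum>k\<in>{1..n}. ln (real k) - ln (real n))"
        using n by (cases n) auto
      also have "\<dots> = ln (fact n) - real n * ln (real n)" unfolding sum_subtractf sum_ln_upto by simp
      finally have ce: "beta_center g ?b (n - 1) = ln (fact n) - real n * ln (real n) - beta_var g ?b (n - 1) / 2"
        using beta_center_eq[OF g b] by simp
      have st: "\<bar>ln (fact n) - (real n * ln (real n) - real n + ln (real n) / 2)\<bar> \<le> 1"
        using n by (intro stirling_bounded) auto
      have mu: "mu_G (2 * g) n = ln (real n) / 2 - (ln (real n) / g) / 2 - real n + (1 / g) / 2"
        by (simp add: mu_G_def algebra_simps)
      define q where "q = ln (real n) / g"
      define r where "r = 1 / g"
      have r: "2 / g = 2 * r" "r > 0" using g by (auto simp: r_def)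
      show ?thesis using st v r(2) unfolding ce mu E_def r(1) q_def[symmetric] r_def[symmetric] by linarith
    qed
    have "\<bar>measure (beta_prod (\<lambda>k. g * real k) ?b (n - 1)) {z. (ln z - mu_G (2 * g) n) * sqrt (g / ln (real n)) \<le> x} - Phi x\<bar>
      \<le> K * sqrt (g / ln (real n))"
      using n v b c by (intro kol) (auto simp: kolmogorov_regime_def E_def)
    then show ?thesis unfolding gram_law[OF g n] by (subst cdf_rescaled) auto
  qed
  then show ?thesis using K by blast
qed

text \<open>With \<open>m\<close> and \<open>M\<close> the smaller and the larger dimension, the density is that of \<open>selberg_law\<close> for \<open>a = g\<close> and
  \<open>b = g * (M - m + 1)\<close>, and \<open>b + g * (m - 1) = g * M\<close>.\<close>

lemma jacobi_law:
  assumes g: "g > 0" and n: "n1 \<ge> 1" "n2 \<ge> 1"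
  shows "distr (jacobi_ensemble (2 * g) n1 n2) borel (\<lambda>x. \<Prod>k\<in>{1..min n1 n2}. x k)
    = beta_prod (\<lambda>k. g * real k) (\<lambda>_. g * real (max n1 n2)) (min n1 n2)"
proof -
  define m where "m = min n1 n2"
  define M where "M = max n1 n2"
  have mM: "m \<ge> 1" "m \<le> M" using n by (auto simp: m_def M_def)
  define b where "b = g * (real M - real m + 1)"
  have b: "b > 0" using g mM by (simp add: b_def)
  have "distr (jacobi_ensemble (2 * g) n1 n2) borel (\<lambda>x. \<Prod>k\<in>{1..m}. x k)
    = distr (proportional_density (\<Pi>\<^sub>M k\<in>{1..m}. lborel)
           (\<lambda>x. vandermonde_abs m x powr (2 * g) * (\<Prod>k\<in>{1..m}. indicator {0<..<1} (x k) * x k powr (g - 1) * (1 - x k / 1) powr (b - 1)))) borel (\<lambda>x. \<Prod>k\<in>{1..m}. x k)"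
    unfolding jacobi_ensemble_def Let_def m_def[symmetric] M_def[symmetric] b_def by simp
  also have "\<dots> = distr (beta_prod (\<lambda>k. g + g * (real k - 1)) (\<lambda>_. b + g * (real m - 1)) m) borel (\<lambda>u. 1 ^ m * u)"
    by (rule selberg_law) (use g b in auto)
  also have "(\<lambda>k. g + g * (real k - 1)) = (\<lambda>k. g * real k)" by (auto simp: algebra_simps)
  also have "b + g * (real m - 1) = g * real M" by (simp add: b_def algebra_simps)
  also have "distr (beta_prod (\<lambda>k. g * real k) (\<lambda>_. g * real M) m) borel (\<lambda>u. 1 ^ m * u) = beta_prod (\<lambda>k. g * real k) (\<lambda>_. g * real M) m"
    by (simp add: distr_id2)
  finally show ?thesis by (simp add: m_def M_def)
qed

lemma nfloor_ln:
  assumes t: "t > 0" and n: "n \<ge> 2" and f: "nfloor n t \<ge> 1"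
  shows "\<bar>ln (real (nfloor n t)) - ln (real n)\<bar> \<le> ln 2 + \<bar>ln t\<bar>"
    "real (nfloor n t) \<le> real n * t" "real n * t \<le> 2 * real (nfloor n t)"
proof -
  have nt: "real n * t > 0" using t n by simp
  have fl: "real (nfloor n t) = of_int \<lfloor>real n * t\<rfloor>" using nt by (simp add: nfloor_def)
  show up: "real (nfloor n t) \<le> real n * t" unfolding fl by linarith
  have "real n * t < real (nfloor n t) + 1" unfolding fl by linarith
  then show lo: "real n * t \<le> 2 * real (nfloor n t)" using f by linarith
  have "ln (real (nfloor n t)) \<le> ln (real n * t)" using up f by simp
  moreover have "ln (real n * t) \<le> ln (2 * real (nfloor n t))" using lo nt by simp
  moreover have "ln (real n * t) = ln (real n) + ln t" using n t by (simp add: ln_mult)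
  moreover have "ln (2 * real (nfloor n t)) = ln 2 + ln (real (nfloor n t))" using f by (simp add: ln_mult)
  moreover have "ln 2 > (0::real)" by simp
  ultimately show "\<bar>ln (real (nfloor n t)) - ln (real n)\<bar> \<le> ln 2 + \<bar>ln t\<bar>" by linarith
qed

text \<open>The means \<open>k / (M + k)\<close> multiply to \<open>m! M! / (M + m)!\<close>. By Stirling's formula the leading terms combine to the two
  \<open>eps\<close> terms of the centering, which are symmetric in the two dimensions; the logarithms of \<open>m\<close>, \<open>M\<close> and
  \<open>M + m\<close> all differ from \<open>ln n\<close> by a bounded amount.\<close>

theorem jacobi_kolmogorov:
  assumes g: "g > 0" and t: "t1 > 0" "t2 > 0"
  shows "\<exists>K\<ge>0. \<forall>n\<ge>2. \<forall>x. nfloor n t1 \<ge> 1 \<and> nfloor n t2 \<ge> 1 \<longrightarrow>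
    \<bar>cdf (rescaled_log_law (2 * g) n (mu_J (2 * g) t1 t2 n) (jacobi_det (2 * g) t1 t2 n)) x - Phi x\<bar>
    \<le> K * sqrt (g / ln (real n))"
proof -
  define D where "D = ln 2 + \<bar>ln t1\<bar> + \<bar>ln t2\<bar> + \<bar>ln (t1 + t2)\<bar>"
  have D: "D \<ge> 0" by (simp add: D_def)
  define c0 where "c0 = (1 / 2 - 1 / (2 * g)) * ln (t1 * t2 / (t1 + t2))"
  define E where "E = (1 + D) / g + \<bar>c0\<bar> + 3 + 2 * D"
  have E: "E \<ge> 0" using g D by (simp add: E_def)
  obtain K where K: "K \<ge> 0" and kol: "\<And>n m b u x. kolmogorov_regime g E n m b u \<Longrightarrow>
    \<bar>measure (beta_prod (\<lambda>k. g * real k) b m) {z. (ln z - u) * sqrt (g / ln (real n)) \<le> x} - Phi x\<bar>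
      \<le> K * sqrt (g / ln (real n))"
    using beta_prod_kolmogorov[OF g E] by blast
  have "\<bar>cdf (rescaled_log_law (2 * g) n (mu_J (2 * g) t1 t2 n) (jacobi_det (2 * g) t1 t2 n)) x - Phi x\<bar>
    \<le> K * sqrt (g / ln (real n))" if n: "n \<ge> 2" and f: "nfloor n t1 \<ge> 1" "nfloor n t2 \<ge> 1" for n x
  proof -
    define n1 where "n1 = nfloor n t1"
    define n2 where "n2 = nfloor n t2"
    define m where "m = min n1 n2"
    define M where "M = max n1 n2"
    have p: "n1 \<ge> 1" "n2 \<ge> 1" "m \<ge> 1" "M \<ge> 1" "m \<le> M" using f by (auto simp: n1_def n2_def m_def M_def)
    note f1 = nfloor_ln[OF t(1) n f(1), folded n1_def]
    note f2 = nfloor_ln[OF t(2) n f(2), folded n2_def]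
    let ?b = "\<lambda>_::nat. g * real M"
    have b: "?b k > 0" if "k \<in> {1..m}" for k using g p by simp
    have lm: "\<bar>ln (real m) - ln (real n)\<bar> \<le> D" "\<bar>ln (real M) - ln (real n)\<bar> \<le> D"
      using f1(1) f2(1) by (auto simp: D_def m_def M_def min_def max_def)
    have lmM: "\<bar>ln (real (m + M)) - ln (real n)\<bar> \<le> D"
    proof -
      have mM: "m + M = n1 + n2" by (simp add: m_def M_def)
      have up: "real (n1 + n2) \<le> real n * (t1 + t2)" using f1(2) f2(2) by (simp add: distrib_left)
      have lo: "real n * (t1 + t2) \<le> 2 * real (n1 + n2)" using f1(3) f2(3) by (simp add: distrib_left)
      have pos: "real n * (t1 + t2) > 0" "real (n1 + n2) > 0" using n t p by auto
      have "ln (real (n1 + n2)) \<le> ln (real n * (t1 + t2))" using up pos by (subst ln_le_cancel_iff) auto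
      moreover have "ln (real n * (t1 + t2)) \<le> ln (2 * real (n1 + n2))" using lo pos by (subst ln_le_cancel_iff) auto
      moreover have "ln (real n * (t1 + t2)) = ln (real n) + ln (t1 + t2)" using n t by (simp add: ln_mult)
      moreover have "ln (2 * real (n1 + n2)) = ln 2 + ln (real (n1 + n2))" using pos by (subst ln_mult) auto
      moreover have "ln 2 > (0::real)" by simp
      ultimately show ?thesis unfolding mM D_def by linarith
    qed
    have v: "\<bar>beta_var g ?b m - ln (real n) / g\<bar> \<le> (1 + D) / g"
    proof -
      have "\<bar>beta_var g ?b m - ln (real m) / g\<bar> \<le> 1 / g"
      proof (rule beta_var_harmonic[OF g p(3)])
        fix k :: nat assume "k \<in> {1..m}"
        have "g * real m \<le> g * real M" using g p by simp
        also have "\<dots> \<le> g * real k + g * real M" using g by simp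
        finally show "g * real m \<le> g * real k + g * real M" .
      qed
      moreover have "\<bar>ln (real m) / g - ln (real n) / g\<bar> \<le> D / g"
        using lm(1) g by (simp add: diff_divide_distrib[symmetric] divide_right_mono)
      ultimately show ?thesis unfolding add_divide_distrib by linarith
    qed
    have c: "\<bar>mu_J (2 * g) t1 t2 n - beta_center g ?b m\<bar> \<le> E"
    proof -
      have "(\<Sum>k\<in>{1..m}. ln (g * real k) - ln (g * real k + ?b k)) = (\<Sum>k\<in>{1..m}. ln (real k) - ln (real (M + k)))"
      proof (rule sum.cong)
        fix k assume k: "k \<in> {1..m}"
        have "g * real k + g * real M = g * real (M + k)" by (simp add: algebra_simps)
        moreover have "real (M + k) > 0" "real k > 0" using k by auto
        ultimately show "ln (g * real k) - ln (g * real k + g * real M) = ln (real k) - ln (real (M + k))"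
          using g ln_mult[of g "real k"] ln_mult[of g "real (M + k)"] by (simp only:) simp
      qed simp
      also have "\<dots> = ln (fact m) + ln (fact M) - ln (fact (M + m))"
      proof -
        have "ln (fact M) + (\<Sum>k\<in>{1..m}. ln (real (M + k))) = ln (fact (M + m))"
          by (induction m) (auto simp: ln_mult add_ac)
        then show ?thesis unfolding sum_subtractf sum_ln_upto by simp
      qed
      finally have ce: "beta_center g ?b m = ln (fact m) + ln (fact M) - ln (fact (M + m)) - beta_var g ?b m / 2"
        using beta_center_eq[OF g b] by simp
      have st: "\<bar>ln (fact m) - (real m * ln (real m) - real m + ln (real m) / 2)\<bar> \<le> 1"
        "\<bar>ln (fact M) - (real M * ln (real M) - real M + ln (real M) / 2)\<bar> \<le> 1"
        "\<bar>ln (fact (M + m)) - (real (M + m) * ln (real (M + m)) - real (M + m) + ln (real (M + m)) / 2)\<bar> \<le> 1"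
        using p by (intro stirling_bounded; simp)+
      have ep: "eps (real i) (real j) = real i * ln (real (i + j)) - real i * ln (real i)" if "i \<ge> 1" for i j :: nat
      proof -
        have "1 + real j / real i = real (i + j) / real i" using that by (simp add: field_simps)
        then have "ln (1 + real j / real i) = ln (real (i + j)) - ln (real i)"
          using that by (simp only:) (subst ln_div, auto)
        then show ?thesis unfolding eps_def by (simp only: right_diff_distrib)
      qed
      have "eps (real n1) (real n2) + eps (real n2) (real n1) = eps (real m) (real M) + eps (real M) (real m)"
        by (auto simp: m_def M_def min_def max_def)
      also have "\<dots> = real (M + m) * ln (real (M + m)) - real m * ln (real m) - real M * ln (real M)"
        unfolding ep[OF p(3)] ep[OF p(4)] by (simp add: add.commute algebra_simps)
      finally have ee: "eps (real n1) (real n2) + eps (real n2) (real n1) = real (M + m) * ln (real (M + m)) - real m * ln (real m) - real M * ln (real M)" .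
      have mu: "mu_J (2 * g) t1 t2 n = ln (real n) / 2 - (ln (real n) / g) / 2 + c0
        - (real (M + m) * ln (real (M + m)) - real m * ln (real m) - real M * ln (real M))"
        unfolding mu_J_def n1_def[symmetric] n2_def[symmetric] c0_def ee[symmetric]
        by (simp add: algebra_simps)
      have mM: "real (M + m) = real M + real m" by simp
      have mM': "m + M = M + m" by simp
      define q where "q = ln (real n) / g"
      define r where "r = (1 + D) / g"
      define P where "P = real (M + m) * ln (real (M + m))"
      define P1 where "P1 = real m * ln (real m)"
      define P2 where "P2 = real M * ln (real M)"
      show ?thesis
        using st v lm lmM D abs_ge_self[of c0] abs_ge_minus_self[of c0]
        unfolding ce mu E_def q_def[symmetric] r_def[symmetric] mM' P_def[symmetric] P1_def[symmetric] P2_def[symmetric] mM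
        by linarith
    qed
    have "\<bar>measure (beta_prod (\<lambda>k. g * real k) ?b m) {z. (ln z - mu_J (2 * g) t1 t2 n) * sqrt (g / ln (real n)) \<le> x} - Phi x\<bar>
      \<le> K * sqrt (g / ln (real n))"
      using n v b c D by (intro kol) (auto simp: kolmogorov_regime_def E_def)
    moreover have "jacobi_det (2 * g) t1 t2 n = beta_prod (\<lambda>k. g * real k) ?b m"
      unfolding jacobi_det_def n1_def[symmetric] n2_def[symmetric] m_def M_def
      by (rule jacobi_law[OF g p(1,2)])
    ultimately show ?thesis by (subst cdf_rescaled) auto
  qed
  then show ?thesis using K by blast
qed

section \<open>The Laguerre ensemble as a limit of Jacobi ensembles\<close>

lemma gamma_density_integrable:
  fixes s :: real
  assumes s: "s > 0"
  shows "integrable lborel (\<lambda>y. indicator {0<..} y * y powr (s - 1) * exp (- y / 2))"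
proof -
  define f where "f t = indicator {0..} t * t powr (s - 1) / exp t" for t :: real
  have [measurable]: "f \<in> borel_measurable borel" unfolding f_def[abs_def] by measurable
  have "(\<integral>\<^sup>+t. ennreal (f t) \<partial>lborel) = ennreal (Gamma s)"
    using Gamma_conv_nn_integral_real[OF s] by (simp add: f_def)
  then have "integrable lborel f"
    by (intro integrableI_nonneg) (auto simp: f_def)
  from lborel_integrable_real_affine[OF this, of "1 / 2" 0]
  have int: "integrable lborel (\<lambda>x. 2 powr (s - 1) * f (x / 2))" by simp
  have *: "2 powr (s - 1) * f (y / 2) = indicator {0<..} y * y powr (s - 1) * exp (- y / 2)" if "y \<noteq> 0" for y
    using that by (auto simp: f_def indicator_def powr_divide exp_minus field_simps)
  have "AE y in lborel. 2 powr (s - 1) * f (y / 2) = indicator {0<..} y * y powr (s - 1) * exp (- y / 2)"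
    using AE_lborel_singleton[of 0] by eventually_elim (rule *)
  with int show ?thesis
    by (subst (asm) integrable_cong_AE[of _ lborel "\<lambda>y. indicator {0<..} y * y powr (s - 1) * exp (- y / 2)"]) measurable
qed

definition laguerre_weight :: "real \<Rightarrow> real \<Rightarrow> real" where
  "laguerre_weight g y = indicator {0<..} y * y powr (g - 1) * exp (- y / 2)"

text \<open>The weight of a Jacobi ensemble with \<open>b = N / 2 + 1\<close>, stretched to \<open>{0<..<N}\<close>; it converges to the Laguerre
  weight and never exceeds it.\<close>

definition truncated_weight :: "real \<Rightarrow> nat \<Rightarrow> real \<Rightarrow> real" where
  "truncated_weight g N y = indicator {0<..<real N} y * y powr (g - 1) * (1 - y / real N) powr (real N / 2)"

lemma truncated_weight_le:
  "0 \<le> truncated_weight g N y" "truncated_weight g N y \<le> laguerre_weight g y"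
proof -
  show "0 \<le> truncated_weight g N y" by (simp add: truncated_weight_def)
  show "truncated_weight g N y \<le> laguerre_weight g y"
  proof (cases "0 < y \<and> y < real N")
    case True
    have "1 - y / real N \<le> exp (- (y / real N))" using exp_ge_add_one_self[of "- (y / real N)"] by simp
    then have "(1 - y / real N) powr (real N / 2) \<le> exp (- (y / real N)) powr (real N / 2)"
      using True by (intro powr_mono2) auto
    also have "\<dots> = exp (- y / 2)" using True by (simp add: powr_def)
    finally show ?thesis
      using True by (simp add: truncated_weight_def laguerre_weight_def mult_left_mono)
  next
    case False
    then have "truncated_weight g N y = 0" by (auto simp: truncated_weight_def)
    then show ?thesis by (simp add: laguerre_weight_def)
  qed
qed

lemma truncated_weight_tendsto: "(\<lambda>N. truncated_weight g N y) \<longlonglongrightarrow> laguerre_weight g y"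
proof (cases "y > 0")
  case False
  then show ?thesis by (simp add: truncated_weight_def laguerre_weight_def)
next
  case True
  have "(\<lambda>N. ((1 + (- y) / real N) ^ N) powr (1 / 2)) \<longlonglongrightarrow> exp (- y) powr (1 / 2)"
    by (intro tendsto_powr tendsto_exp_limit_sequentially tendsto_const) auto
  also have "exp (- y) powr (1 / 2) = exp (- y / 2)" by (simp add: powr_def)
  finally have 1: "(\<lambda>N. y powr (g - 1) * ((1 + (- y) / real N) ^ N) powr (1 / 2)) \<longlonglongrightarrow> y powr (g - 1) * exp (- y / 2)"
    by (intro tendsto_mult tendsto_const)
  obtain M :: nat where M: "real M > y" using reals_Archimedean2 by blast
  have "\<forall>\<^sub>F N in sequentially. y powr (g - 1) * ((1 + (- y) / real N) ^ N) powr (1 / 2) = truncated_weight g N y"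
    using eventually_ge_at_top[of M]
  proof eventually_elim
    case (elim N)
    have N: "y < real N" using elim M by (meson of_nat_le_iff order_less_le_trans)
    then have p: "1 + (- y) / real N > 0" using True by (simp add: field_simps)
    have "((1 + (- y) / real N) ^ N) powr (1 / 2) = (1 + (- y) / real N) powr (real N / 2)"
      using p by (simp add: powr_realpow[symmetric] powr_powr)
    then show ?case using N True by (simp add: truncated_weight_def)
  qed
  from Lim_transform_eventually[OF 1 this] show ?thesis using True by (simp add: laguerre_weight_def)
qed

lemma laguerre_weight_measurable [measurable]: "laguerre_weight g \<in> borel_measurable borel"
  unfolding laguerre_weight_def[abs_def] by measurable

lemma truncated_weight_measurable [measurable]: "truncated_weight g N \<in> borel_measurable borel"
  unfolding truncated_weight_def[abs_def] by measurable

abbreviation lborel_n :: "nat \<Rightarrow> (nat \<Rightarrow> real) measure" where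
  "lborel_n n \<equiv> (\<Pi>\<^sub>M k\<in>{1..n}. lborel)"

definition laguerre_density :: "real \<Rightarrow> nat \<Rightarrow> (nat \<Rightarrow> real) \<Rightarrow> real" where
  "laguerre_density g n x = vandermonde_abs n x powr (2 * g) * (\<Prod>k\<in>{1..n}. laguerre_weight g (x k))"

definition truncated_density :: "real \<Rightarrow> nat \<Rightarrow> nat \<Rightarrow> (nat \<Rightarrow> real) \<Rightarrow> real" where
  "truncated_density g n N x = vandermonde_abs n x powr (2 * g) * (\<Prod>k\<in>{1..n}. truncated_weight g N (x k))"

lemma vandermonde_measurable [measurable]:
  "(\<lambda>x. vandermonde_abs n x powr (2 * g)) \<in> borel_measurable (lborel_n n)"
proof -
  have "sets (lborel_n n) = sets (\<Pi>\<^sub>M k\<in>{1..n}. borel)" by (intro sets_PiM_cong) auto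
  then show ?thesis
    using reg_vandermonde_measurable[of "{1..n}" g 0]
    unfolding reg_vandermonde_eq[symmetric] by (simp cong: measurable_cong_sets)
qed

lemma laguerre_density_measurable [measurable]: "laguerre_density g n \<in> borel_measurable (lborel_n n)"
  unfolding laguerre_density_def[abs_def] by measurable

lemma truncated_density_measurable [measurable]: "truncated_density g n N \<in> borel_measurable (lborel_n n)"
  unfolding truncated_density_def[abs_def] by measurable

lemma laguerre_weight_nonneg: "0 \<le> laguerre_weight g y"
  by (simp add: laguerre_weight_def)

lemma truncated_density_le:
  "0 \<le> truncated_density g n N x" "truncated_density g n N x \<le> laguerre_density g n x"
  unfolding truncated_density_def laguerre_density_def
  by (auto intro!: mult_nonneg_nonneg prod_nonneg mult_left_mono prod_mono truncated_weight_le)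

lemma laguerre_density_nonneg: "0 \<le> laguerre_density g n x"
  using truncated_density_le order_trans by blast

lemma truncated_density_tendsto: "(\<lambda>N. truncated_density g n N x) \<longlonglongrightarrow> laguerre_density g n x"
  unfolding truncated_density_def laguerre_density_def
  by (intro tendsto_mult tendsto_const tendsto_prod truncated_weight_tendsto)

text \<open>Every difference is at most the product \<open>R\<close> of all \<open>1 + x k\<close>, and there are at most \<open>n * n\<close> of them. A
  bound in product form reduces integrability to one dimension.\<close>

lemma vandermonde_growth:
  assumes x: "\<And>k. k \<in> {1..n} \<Longrightarrow> x k > 0"
  shows "vandermonde_abs n x \<le> (\<Prod>k\<in>{1..n}. 1 + x k) ^ (n * n)"
proof -
  define R where "R = (\<Prod>k\<in>{1..n}. 1 + x k)"
  have xR: "x k \<le> R" if k: "k \<in> {1..n}" for k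
  proof -
    have "R = (1 + x k) * (\<Prod>i\<in>{1..n} - {k}. 1 + x i)" unfolding R_def using k by (subst prod.remove) auto
    moreover have "1 \<le> (\<Prod>i\<in>{1..n} - {k}. 1 + x i)" using x by (intro prod_ge_1) (auto simp: less_imp_le)
    ultimately have "(1 + x k) * 1 \<le> R" using x[OF k] by (simp add: mult_left_mono)
    then show ?thesis by simp
  qed
  have R1: "1 \<le> R" unfolding R_def using x by (intro prod_ge_1) (auto simp: less_imp_le)
  have "vandermonde_abs n x \<le> (\<Prod>k\<in>{1..n}. \<Prod>j\<in>{1..<k}. R)"
    unfolding vandermonde_abs_def
  proof (intro prod_mono conjI prod_nonneg abs_ge_zero)
    fix k j assume kj: "k \<in> {1..n}" "j \<in> {1..<k}"
    then have "j \<in> {1..n}" by auto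
    then show "\<bar>x k - x j\<bar> \<le> R" using kj xR[of k] xR[of j] x[of k] x[of j] by (auto simp: abs_le_iff)
  qed
  also have "\<dots> \<le> (\<Prod>k\<in>{1..n}. R ^ n)"
    using R1 by (intro prod_mono) (auto intro: power_increasing)
  also have "\<dots> = R ^ (n * n)" by (simp add: power_mult)
  finally show ?thesis by (simp add: R_def)
qed

text \<open>The factor \<open>(1 + y) powr q\<close> that bounds the Vandermonde term is at most \<open>2 powr q * (1 + y powr q)\<close>, so a sum of
  two Gamma densities dominates each coordinate.\<close>

lemma laguerre_density_integrable:
  assumes g: "g > 0"
  shows "integrable (lborel_n n) (laguerre_density g n)"
proof -
  interpret product_sigma_finite "\<lambda>_::nat. lborel :: real measure"
    by (intro product_sigma_finite.intro lborel.sigma_finite_measure_axioms)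
  define q where "q = real (n * n) * (2 * g)"
  have q: "q \<ge> 0" using g by (simp add: q_def)
  define h where "h y = (1 + y) powr q * laguerre_weight g y" for y
  have ih: "integrable lborel h"
  proof (rule Bochner_Integration.integrable_bound)
    have "integrable lborel (\<lambda>y. 2 powr q * (indicator {0<..} y * y powr (g - 1) * exp (- y / 2) + indicator {0<..} y * y powr (g + q - 1) * exp (- y / 2)))"
      using g q by (intro integrable_mult_right Bochner_Integration.integrable_add gamma_density_integrable) auto
    then show "integrable lborel (\<lambda>y. 2 powr q * (laguerre_weight g y + laguerre_weight (g + q) y))"
      by (simp add: laguerre_weight_def)
    show "h \<in> borel_measurable lborel" unfolding h_def by measurable
    show "AE y in lborel. norm (h y) \<le> norm (2 powr q * (laguerre_weight g y + laguerre_weight (g + q) y))"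
    proof (rule AE_I2)
      fix y :: real
      have "h y \<le> 2 powr q * (laguerre_weight g y + laguerre_weight (g + q) y)"
      proof (cases "y > 0")
        case True
        have "(1 + y) powr q \<le> 2 powr q * (1 + y powr q)"
        proof (cases "y \<le> 1")
          case True
          have "(1 + y) powr q \<le> 2 powr q" using True \<open>y > 0\<close> q by (intro powr_mono2) auto
          also have "\<dots> \<le> 2 powr q * (1 + y powr q)" by simp
          finally show ?thesis .
        next
          case False
          have "(1 + y) powr q \<le> (2 * y) powr q" using False q by (intro powr_mono2) auto
          also have "\<dots> = 2 powr q * y powr q" using False by (simp add: powr_mult)
          also have "\<dots> \<le> 2 powr q * (1 + y powr q)" by simp
          finally show ?thesis .
        qed
        then have "h y \<le> 2 powr q * (1 + y powr q) * laguerre_weight g y"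
          unfolding h_def by (intro mult_right_mono laguerre_weight_nonneg)
        also have "\<dots> = 2 powr q * (laguerre_weight g y + y powr q * laguerre_weight g y)" by (simp add: algebra_simps)
        also have "y powr q * laguerre_weight g y = laguerre_weight (g + q) y"
        proof -
          have "y powr (g + q - 1) = y powr q * y powr (g - 1)" by (simp add: powr_add[symmetric] algebra_simps)
          then show ?thesis by (simp add: laguerre_weight_def)
        qed
        finally show ?thesis .
      qed (simp add: h_def laguerre_weight_def)
      moreover have "0 \<le> h y" by (simp add: h_def laguerre_weight_nonneg)
      ultimately show "norm (h y) \<le> norm (2 powr q * (laguerre_weight g y + laguerre_weight (g + q) y))" by simp
    qed
  qed
  show ?thesis
  proof (rule Bochner_Integration.integrable_bound)
    show "integrable (lborel_n n) (\<lambda>x. \<Prod>k\<in>{1..n}. h (x k))"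
      by (rule product_integrable_prod) (auto intro: ih)
    show "AE x in lborel_n n. norm (laguerre_density g n x) \<le> norm (\<Prod>k\<in>{1..n}. h (x k))"
    proof (rule AE_I2)
      fix x :: "nat \<Rightarrow> real"
      have "laguerre_density g n x \<le> (\<Prod>k\<in>{1..n}. h (x k))"
      proof (cases "\<forall>k\<in>{1..n}. x k > 0")
        case True
        have R0: "(\<Prod>k\<in>{1..n}. 1 + x k) > 0" using True by (intro prod_pos) (auto intro: add_pos_pos)
        have V0: "0 \<le> vandermonde_abs n x" unfolding vandermonde_abs_def by (intro prod_nonneg) auto
        have "vandermonde_abs n x powr (2 * g) \<le> ((\<Prod>k\<in>{1..n}. 1 + x k) ^ (n * n)) powr (2 * g)"
          using True g V0 by (intro powr_mono2 vandermonde_growth) auto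
        also have "\<dots> = (\<Prod>k\<in>{1..n}. 1 + x k) powr q"
          using R0 by (simp add: powr_realpow[symmetric] powr_powr q_def)
        also have "\<dots> = (\<Prod>k\<in>{1..n}. (1 + x k) powr q)" by (simp add: prod_powr_distrib)
        finally have "laguerre_density g n x \<le> (\<Prod>k\<in>{1..n}. (1 + x k) powr q) * (\<Prod>k\<in>{1..n}. laguerre_weight g (x k))"
          unfolding laguerre_density_def by (intro mult_right_mono prod_nonneg) (auto simp: laguerre_weight_nonneg)
        then show ?thesis by (simp add: h_def prod.distrib)
      next
        case False
        then obtain k where k: "k \<in> {1..n}" "\<not> x k > 0" by auto
        then have "laguerre_weight g (x k) = 0" by (simp add: laguerre_weight_def)
        then have "(\<Prod>k\<in>{1..n}. laguerre_weight g (x k)) = 0" using k by (intro prod_zero) auto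
        then have "laguerre_density g n x = 0" by (simp add: laguerre_density_def)
        moreover have "0 \<le> (\<Prod>k\<in>{1..n}. h (x k))" by (intro prod_nonneg) (simp add: h_def laguerre_weight_nonneg)
        ultimately show ?thesis by simp
      qed
      then show "norm (laguerre_density g n x) \<le> norm (\<Prod>k\<in>{1..n}. h (x k))"
        using laguerre_density_nonneg[of g n x] by simp
    qed
  qed measurable
qed

lemma truncated_law:
  assumes g: "g > 0" and N: "N \<ge> 1"
  shows "distr (proportional_density (lborel_n n) (truncated_density g n N)) borel (\<lambda>x. \<Prod>k\<in>{1..n}. x k)
    = distr (beta_prod (\<lambda>k. g * real k) (\<lambda>_. real N / 2 + 1 + g * (real n - 1)) n) borel (\<lambda>u. real N ^ n * u)"
proof -
  have "distr (proportional_density (lborel_n n) (truncated_density g n N)) borel (\<lambda>x. \<Prod>k\<in>{1..n}. x k)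
    = distr (proportional_density (lborel_n n)
       (\<lambda>x. vandermonde_abs n x powr (2 * g) * (\<Prod>k\<in>{1..n}. indicator {0<..<real N} (x k) * x k powr (g - 1) * (1 - x k / real N) powr ((real N / 2 + 1) - 1))))
       borel (\<lambda>x. \<Prod>k\<in>{1..n}. x k)"
    unfolding truncated_density_def[abs_def] truncated_weight_def by simp
  also have "\<dots> = distr (beta_prod (\<lambda>k. g + g * (real k - 1)) (\<lambda>_. real N / 2 + 1 + g * (real n - 1)) n) borel (\<lambda>u. real N ^ n * u)"
    using g N by (intro selberg_law) auto
  also have "(\<lambda>k. g + g * (real k - 1)) = (\<lambda>k. g * real k)" by (auto simp: algebra_simps)
  finally show ?thesis .
qed

lemma truncated_density_integrable:
  assumes g: "g > 0"
  shows "integrable (lborel_n n) (truncated_density g n N)"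
proof (rule Bochner_Integration.integrable_bound[OF laguerre_density_integrable[OF g]])
  show "AE x in lborel_n n. norm (truncated_density g n N x) \<le> norm (laguerre_density g n x)"
    using truncated_density_le[of g n N] laguerre_density_nonneg[of g n] by (intro AE_I2) simp
qed measurable

text \<open>By \<open>selberg_law\<close> the normalised density pushes forward to a probability measure, which excludes total mass \<open>0\<close>.\<close>

lemma truncated_density_pos:
  assumes g: "g > 0" and N: "N \<ge> 1"
  shows "(\<integral>x. truncated_density g n N x \<partial>lborel_n n) > 0"
proof -
  let ?b = "\<lambda>_::nat. real N / 2 + 1 + g * (real n - 1)"
  let ?Q = "proportional_density (lborel_n n) (truncated_density g n N)"
  have par: "g * real k > 0 \<and> ?b k > 0" if "k \<in> {1..n}" for k
    using g N that by (auto intro!: add_pos_nonneg)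
  interpret W: prob_space "beta_prod (\<lambda>k. g * real k) ?b n"
    by (rule prob_space_beta_prod) (rule par)
  have pm [measurable]: "(\<lambda>x. \<Prod>k\<in>{1..n}. x k) \<in> borel_measurable (lborel_n n)" by measurable
  have "prob_space (distr ?Q borel (\<lambda>x. \<Prod>k\<in>{1..n}. x k))"
    unfolding truncated_law[OF g N] by (rule W.prob_space_distr) measurable
  then have one: "emeasure ?Q (space (lborel_n n)) = 1"
    using prob_space.emeasure_space_1[of "distr ?Q borel (\<lambda>x. \<Prod>k\<in>{1..n}. x k)"]
    by (subst (asm) emeasure_distr) auto
  have "(\<integral>x. truncated_density g n N x \<partial>lborel_n n) \<noteq> 0"
  proof
    assume "(\<integral>x. truncated_density g n N x \<partial>lborel_n n) = 0"
    then have "AE x in lborel_n n. truncated_density g n N x = 0"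
      using integral_nonneg_eq_0_iff_AE[OF truncated_density_integrable[OF g] AE_I2[OF truncated_density_le(1)]] by simp
    then have ae: "AE x in lborel_n n. ennreal (truncated_density g n N x) / (\<integral>\<^sup>+y. ennreal (truncated_density g n N y) \<partial>lborel_n n) = 0"
      by eventually_elim simp
    have "emeasure ?Q (space (lborel_n n)) = (\<integral>\<^sup>+x. ennreal (truncated_density g n N x) / (\<integral>\<^sup>+y. ennreal (truncated_density g n N y) \<partial>lborel_n n) \<partial>lborel_n n)"
      unfolding proportional_density_def
    proof (subst emeasure_density)
      show "(\<lambda>x. ennreal (truncated_density g n N x) / (\<integral>\<^sup>+y. ennreal (truncated_density g n N y) \<partial>lborel_n n)) \<in> borel_measurable (lborel_n n)"
        by (intro borel_measurable_divide_ennreal measurable_compose[OF truncated_density_measurable measurable_ennreal] borel_measurable_const)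
    qed (auto intro!: nn_integral_cong)
    also have "\<dots> = (\<integral>\<^sup>+x. 0 \<partial>lborel_n n)" by (rule nn_integral_cong_AE) (rule ae)
    finally show False using one by simp
  qed
  moreover have "(\<integral>x. truncated_density g n N x \<partial>lborel_n n) \<ge> 0"
    by (intro integral_nonneg_AE AE_I2 truncated_density_le)
  ultimately show ?thesis by linarith
qed

lemma laguerre_density_pos:
  assumes g: "g > 0"
  shows "(\<integral>x. laguerre_density g n x \<partial>lborel_n n) > 0"
  using truncated_density_pos[OF g, of 1 n]
    integral_mono[OF truncated_density_integrable[OF g] laguerre_density_integrable[OF g] truncated_density_le(2), of n 1]
  by simp

lemma measure_distr_proportional:
  assumes "integrable N w" "\<And>x. w x \<ge> 0" "(\<integral>x. w x \<partial>N) > 0" and [measurable]: "f \<in> borel_measurable N" "A \<in> sets borel"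
  shows "measure (distr (proportional_density N w) borel f) A = (\<integral>x. indicator A (f x) * w x \<partial>N) / (\<integral>x. w x \<partial>N)"
proof -
  have "measure (distr (proportional_density N w) borel f) A = (\<integral>y. indicator A y \<partial>distr (proportional_density N w) borel f)" by simp
  also have "\<dots> = (\<integral>x. indicator A (f x) \<partial>proportional_density N w)" by (subst integral_distr) auto
  also have "\<dots> = (\<integral>x. indicator A (f x) * w x \<partial>N) / (\<integral>x. w x \<partial>N)"
    by (rule integral_proportional_density[OF assms(1-3)]) measurable
  finally show ?thesis .
qed

lemma laguerre_det_eq:
  "laguerre_det (2 * g) n = distr (proportional_density (lborel_n n) (laguerre_density g n)) borel (\<lambda>x. \<Prod>k\<in>{1..n}. x k)"
  unfolding laguerre_det_def laguerre_ensemble_def laguerre_density_def[abs_def] laguerre_weight_def by simp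

text \<open>Dominated convergence, with the Laguerre density as the dominating function, in the numerator and in the
  normalising constant.\<close>

lemma laguerre_limit:
  assumes g: "g > 0" and A [measurable]: "A \<in> sets borel"
  shows "(\<lambda>N. measure (distr (beta_prod (\<lambda>k. g * real k) (\<lambda>_. real N / 2 + 1 + g * (real n - 1)) n) borel (\<lambda>u. real N ^ n * u)) A)
     \<longlonglongrightarrow> measure (laguerre_det (2 * g) n) A"
proof -
  have pm [measurable]: "(\<lambda>x. \<Prod>k\<in>{1..n}. x k) \<in> borel_measurable (lborel_n n)" by measurable
  have lim: "(\<lambda>N. \<integral>x. indicator S (\<Prod>k\<in>{1..n}. x k) * truncated_density g n N x \<partial>lborel_n n)
     \<longlonglongrightarrow> (\<integral>x. indicator S (\<Prod>k\<in>{1..n}. x k) * laguerre_density g n x \<partial>lborel_n n)"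
    if [measurable]: "S \<in> sets borel" for S :: "real set"
  proof (rule integral_dominated_convergence[OF _ _ laguerre_density_integrable[OF g, of n]])
    show "AE x in lborel_n n. (\<lambda>N. indicator S (\<Prod>k\<in>{1..n}. x k) * truncated_density g n N x)
       \<longlonglongrightarrow> indicator S (\<Prod>k\<in>{1..n}. x k) * laguerre_density g n x"
      by (intro AE_I2 tendsto_mult tendsto_const truncated_density_tendsto)
    show "AE x in lborel_n n. norm (indicator S (\<Prod>k\<in>{1..n}. x k) * truncated_density g n N x) \<le> laguerre_density g n x" for N
      using truncated_density_le[of g n N] laguerre_density_nonneg[of g n]
      by (intro AE_I2) (auto simp: indicator_def abs_mult)
  qed measurable
  have "(\<lambda>N. (\<integral>x. indicator A (\<Prod>k\<in>{1..n}. x k) * truncated_density g n N x \<partial>lborel_n n) / (\<integral>x. truncated_density g n N x \<partial>lborel_n n))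
    \<longlonglongrightarrow> (\<integral>x. indicator A (\<Prod>k\<in>{1..n}. x k) * laguerre_density g n x \<partial>lborel_n n) / (\<integral>x. laguerre_density g n x \<partial>lborel_n n)"
    using lim[of UNIV] laguerre_density_pos[OF g, of n] by (intro tendsto_divide lim) auto
  also have "(\<integral>x. indicator A (\<Prod>k\<in>{1..n}. x k) * laguerre_density g n x \<partial>lborel_n n) / (\<integral>x. laguerre_density g n x \<partial>lborel_n n)
     = measure (laguerre_det (2 * g) n) A"
    unfolding laguerre_det_eq
    by (rule measure_distr_proportional[symmetric, OF laguerre_density_integrable[OF g]
          laguerre_density_nonneg laguerre_density_pos[OF g] pm A])
  finally show ?thesis
  proof (rule Lim_transform_eventually)
    show "\<forall>\<^sub>F N in sequentially. (\<integral>x. indicator A (\<Prod>k\<in>{1..n}. x k) * truncated_density g n N x \<partial>lborel_n n) / (\<integral>x. truncated_density g n N x \<partial>lborel_n n)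
      = measure (distr (beta_prod (\<lambda>k. g * real k) (\<lambda>_. real N / 2 + 1 + g * (real n - 1)) n) borel (\<lambda>u. real N ^ n * u)) A"
      using eventually_ge_at_top[of 1]
    proof eventually_elim
      case (elim N)
      show ?case
        unfolding truncated_law[OF g elim, symmetric]
        by (rule measure_distr_proportional[symmetric, OF truncated_density_integrable[OF g]
              truncated_density_le(1) truncated_density_pos[OF g elim] pm A])
    qed
  qed
qed

text \<open>The normal approximation of the truncated ensembles has a constant that does not depend on \<open>N\<close>, and
  for fixed \<open>n\<close> and \<open>x\<close> the probabilities converge as \<open>N\<close> grows. The factor \<open>N ^ n\<close> and the means
  \<open>g * k / (g * k + b)\<close>, with \<open>b\<close> close to \<open>N / 2\<close>, combine to \<open>2 * g * k\<close>; this leads to the term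
  \<open>n * ln (\<beta> * n)\<close> of the centering.\<close>

theorem laguerre_kolmogorov:
  assumes g: "g > 0"
  shows "\<exists>K\<ge>0. \<forall>n\<ge>2. \<forall>x. \<bar>cdf (rescaled_log_law (2 * g) n (mu_L (2 * g) n) (laguerre_det (2 * g) n)) x - Phi x\<bar>
    \<le> K * sqrt (g / ln (real n))"
proof -
  define E where "E = 1 / g + 2"
  have E: "E \<ge> 0" using g by (simp add: E_def)
  obtain K where K: "K \<ge> 0" and kol: "\<And>n m b u x. kolmogorov_regime g E n m b u \<Longrightarrow>
    \<bar>measure (beta_prod (\<lambda>k. g * real k) b m) {z. (ln z - u) * sqrt (g / ln (real n)) \<le> x} - Phi x\<bar>
      \<le> K * sqrt (g / ln (real n))"
    using beta_prod_kolmogorov[OF g E] by blast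
  have "\<bar>cdf (rescaled_log_law (2 * g) n (mu_L (2 * g) n) (laguerre_det (2 * g) n)) x - Phi x\<bar>
    \<le> K * sqrt (g / ln (real n))" if n: "n \<ge> 2" for n x
  proof -
    define c where "c = g * (real n - 1)"
    have c: "c \<ge> 0" using g n by (simp add: c_def)
    define b where "b N = (\<lambda>_::nat. real N / 2 + 1 + c)" for N :: nat
    have bpos: "b N k > 0" for N k using c by (simp add: b_def add_pos_nonneg)
    let ?S = "{w. (ln w - mu_L (2 * g) n) * sqrt (g / ln (real n)) \<le> x}"
    let ?P = "\<lambda>N. beta_prod (\<lambda>k. g * real k) (b N) n"
    have var: "\<bar>beta_var g (b N) n - ln (real n) / g\<bar> \<le> 1 / g" for N
    proof (rule beta_var_harmonic[OF g])
      fix k assume k: "k \<in> {1..n}"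
      have "g * 1 \<le> g * real k" using g k by (intro mult_left_mono) auto
      moreover have "g * real n = g + c" by (simp add: c_def algebra_simps)
      ultimately show "g * real n \<le> g * real k + b N k" by (simp add: b_def)
    qed (use n in simp)
    have lnlim: "(\<lambda>N. \<Sum>k\<in>{1..n}. ln (real N) - ln (g * real k + b N k)) \<longlonglongrightarrow> (\<Sum>k\<in>{1..n}. ln 2)"
    proof (rule tendsto_sum)
      fix k assume k: "k \<in> {1..n}"
      have "(\<lambda>N. (g * real k + 1 + c) / real N + 1 / 2) \<longlonglongrightarrow> 0 + 1 / 2"
        by (intro tendsto_add lim_const_over_n tendsto_const)
      then have "(\<lambda>N. - ln ((g * real k + 1 + c) / real N + 1 / 2)) \<longlonglongrightarrow> - ln (0 + 1 / 2)"
        by (intro tendsto_minus tendsto_ln) auto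
      also have "- ln (0 + 1 / 2) = ln (2::real)" by (simp add: ln_div)
      finally show "(\<lambda>N. ln (real N) - ln (g * real k + b N k)) \<longlonglongrightarrow> ln 2"
      proof (rule Lim_transform_eventually)
        show "\<forall>\<^sub>F N in sequentially. - ln ((g * real k + 1 + c) / real N + 1 / 2) = ln (real N) - ln (g * real k + b N k)"
          using eventually_ge_at_top[of 1]
        proof eventually_elim
          case (elim N)
          have "(g * real k + 1 + c) / real N + 1 / 2 = (g * real k + b N k) / real N"
            using elim by (simp add: b_def field_simps)
          moreover have "g * real k + b N k > 0" using g bpos[of N k] by (intro add_nonneg_pos) auto
          ultimately show ?case using elim by (simp add: ln_div)
        qed
      qed
    qed
    have ev: "\<forall>\<^sub>F N in sequentially. \<bar>(\<Sum>k\<in>{1..n}. ln (real N) - ln (g * real k + b N k)) - real n * ln 2\<bar> < 1"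
      using tendstoD[OF lnlim, of 1] by (simp add: dist_real_def)
    have bound: "\<forall>\<^sub>F N in sequentially. \<bar>measure (distr (?P N) borel (\<lambda>u. real N ^ n * u)) ?S - Phi x\<bar> \<le> K * sqrt (g / ln (real n))"
      using ev eventually_ge_at_top[of 1]
    proof eventually_elim
      case (elim N)
      have N: "real N > 0" using elim by simp
      have par: "g * real k > 0 \<and> b N k > 0" if "k \<in> {1..n}" for k using that g bpos by auto
      interpret W: prob_space "?P N" by (rule prob_space_beta_prod) (rule par)
      have "AE z in ?P N. 0 < z \<and> z \<le> 1" by (rule AE_beta_prod) (rule par)
      then have ae: "AE z in ?P N. z \<in> {u. real N ^ n * u \<in> ?S} \<longleftrightarrow> z \<in> {z. (ln z - (mu_L (2 * g) n - real n * ln (real N))) * sqrt (g / ln (real n)) \<le> x}"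
      proof eventually_elim
        case (elim z)
        then have "ln (real N ^ n * z) = real n * ln (real N) + ln z"
          using N by (simp add: ln_mult ln_realpow)
        then show ?case by (simp add: algebra_simps)
      qed
      have "measure (distr (?P N) borel (\<lambda>u. real N ^ n * u)) ?S = measure (?P N) {u. real N ^ n * u \<in> ?S}"
        by (subst measure_distr) (auto simp: vimage_def)
      also have "\<dots> = measure (?P N) {z. (ln z - (mu_L (2 * g) n - real n * ln (real N))) * sqrt (g / ln (real n)) \<le> x}"
        by (rule measure_eq_AE[OF ae]) measurable
      also have "\<bar>\<dots> - Phi x\<bar> \<le> K * sqrt (g / ln (real n))"
      proof (rule kol, unfold kolmogorov_regime_def, intro conjI n)
        show "\<forall>k\<in>{1..n}. b N k > 0" using bpos by simp
        show "\<bar>beta_var g (b N) n - ln (real n) / g\<bar> \<le> E" using var[of N] by (simp add: E_def)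
        have "beta_center g (b N) n = (\<Sum>k\<in>{1..n}. ln (g * real k) - ln (g * real k + b N k)) - beta_var g (b N) n / 2"
          by (rule beta_center_eq[OF g]) (rule bpos)
        moreover have "(\<Sum>k\<in>{1..n}. ln (g * real k) - ln (g * real k + b N k))
          = (\<Sum>k\<in>{1..n}. ln g + ln (real k) + (ln (real N) - ln (g * real k + b N k)) - ln (real N))"
          using g by (intro sum.cong) (auto simp: ln_mult)
        moreover have "\<dots> = real n * ln g + ln (fact n) + (\<Sum>k\<in>{1..n}. ln (real N) - ln (g * real k + b N k)) - real n * ln (real N)"
          unfolding sum_subtractf sum.distrib sum_ln_upto by simp
        ultimately have ce: "beta_center g (b N) n = real n * ln g + ln (fact n)
          + (\<Sum>k\<in>{1..n}. ln (real N) - ln (g * real k + b N k)) - real n * ln (real N) - beta_var g (b N) n / 2" by simp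
        have st: "\<bar>ln (fact n) - (real n * ln (real n) - real n + ln (real n) / 2)\<bar> \<le> 1"
          using n by (intro stirling_bounded) auto
        have lnn: "ln (2 * g * real n) = ln 2 + ln g + ln (real n)" using g n by (simp add: ln_mult)
        have mu: "mu_L (2 * g) n = ln (real n) / 2 - (ln (real n) / g) / 2 - real n + (real n * ln 2 + real n * ln g + real n * ln (real n))"
          unfolding mu_L_def lnn by (simp add: algebra_simps)
        define s where "s = (\<Sum>k\<in>{1..n}. ln (real N) - ln (g * real k + b N k))"
        define q where "q = ln (real n) / g"
        define r where "r = 1 / g"
        define P1 where "P1 = real n * ln (real n)"
        define P2 where "P2 = real n * ln 2"
        define P3 where "P3 = real n * ln g"
        define P4 where "P4 = real n * ln (real N)"
        have "\<bar>s - P2\<bar> < 1" using elim(1) by (simp add: s_def P2_def)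
        then show "\<bar>mu_L (2 * g) n - real n * ln (real N) - beta_center g (b N) n\<bar> \<le> E"
          using st var[of N] g
          unfolding ce mu E_def s_def[symmetric] q_def[symmetric] r_def[symmetric] P1_def[symmetric] P2_def[symmetric] P3_def[symmetric] P4_def[symmetric]
          by linarith
      qed
      finally show ?case .
    qed
    have "(\<lambda>N. measure (distr (?P N) borel (\<lambda>u. real N ^ n * u)) ?S) \<longlonglongrightarrow> measure (laguerre_det (2 * g) n) ?S"
      unfolding b_def c_def by (rule laguerre_limit[OF g]) measurable
    then have "(\<lambda>N. \<bar>measure (distr (?P N) borel (\<lambda>u. real N ^ n * u)) ?S - Phi x\<bar>) \<longlonglongrightarrow> \<bar>measure (laguerre_det (2 * g) n) ?S - Phi x\<bar>"
      by (intro tendsto_rabs tendsto_diff tendsto_const)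
    then have "\<bar>measure (laguerre_det (2 * g) n) ?S - Phi x\<bar> \<le> K * sqrt (g / ln (real n))"
      using bound by (rule tendsto_upperbound) simp
    then show ?thesis by (subst cdf_rescaled) (auto simp: laguerre_det_def)
  qed
  then show ?thesis using K by blast
qed

section \<open>Berry-Esseen bounds for the three determinants\<close>

lemma kolmogorov_dist_le:
  assumes "\<And>x. \<bar>cdf M x - Phi x\<bar> \<le> C"
  shows "kolmogorov_dist M std_normal_distribution \<le> C"
  unfolding kolmogorov_dist_def using assms by (intro cSUP_least) (auto simp: Phi_def)

theorem theorem4p11:
  fixes \<beta> \<tau>1 \<tau>2 :: real
  assumes "\<beta> > 0" and "\<tau>1 > 0" and "\<tau>2 > 0"
  shows "\<exists>K1::real. K1 > 0 \<and> (\<forall>n::nat. n \<ge> 2 \<longrightarrow>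
    kolmogorov_dist (rescaled_log_law \<beta> n (mu_L \<beta> n) (laguerre_det \<beta> n)) std_normal_distribution
      \<le> kol_const (1 / (4 * K2 \<beta>)) 1 K1 * (\<beta> / (2 * ln (real n))) powr (1 / 2) \<and>
    kolmogorov_dist (rescaled_log_law \<beta> n (mu_G \<beta> n) (gram_det \<beta> n)) std_normal_distribution
      \<le> kol_const (1 / (4 * K2 \<beta>)) 1 K1 * (\<beta> / (2 * ln (real n))) powr (1 / 2) \<and>
    (nfloor n \<tau>1 \<ge> 1 \<and> nfloor n \<tau>2 \<ge> 1 \<longrightarrow>
      kolmogorov_dist (rescaled_log_law \<beta> n (mu_J \<beta> \<tau>1 \<tau>2 n) (jacobi_det \<beta> \<tau>1 \<tau>2 n)) std_normal_distribution
        \<le> kol_const (1 / (4 * K2 \<beta>)) 1 K1 * (\<beta> / (2 * ln (real n))) powr (1 / 2)))"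
proof -
  define g where "g = \<beta> / 2"
  have g: "g > 0" and \<beta>: "\<beta> = 2 * g" using assms(1) by (auto simp: g_def)
  obtain KL where KL: "KL \<ge> 0" "\<And>n x. n \<ge> 2 \<Longrightarrow>
      \<bar>cdf (rescaled_log_law (2 * g) n (mu_L (2 * g) n) (laguerre_det (2 * g) n)) x - Phi x\<bar> \<le> KL * sqrt (g / ln (real n))"
    using laguerre_kolmogorov[OF g] by blast
  obtain KG where KG: "KG \<ge> 0" "\<And>n x. n \<ge> 2 \<Longrightarrow>
      \<bar>cdf (rescaled_log_law (2 * g) n (mu_G (2 * g) n) (gram_det (2 * g) n)) x - Phi x\<bar> \<le> KG * sqrt (g / ln (real n))"
    using gram_kolmogorov[OF g] by blast
  obtain KJ where KJ: "KJ \<ge> 0" "\<And>n x. n \<ge> 2 \<Longrightarrow> nfloor n \<tau>1 \<ge> 1 \<Longrightarrow> nfloor n \<tau>2 \<ge> 1 \<Longrightarrow>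
      \<bar>cdf (rescaled_log_law (2 * g) n (mu_J (2 * g) \<tau>1 \<tau>2 n) (jacobi_det (2 * g) \<tau>1 \<tau>2 n)) x - Phi x\<bar> \<le> KJ * sqrt (g / ln (real n))"
    using jacobi_kolmogorov[OF g assms(2,3)] by blast
  define K where "K = KL + KG + KJ + 1"
  have K: "K > 0" "KL \<le> K" "KG \<le> K" "KJ \<le> K" using KL(1) KG(1) KJ(1) by (auto simp: K_def)
  \<comment> \<open>As \<open>Gamma (1 / 2) = sqrt pi\<close>, this makes the summand of \<open>kol_const\<close> that contains \<open>K1\<close>
     equal to \<open>K\<close>.\<close>
  define K1 where "K1 = K * (2 * pi) / (3 * sqrt pi)"
  have K1: "K1 > 0" using K by (simp add: K1_def)
  have C: "K \<le> kol_const (1 / (4 * K2 \<beta>)) 1 K1"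
  proof -
    have "K2 \<beta> > 0" using assms(1) by (simp add: K2_def add_pos_pos)
    then have "3 / (2 * pi) * (sqrt pi * K1 + 0) \<le> 3 / (2 * pi) * (sqrt pi * K1 + 7 / (1 / (4 * K2 \<beta>)) * sqrt (pi / 2))"
      by (intro mult_left_mono add_left_mono) auto
    also have "\<dots> = kol_const (1 / (4 * K2 \<beta>)) 1 K1"
      by (simp add: kol_const_def Gamma_one_half_real)
    also have "3 / (2 * pi) * (sqrt pi * K1 + 0) = K" by (simp add: K1_def)
    finally show ?thesis .
  qed
  have r: "(\<beta> / (2 * ln (real n))) powr (1 / 2) = sqrt (g / ln (real n))" if "n \<ge> 2" for n :: nat
    using that g by (simp add: powr_half_sqrt \<beta>)
  have up: "k * sqrt (g / ln (real n)) \<le> kol_const (1 / (4 * K2 \<beta>)) 1 K1 * (\<beta> / (2 * ln (real n))) powr (1 / 2)"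
    if "n \<ge> 2" "k \<le> K" for n :: nat and k
    unfolding r[OF that(1)] using that g C by (intro mult_right_mono) auto
  show ?thesis
  proof (intro exI[of _ K1] conjI allI impI K1)
    fix n :: nat assume n: "n \<ge> 2"
    show "kolmogorov_dist (rescaled_log_law \<beta> n (mu_L \<beta> n) (laguerre_det \<beta> n)) std_normal_distribution
      \<le> kol_const (1 / (4 * K2 \<beta>)) 1 K1 * (\<beta> / (2 * ln (real n))) powr (1 / 2)"
      using order_trans[OF KL(2)[OF n] up[OF n K(2)]] by (intro kolmogorov_dist_le) (simp add: \<beta>)
    show "kolmogorov_dist (rescaled_log_law \<beta> n (mu_G \<beta> n) (gram_det \<beta> n)) std_normal_distribution
      \<le> kol_const (1 / (4 * K2 \<beta>)) 1 K1 * (\<beta> / (2 * ln (real n))) powr (1 / 2)"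
      using order_trans[OF KG(2)[OF n] up[OF n K(3)]] by (intro kolmogorov_dist_le) (simp add: \<beta>)
    assume "nfloor n \<tau>1 \<ge> 1 \<and> nfloor n \<tau>2 \<ge> 1"
    then show "kolmogorov_dist (rescaled_log_law \<beta> n (mu_J \<beta> \<tau>1 \<tau>2 n) (jacobi_det \<beta> \<tau>1 \<tau>2 n)) std_normal_distribution
        \<le> kol_const (1 / (4 * K2 \<beta>)) 1 K1 * (\<beta> / (2 * ln (real n))) powr (1 / 2)"
      using order_trans[OF KJ(2)[OF n] up[OF n K(4)]] by (intro kolmogorov_dist_le) (simp add: \<beta>)
  qed
qed

end
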